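(* Let $\mathcal{H}$ be a finite-dimensional Hilbert space. Suppose the following. 1. For any $T>0$, the operators $\mathscr{A}:[0,T]\times\mathcal{H}\to\mathcal{H}$ and $\mathscr{G}:[0,T]\times\mathcal{H}\to\mathscr{L}^2(\mathfrak{U};\mathcal{H})$ are measurable. 2. There exist a function $C_\cdot:[0,\infty)\to\mathbb{R}$ bounded on $[0,T]$ for every $T$, and constants $c_i$, such that for every $\phi,\psi\in\mathcal{H}$ and $t\in[0,\infty)$, $$\|\mathscr{A}(t,\phi)\|^2_{\mathcal{H}}\le C_t[1+\|\phi\|^2_{\mathcal{H}}],\qquad\|\mathscr{G}_i(t,\phi)\|^2_{\mathcal{H}}\le C_tc_i[1+\|\phi\|^2_{\mathcal{H}}],\qquad\sum_{i=1}^\infty c_i<\infty,$$ $$\|\mathscr{A}(t,\phi)-\mathscr{A}(t,\psi)\|^2_{\mathcal{H}}+\sum_{i=1}^\infty\|\mathscr{G}_i(t,\phi)-\mathscr{G}_i(t,\psi)\|^2_{\mathcal{H}}\le C_t\|\phi-\psi\|^2_{\mathcal{H}}.$$ 3. $\Phi_0\in L^2(\Omega;\mathcal{H})$ is $\mathcal{F}_0$-measurable. Then there exists a process $\Phi:[0,\infty)\times\Omega\to\mathcal{H}$ such that for $\mathbb{P}$-a.e. $\omega$, $\Phi_\cdot(\omega)\in C([0,T];\mathcal{H})$ for every $T>0$, $\Phi$ is progressively measurable in $\mathcal{H}$, and the identity $$\Phi_t=\Phi_0+\int_0^t\mathscr{A}(s,\Phi_s)\,ds+\int_0^t\mathscr{G}(s,\Phi_s)\,d\mathcal{W}_s$$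 holds $\mathbb{P}$-a.s. in $\mathcal{H}$ for every $t\ge0$.
   Context: $(\Omega,\mathcal{F},(\mathcal{F}_t)_{t\ge0},\mathbb{P})$ is a fixed filtered probability space, complete with respect to $\mathcal{F}_0$. $\mathfrak{U}$ is a separable (infinite dimensional) Hilbert space with orthonormal basis $(e_i)$, $(W^i)$ are independent standard real Brownian motions with respect to $(\mathcal F_t)$, and $\mathcal{W}=\sum_ie_iW^i$ (formal sum) is a cylindrical Brownian motion over $\mathfrak{U}$. $\mathscr{L}^2(\mathfrak{U};\mathcal{H})$ denotes Hilbert-Schmidt operators, and $\mathscr{G}_i(t,\phi):=\mathscr{G}(t,\phi)e_i$. For a progressively measurable $\mathscr{L}^2(\mathfrak{U};\mathcal{H})$-valued process $B$ with $\mathbb{E}\int_0^T\|B(s)\|^2ds<\infty$ for all $T$, $\int_0^tB(s)d\mathcal{W}_s:=\sum_i\int_0^tB(s)e_i\,dW^i_s$, limit in $L^2(\Omega;\mathcal{H})$. If only $\int_0^T\|B(s)\|^2ds<\infty$ $\mathbb{P}$-a.s. for all $T$, the integral is defined by localisation: with $\tau_n=n\wedge\inf\{t\ge 0:\int_0^t\|B(s)\|^2ds\ge n\}$, it equals at $\omega$ the integral of $B\mathbbm{1}_{\cdot\le\tau_n}$ for any $n$ with $t\le\tau_n(\omega)$. *)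

theory Defs
  imports "HOL-Probability.Probability"
begin

section \<open>Filtered probability spaces and Brownian motion\<close>

text \<open>Time is \<^term>\<open>{0..} :: real set\<close>; nothing is required of the filtration or of processes at
  negative times. Completeness means that \<open>F 0\<close> contains every subset of every null set of \<open>M\<close>;
  no right-continuity is assumed.\<close>

locale filtered_prob_space = prob_space M for M :: "'a measure" +
  fixes F :: "real \<Rightarrow> 'a measure"
  assumes subalgebra_F: "0 \<le> t \<Longrightarrow> subalgebra M (F t)"
    and mono_F: "0 \<le> s \<Longrightarrow> s \<le> t \<Longrightarrow> sets (F s) \<subseteq> sets (F t)"
    and complete_F0: "N \<in> null_sets M \<Longrightarrow> A \<subseteq> N \<Longrightarrow> A \<in> sets (F 0)"

definition progressively_measurable ::
    "(real \<Rightarrow> 'a measure) \<Rightarrow> 'b measure \<Rightarrow> (real \<Rightarrow> 'a \<Rightarrow> 'b) \<Rightarrow> bool" where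
  "progressively_measurable F N X \<longleftrightarrow>
     (\<forall>t\<ge>0. (\<lambda>(s, \<omega>). X s \<omega>) \<in> restrict_space borel {0..t} \<Otimes>\<^sub>M F t \<rightarrow>\<^sub>M N)"

definition std_brownian_motion ::
    "'a measure \<Rightarrow> (real \<Rightarrow> 'a measure) \<Rightarrow> (real \<Rightarrow> 'a \<Rightarrow> real) \<Rightarrow> bool" where
  "std_brownian_motion M F W \<longleftrightarrow>
     (\<forall>t\<ge>0. W t \<in> borel_measurable (F t)) \<and>
     (AE \<omega> in M. W 0 \<omega> = 0) \<and>
     (AE \<omega> in M. continuous_on {0..} (\<lambda>t. W t \<omega>)) \<and>
     (\<forall>s t. 0 \<le> s \<and> s < t \<longrightarrow>
        distributed M lborel (\<lambda>\<omega>. W t \<omega> - W s \<omega>) (normal_density 0 (sqrt (t - s))) \<and>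
        prob_space.indep_set M (sets (F s))
          (sets (vimage_algebra (space M) (\<lambda>\<omega>. W t \<omega> - W s \<omega>) borel)))"

text \<open>The formal sum of the \<open>e i\<close> with coefficients \<open>W i\<close> is represented by the family \<open>W\<close> itself.
  Independence is that of the whole paths.\<close>

definition cylindrical_brownian_motion ::
    "'a measure \<Rightarrow> (real \<Rightarrow> 'a measure) \<Rightarrow> (nat \<Rightarrow> real \<Rightarrow> 'a \<Rightarrow> real) \<Rightarrow> bool" where
  "cylindrical_brownian_motion M F W \<longleftrightarrow>
     (\<forall>i. std_brownian_motion M F (W i)) \<and>
     prob_space.indep_vars M (\<lambda>_. \<Pi>\<^sub>M t\<in>{0..}. borel) (\<lambda>i \<omega>. \<lambda>t\<in>{0..}. W i t \<omega>) UNIV"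


section \<open>Hilbert--Schmidt operators\<close>

definition orthonormal_basis :: "(nat \<Rightarrow> 'u::real_inner) \<Rightarrow> bool" where
  "orthonormal_basis e \<longleftrightarrow>
     (\<forall>i j. e i \<bullet> e j = (if i = j then 1 else 0)) \<and> closure (span (range e)) = UNIV"

definition hilbert_schmidt :: "(nat \<Rightarrow> 'u::real_normed_vector) \<Rightarrow> ('u \<Rightarrow>\<^sub>L 'h::real_normed_vector) set" where
  "hilbert_schmidt e = {S. summable (\<lambda>i. (norm (blinfun_apply S (e i)))\<^sup>2)}"

definition hs_norm :: "(nat \<Rightarrow> 'u::real_normed_vector) \<Rightarrow> ('u \<Rightarrow>\<^sub>L 'h::real_normed_vector) \<Rightarrow> real" where
  "hs_norm e S = sqrt (\<Sum>i. (norm (blinfun_apply S (e i)))\<^sup>2)"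

text \<open>The Borel sigma-algebra of the Hilbert--Schmidt norm, not of the operator norm that
  underlies \<^term>\<open>borel\<close> on the type of bounded operators.\<close>

definition hs_borel :: "(nat \<Rightarrow> 'u::real_normed_vector) \<Rightarrow> ('u \<Rightarrow>\<^sub>L 'h::real_normed_vector) measure" where
  "hs_borel e = sigma (hilbert_schmidt e)
     {V. V \<subseteq> hilbert_schmidt e \<and>
         (\<forall>S\<in>V. \<exists>\<epsilon>>0. \<forall>R\<in>hilbert_schmidt e. hs_norm e (R - S) < \<epsilon> \<longrightarrow> R \<in> V)}"


section \<open>The Ito integral against a real Brownian motion\<close>

text \<open>The data \<open>n\<close>, \<open>\<tau>\<close>, \<open>\<xi>\<close> encode the elementary process that takes the value \<open>\<xi> j\<close> on
  the interval \<open>{\<tau> j<..\<tau> (Suc j)}\<close>, for \<open>j < n\<close>.\<close>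

definition elementary_process ::
    "'a measure \<Rightarrow> (real \<Rightarrow> 'a measure) \<Rightarrow> nat \<Rightarrow> (nat \<Rightarrow> real) \<Rightarrow> (nat \<Rightarrow> 'a \<Rightarrow> 'h::real_normed_vector) \<Rightarrow> bool" where
  "elementary_process M F n \<tau> \<xi> \<longleftrightarrow>
     0 \<le> \<tau> 0 \<and> (\<forall>j<n. \<tau> j \<le> \<tau> (Suc j)) \<and>
     (\<forall>j<n. \<xi> j \<in> borel_measurable (F (\<tau> j)) \<and> bounded (\<xi> j ` space M))"

definition elementary_value ::
    "nat \<Rightarrow> (nat \<Rightarrow> real) \<Rightarrow> (nat \<Rightarrow> 'a \<Rightarrow> 'h::real_normed_vector) \<Rightarrow> real \<Rightarrow> 'a \<Rightarrow> 'h" where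
  "elementary_value n \<tau> \<xi> s \<omega> = (\<Sum>j<n. indicat_real {\<tau> j<..\<tau> (Suc j)} s *\<^sub>R \<xi> j \<omega>)"

definition elementary_integral ::
    "(real \<Rightarrow> 'a \<Rightarrow> real) \<Rightarrow> nat \<Rightarrow> (nat \<Rightarrow> real) \<Rightarrow> (nat \<Rightarrow> 'a \<Rightarrow> 'h::real_normed_vector) \<Rightarrow> real \<Rightarrow> 'a \<Rightarrow> 'h" where
  "elementary_integral W n \<tau> \<xi> t \<omega> =
     (\<Sum>j<n. (W (min (\<tau> (Suc j)) t) \<omega> - W (min (\<tau> j) t) \<omega>) *\<^sub>R \<xi> j \<omega>)"

text \<open>Stochastic integrals are only determined almost surely, so they are rendered as relations:
  \<open>has_ito_integral M F W b t X\<close> says that \<open>X\<close> is a version of the integral of \<open>b\<close> over \<open>[0,t]\<close>.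
  For a square-integrable \<open>b\<close> it is the mean-square limit of the integrals of elementary
  processes that converge to \<open>b\<close>; by the isometry it does not depend on their choice.\<close>

definition has_ito_integral ::
    "'a measure \<Rightarrow> (real \<Rightarrow> 'a measure) \<Rightarrow> (real \<Rightarrow> 'a \<Rightarrow> real) \<Rightarrow>
     (real \<Rightarrow> 'a \<Rightarrow> 'h::{banach, second_countable_topology}) \<Rightarrow> real \<Rightarrow> ('a \<Rightarrow> 'h) \<Rightarrow> bool" where
  "has_ito_integral M F W b t X \<longleftrightarrow>
     progressively_measurable F borel b \<and>
     (\<forall>T>0. (\<integral>\<^sup>+\<omega>. (\<integral>\<^sup>+s\<in>{0..T}. ennreal ((norm (b s \<omega>))\<^sup>2) \<partial>lborel) \<partial>M) < \<infinity>) \<and>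
     X \<in> borel_measurable M \<and>
     (\<exists>n \<tau> \<xi>.
        (\<forall>k. elementary_process M F (n k) (\<tau> k) (\<xi> k)) \<and>
        (\<lambda>k. \<integral>\<^sup>+\<omega>. (\<integral>\<^sup>+s\<in>{0..t}.
            ennreal ((norm (elementary_value (n k) (\<tau> k) (\<xi> k) s \<omega> - b s \<omega>))\<^sup>2) \<partial>lborel) \<partial>M)
          \<longlonglongrightarrow> 0 \<and>
        (\<lambda>k. \<integral>\<^sup>+\<omega>. ennreal ((norm (elementary_integral W (n k) (\<tau> k) (\<xi> k) t \<omega> - X \<omega>))\<^sup>2) \<partial>M)
          \<longlonglongrightarrow> 0)"


section \<open>The integral against a cylindrical Brownian motion\<close>

definition hs_energy ::
    "(nat \<Rightarrow> 'u::real_normed_vector) \<Rightarrow> (real \<Rightarrow> 'a \<Rightarrow> 'u \<Rightarrow>\<^sub>L 'h::real_normed_vector) \<Rightarrow> real \<Rightarrow> 'a \<Rightarrow> ennreal" where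
  "hs_energy e B t \<omega> = (\<integral>\<^sup>+s\<in>{0..t}. ennreal ((hs_norm e (B s \<omega>))\<^sup>2) \<partial>lborel)"

definition square_integrable_process ::
    "'a measure \<Rightarrow> (real \<Rightarrow> 'a measure) \<Rightarrow> (nat \<Rightarrow> 'u::real_normed_vector) \<Rightarrow>
     (real \<Rightarrow> 'a \<Rightarrow> 'u \<Rightarrow>\<^sub>L 'h::real_normed_vector) \<Rightarrow> bool" where
  "square_integrable_process M F e B \<longleftrightarrow>
     progressively_measurable F (hs_borel e) B \<and> (\<forall>T>0. (\<integral>\<^sup>+\<omega>. hs_energy e B T \<omega> \<partial>M) < \<infinity>)"

definition locally_square_integrable_process ::
    "'a measure \<Rightarrow> (real \<Rightarrow> 'a measure) \<Rightarrow> (nat \<Rightarrow> 'u::real_normed_vector) \<Rightarrow>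
     (real \<Rightarrow> 'a \<Rightarrow> 'u \<Rightarrow>\<^sub>L 'h::real_normed_vector) \<Rightarrow> bool" where
  "locally_square_integrable_process M F e B \<longleftrightarrow>
     progressively_measurable F (hs_borel e) B \<and> (\<forall>T>0. AE \<omega> in M. hs_energy e B T \<omega> < \<infinity>)"

definition has_cylindrical_integral_L2 ::
    "'a measure \<Rightarrow> (real \<Rightarrow> 'a measure) \<Rightarrow> (nat \<Rightarrow> 'u::real_normed_vector) \<Rightarrow> (nat \<Rightarrow> real \<Rightarrow> 'a \<Rightarrow> real) \<Rightarrow>
     (real \<Rightarrow> 'a \<Rightarrow> 'u \<Rightarrow>\<^sub>L 'h::{banach, second_countable_topology}) \<Rightarrow> real \<Rightarrow> ('a \<Rightarrow> 'h) \<Rightarrow> bool" where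
  "has_cylindrical_integral_L2 M F e W B t X \<longleftrightarrow>
     square_integrable_process M F e B \<and>
     X \<in> borel_measurable M \<and>
     (\<exists>J. (\<forall>i. has_ito_integral M F (W i) (\<lambda>s \<omega>. blinfun_apply (B s \<omega>) (e i)) t (J i)) \<and>
        (\<lambda>m. \<integral>\<^sup>+\<omega>. ennreal ((norm ((\<Sum>i<m. J i \<omega>) - X \<omega>))\<^sup>2) \<partial>M) \<longlonglongrightarrow> 0)"

text \<open>Inserting \<open>n\<close> into the set realises both the minimum with \<open>n\<close> and the convention that the
  infimum of the empty set is infinite.\<close>

definition localising_time ::
    "(nat \<Rightarrow> 'u::real_normed_vector) \<Rightarrow> (real \<Rightarrow> 'a \<Rightarrow> 'u \<Rightarrow>\<^sub>L 'h::real_normed_vector) \<Rightarrow> nat \<Rightarrow> 'a \<Rightarrow> real" where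
  "localising_time e B n \<omega> = Inf (insert (real n) {t. 0 \<le> t \<and> hs_energy e B t \<omega> \<ge> of_nat n})"

definition has_cylindrical_integral ::
    "'a measure \<Rightarrow> (real \<Rightarrow> 'a measure) \<Rightarrow> (nat \<Rightarrow> 'u::real_normed_vector) \<Rightarrow> (nat \<Rightarrow> real \<Rightarrow> 'a \<Rightarrow> real) \<Rightarrow>
     (real \<Rightarrow> 'a \<Rightarrow> 'u \<Rightarrow>\<^sub>L 'h::{banach, second_countable_topology}) \<Rightarrow> real \<Rightarrow> ('a \<Rightarrow> 'h) \<Rightarrow> bool" where
  "has_cylindrical_integral M F e W B t X \<longleftrightarrow>
     (if square_integrable_process M F e B then has_cylindrical_integral_L2 M F e W B t X
      else locally_square_integrable_process M F e B \<and>
        (\<exists>Y. (\<forall>n. has_cylindrical_integral_L2 M F e W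
                (\<lambda>s \<omega>. indicat_real {..localising_time e B n \<omega>} s *\<^sub>R B s \<omega>) t (Y n)) \<and>
             (AE \<omega> in M. \<forall>n. t \<le> localising_time e B n \<omega> \<longrightarrow> X \<omega> = Y n \<omega>)))"

end

theory Submission
  imports Defs
begin

text \<open>Since the initial value is square integrable, so is the solution, and no localisation is needed:
  everything happens in mean square. A progressive integrand is approximated by its averages over the
  preceding dyadic cell, which are elementary and converge in mean square because the averaging is a
  contraction. Isometry and orthogonality of the elementary integrals give the Cauchy property, and
  the weak maximal inequality with the Borel--Cantelli lemma gives a limit with continuous paths.
  The stability estimate for this integral makes Picard iterates converge geometrically at each time;
  one further iteration turns their pointwise limit into a continuous process, which is almost surely
  equal to the limit at each time and hence solves the equation.\<close>

section \<open>Averages over the preceding dyadic cell\<close>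

text \<open>The mean is taken over the cell that ends where the interval of its use begins, so it is
  known at the left endpoint although the integrand need not be continuous. Dyadic grids are nested,
  so approximations of any two integrands at any two levels live on one grid and their difference is
  again elementary; one isometry thus serves both convergence and stability. Its delicate point is
  the orthogonality of different components: each increment is independent of the past and the paths
  are independent of one another, but joint independence of two increments from the past is not
  assumed and has to be replaced by a vanishing covariation. Integrals being determined only almost
  surely, each is tied to the canonical sequence \<open>approx_int\<close>, and estimates are read
  off before the limit. The Picard map need not contract on long intervals; the weight
  \<open>exp (8 * L * t)\<close> turns its Volterra bound into the ratio 1/8 on every
  \<open>{0..T}\<close>. This ratio is small enough for the iterates to converge almost surely at
  each time, so that \<open>lim\<close> gives one explicit progressive process for all
  horizons.\<close>

abbreviation (input) nsq :: "'h::real_normed_vector \<Rightarrow> ennreal" where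
  "nsq x \<equiv> ennreal ((norm x)\<^sup>2)"

abbreviation (input) sq_integral :: "real \<Rightarrow> (real \<Rightarrow> 'h::real_normed_vector) \<Rightarrow> ennreal" where
  "sq_integral T f \<equiv> \<integral>\<^sup>+s\<in>{0..T}. nsq (f s) \<partial>lborel"

lemma ennreal_tendsto_0_mono:
  fixes f g :: "nat \<Rightarrow> ennreal"
  assumes "g \<longlonglongrightarrow> 0" "\<And>k. f k \<le> g k"
  shows "f \<longlonglongrightarrow> 0"
  by (rule tendsto_sandwich[OF always_eventually always_eventually tendsto_const assms(1)])
     (use assms(2) in auto)

section \<open>The averaging operator and its kernel\<close>

definition cell_mean :: "nat \<Rightarrow> (real \<Rightarrow> 'h::{banach, second_countable_topology}) \<Rightarrow> int \<Rightarrow> 'h" where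
  "cell_mean k f j = (\<integral>r. (2 ^ k * indicat_real {r. \<lceil>r * 2 ^ k\<rceil> = j} r) *\<^sub>R f r \<partial>lborel)"

text \<open>The cell with index \<open>j\<close> is the half-open interval of length
  \<open>1 / 2 ^ k\<close> ending at \<open>j / 2 ^ k\<close>. A time \<open>s\<close> lies in the
  cell whose index is the ceiling of \<open>s * 2 ^ k\<close>, so the subtraction of 1 selects the
  cell that is already over when the one containing \<open>s\<close> begins.\<close>

definition past_avg :: "nat \<Rightarrow> (real \<Rightarrow> 'h::{banach, second_countable_topology}) \<Rightarrow> real \<Rightarrow> 'h" where
  "past_avg k f s = cell_mean k f (\<lceil>s * 2 ^ k\<rceil> - 1)"

text \<open>Written as an integral operator, the averaging has a doubly stochastic kernel: unit mass
  in \<open>r\<close> gives Jensen's inequality, and unit mass in \<open>s\<close> gives, through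
  Tonelli's theorem, the contraction property in mean and in mean square.\<close>

definition past_kernel :: "nat \<Rightarrow> real \<Rightarrow> real \<Rightarrow> real" where
  "past_kernel k s r = 2 ^ k * indicat_real {r. \<lceil>r * 2 ^ k\<rceil> = \<lceil>s * 2 ^ k\<rceil> - 1} r"

lemma past_avg_kernel: "past_avg k f s = (\<integral>r. past_kernel k s r *\<^sub>R f r \<partial>lborel)"
  by (simp add: past_avg_def cell_mean_def past_kernel_def)

lemma cell_eq: "{r::real. \<lceil>r * 2 ^ k\<rceil> = j} = {(of_int j - 1) / 2 ^ k <.. of_int j / 2 ^ k}"
  by (auto simp: ceiling_eq_iff field_simps)

lemma emeasure_cell: "emeasure lborel {r::real. \<lceil>r * 2 ^ k\<rceil> = j} = ennreal (1 / 2 ^ k)"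
  unfolding cell_eq by (subst emeasure_lborel_Ioc) (auto simp: field_simps)

lemma sets_cell: "{r::real. \<lceil>r * 2 ^ k\<rceil> = j} \<in> sets lborel"
  unfolding cell_eq by simp

lemma past_kernel_measurable [measurable]:
  "(\<lambda>(s, r). past_kernel k s r) \<in> borel_measurable (borel \<Otimes>\<^sub>M borel)"
proof -
  have "(\<lambda>(s, r). past_kernel k s r) =
      (\<lambda>p. 2 ^ k * (if \<lceil>snd p * 2 ^ k\<rceil> = \<lceil>fst p * 2 ^ k\<rceil> - 1 then 1 else (0::real)))"
    by (auto simp: past_kernel_def fun_eq_iff)
  then show ?thesis by simp
qed

lemma past_kernel_nonneg: "0 \<le> past_kernel k s r"
  by (simp add: past_kernel_def)

lemma past_kernel_right: "(\<integral>\<^sup>+r. ennreal (past_kernel k s r) \<partial>lborel) = 1"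
proof -
  have "(\<integral>\<^sup>+r. ennreal (past_kernel k s r) \<partial>lborel)
      = (\<integral>\<^sup>+r. ennreal (2 ^ k) * indicator {r::real. \<lceil>r * 2 ^ k\<rceil> = \<lceil>s * 2 ^ k\<rceil> - 1} r \<partial>lborel)"
    by (intro nn_integral_cong) (auto simp: past_kernel_def indicator_def)
  also have "\<dots> = ennreal (2 ^ k) * ennreal (1 / 2 ^ k)"
    by (simp only: nn_integral_cmult_indicator[OF sets_cell] emeasure_cell)
  finally show ?thesis by (simp add: ennreal_mult[symmetric])
qed

text \<open>The times \<open>s\<close> whose preceding cell contains \<open>r\<close> fill exactly
  the cell after that of \<open>r\<close>, which has the same length.\<close>

lemma past_kernel_left: "(\<integral>\<^sup>+s. ennreal (past_kernel k s r) \<partial>lborel) = 1"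
proof -
  have "(\<integral>\<^sup>+s. ennreal (past_kernel k s r) \<partial>lborel)
      = (\<integral>\<^sup>+s. ennreal (2 ^ k) * indicator {s::real. \<lceil>s * 2 ^ k\<rceil> = \<lceil>r * 2 ^ k\<rceil> + 1} s \<partial>lborel)"
    by (intro nn_integral_cong) (auto simp: past_kernel_def indicator_def)
  also have "\<dots> = ennreal (2 ^ k) * ennreal (1 / 2 ^ k)"
    by (simp only: nn_integral_cmult_indicator[OF sets_cell] emeasure_cell)
  finally show ?thesis by (simp add: ennreal_mult[symmetric])
qed

text \<open>The bound \<open>r < s\<close> is what keeps the average from anticipating; the other
  one, the width of two cells, confines the averaging error of a step function to short intervals
  after its jumps.\<close>

lemma past_kernel_support:
  assumes "past_kernel k s r \<noteq> 0"
  shows "s - 2 / 2 ^ k < r" "r < s"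
proof -
  have c: "\<lceil>r * 2 ^ k\<rceil> = \<lceil>s * 2 ^ k\<rceil> - 1"
    using assms by (auto simp: past_kernel_def indicator_def split: if_splits)
  have "s * 2 ^ k - 2 < r * 2 ^ k" "r * 2 ^ k < s * 2 ^ k"
    using c by linarith+
  then show "s - 2 / 2 ^ k < r" "r < s" by (auto simp: field_simps)
qed

lemma integrable_past_kernel: "integrable lborel (past_kernel k s)"
  by (rule integrableI_nonneg)
     (use past_kernel_nonneg past_kernel_right[of k s] in auto)

lemma past_avg_const: "(\<integral>r. past_kernel k s r *\<^sub>R (c::'h::{banach, second_countable_topology}) \<partial>lborel) = c"
proof -
  have "(\<integral>r. past_kernel k s r \<partial>lborel) = 1"
    using past_kernel_right[of k s] past_kernel_nonneg
    by (subst integral_eq_nn_integral) auto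
  then show ?thesis by (simp add: integral_scaleR_left integrable_past_kernel)
qed

text \<open>Holds without integrability because the Bochner integral of a function that is not
  integrable is 0.\<close>

lemma norm_integral_le_nn_integral:
  fixes f :: "_ \<Rightarrow> 'h::{banach, second_countable_topology}"
  shows "ennreal (norm (\<integral>x. f x \<partial>M)) \<le> (\<integral>\<^sup>+x. ennreal (norm (f x)) \<partial>M)"
  by (cases "integrable M f") (auto simp: integral_norm_bound_ennreal not_integrable_integral_eq)

lemma past_avg_measurable [measurable]:
  assumes [measurable]: "f \<in> borel_measurable borel"
  shows "past_avg k f \<in> borel_measurable borel"
proof -
  have "past_avg k f = (\<lambda>s. \<integral>r. past_kernel k s r *\<^sub>R f r \<partial>lborel)"
    by (simp add: past_avg_kernel fun_eq_iff)
  moreover have "(\<lambda>s. \<integral>r. past_kernel k s r *\<^sub>R f r \<partial>lborel) \<in> borel_measurable borel"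
    by measurable
  ultimately show ?thesis by simp
qed

lemma past_avg_L1_pt: "ennreal (norm (past_avg k f s)) \<le> (\<integral>\<^sup>+r. ennreal (past_kernel k s r) * ennreal (norm (f r)) \<partial>lborel)"
  unfolding past_avg_kernel
  by (rule order_trans[OF norm_integral_le_nn_integral])
     (auto simp: past_kernel_nonneg ennreal_mult intro!: nn_integral_mono)

lemma past_avg_L2_pt:
  assumes [measurable]: "f \<in> borel_measurable borel"
  shows "nsq (past_avg k f s) \<le> (\<integral>\<^sup>+r. ennreal (past_kernel k s r) * nsq (f r) \<partial>lborel)"
proof -
  \<comment> \<open>Splitting the kernel into two square roots makes the Cauchy-Schwarz inequality
    yield Jensen's inequality, the factor without \<open>f\<close> having total mass 1.\<close>
  have pk: "ennreal (past_kernel k s r) = ennreal (sqrt (past_kernel k s r)) * ennreal (sqrt (past_kernel k s r))" for r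
    by (simp add: ennreal_mult[symmetric] past_kernel_nonneg)
  have "nsq (past_avg k f s) = (ennreal (norm (past_avg k f s)))\<^sup>2"
    by (simp add: ennreal_power)
  also have "\<dots> \<le> (\<integral>\<^sup>+r. ennreal (past_kernel k s r) * ennreal (norm (f r)) \<partial>lborel)\<^sup>2"
    by (intro power_mono past_avg_L1_pt) auto
  also have "\<dots> = (\<integral>\<^sup>+r. ennreal (sqrt (past_kernel k s r)) * (ennreal (sqrt (past_kernel k s r)) * ennreal (norm (f r))) \<partial>lborel)\<^sup>2"
    by (simp add: pk mult.assoc)
  also have "\<dots> \<le> (\<integral>\<^sup>+r. (ennreal (sqrt (past_kernel k s r)))\<^sup>2 \<partial>lborel)
      * (\<integral>\<^sup>+r. (ennreal (sqrt (past_kernel k s r)) * ennreal (norm (f r)))\<^sup>2 \<partial>lborel)"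
    by (rule Cauchy_Schwarz_nn_integral) measurable
  also have "\<dots> = (\<integral>\<^sup>+r. ennreal (past_kernel k s r) \<partial>lborel)
      * (\<integral>\<^sup>+r. ennreal (past_kernel k s r) * nsq (f r) \<partial>lborel)"
    by (simp add: power_mult_distrib ennreal_power past_kernel_nonneg)
  finally show ?thesis by (simp add: past_kernel_right)
qed

lemma past_kernel_contraction:
  assumes [measurable]: "g \<in> borel_measurable borel"
  shows "(\<integral>\<^sup>+s. (\<integral>\<^sup>+r. ennreal (past_kernel k s r) * g r \<partial>lborel) \<partial>lborel) = (\<integral>\<^sup>+r. g r \<partial>lborel)"
proof -
  have "(\<integral>\<^sup>+s. (\<integral>\<^sup>+r. ennreal (past_kernel k s r) * g r \<partial>lborel) \<partial>lborel)
      = (\<integral>\<^sup>+r. (\<integral>\<^sup>+s. ennreal (past_kernel k s r) * g r \<partial>lborel) \<partial>lborel)"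
    by (intro lborel_pair.Fubini') measurable
  also have "\<dots> = (\<integral>\<^sup>+r. g r \<partial>lborel)"
    by (simp add: nn_integral_multc past_kernel_left)
  finally show ?thesis .
qed

lemma past_avg_L1:
  assumes [measurable]: "f \<in> borel_measurable borel"
  shows "(\<integral>\<^sup>+s. ennreal (norm (past_avg k f s)) \<partial>lborel) \<le> (\<integral>\<^sup>+s. ennreal (norm (f s)) \<partial>lborel)"
proof -
  have "(\<integral>\<^sup>+s. ennreal (norm (past_avg k f s)) \<partial>lborel) \<le>
     (\<integral>\<^sup>+s. (\<integral>\<^sup>+r. ennreal (past_kernel k s r) * ennreal (norm (f r)) \<partial>lborel) \<partial>lborel)"
    by (intro nn_integral_mono past_avg_L1_pt)
  also have "\<dots> = (\<integral>\<^sup>+s. ennreal (norm (f s)) \<partial>lborel)"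
    by (intro past_kernel_contraction) measurable
  finally show ?thesis .
qed

lemma past_avg_L2:
  assumes [measurable]: "f \<in> borel_measurable borel"
  shows "(\<integral>\<^sup>+s. nsq (past_avg k f s) \<partial>lborel) \<le> (\<integral>\<^sup>+s. nsq (f s) \<partial>lborel)"
proof -
  have "(\<integral>\<^sup>+s. nsq (past_avg k f s) \<partial>lborel) \<le>
     (\<integral>\<^sup>+s. (\<integral>\<^sup>+r. ennreal (past_kernel k s r) * nsq (f r) \<partial>lborel) \<partial>lborel)"
    by (intro nn_integral_mono past_avg_L2_pt) measurable
  also have "\<dots> = (\<integral>\<^sup>+s. nsq (f s) \<partial>lborel)"
    by (intro past_kernel_contraction) measurable
  finally show ?thesis .
qed

section \<open>Convergence of the averages in the mean\<close>

lemma integrable_kernel_scaleR: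
  assumes "integrable lborel (f :: real \<Rightarrow> 'h::{banach, second_countable_topology})"
  shows "integrable lborel (\<lambda>r. past_kernel k s r *\<^sub>R f r)"
proof (rule Bochner_Integration.integrable_bound)
  show "integrable lborel (\<lambda>r. 2 ^ k *\<^sub>R f r)" using assms by simp
  have [measurable]: "f \<in> borel_measurable borel" using assms by auto
  show "(\<lambda>r. past_kernel k s r *\<^sub>R f r) \<in> borel_measurable lborel" by measurable
  show "AE r in lborel. norm (past_kernel k s r *\<^sub>R f r) \<le> norm (2 ^ k *\<^sub>R f r)"
    by (auto simp: past_kernel_def indicator_def)
qed

lemma past_avg_add:
  assumes "integrable lborel f" "integrable lborel g"
  shows "past_avg k (\<lambda>r. f r + g r) s = past_avg k f s + past_avg k g s"
  unfolding past_avg_kernel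
  using assms by (simp add: scaleR_add_right Bochner_Integration.integral_add integrable_kernel_scaleR)

lemma past_avg_diff:
  assumes "integrable lborel f" "integrable lborel g"
  shows "past_avg k (\<lambda>r. f r - g r) s = past_avg k f s - past_avg k g s"
  unfolding past_avg_kernel
  using assms by (simp add: scaleR_diff_right Bochner_Integration.integral_diff integrable_kernel_scaleR)

text \<open>The class is closed under sums, negation and dominated limits and contains the
  indicators of bounded intervals, hence it will turn out to exhaust the integrable
  functions.\<close>

definition past_approx :: "(real \<Rightarrow> 'h::{banach, second_countable_topology}) \<Rightarrow> bool" where
  "past_approx f \<longleftrightarrow> integrable lborel f \<and>
     (\<lambda>k. \<integral>\<^sup>+s. ennreal (norm (past_avg k f s - f s)) \<partial>lborel) \<longlonglongrightarrow> 0"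

lemma past_approx_add:
  assumes "past_approx f" "past_approx g"
  shows "past_approx (\<lambda>r. f r + g r)"
proof -
  have i: "integrable lborel f" "integrable lborel g"
    and [measurable]: "f \<in> borel_measurable borel" "g \<in> borel_measurable borel"
    using assms unfolding past_approx_def by auto
  have "(\<integral>\<^sup>+s. ennreal (norm (past_avg k (\<lambda>r. f r + g r) s - (f s + g s))) \<partial>lborel)
    \<le> (\<integral>\<^sup>+s. ennreal (norm (past_avg k f s - f s)) \<partial>lborel) + (\<integral>\<^sup>+s. ennreal (norm (past_avg k g s - g s)) \<partial>lborel)" for k
  proof -
    have "(\<integral>\<^sup>+s. ennreal (norm (past_avg k (\<lambda>r. f r + g r) s - (f s + g s))) \<partial>lborel)
      \<le> (\<integral>\<^sup>+s. ennreal (norm (past_avg k f s - f s)) + ennreal (norm (past_avg k g s - g s)) \<partial>lborel)"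
      by (intro nn_integral_mono)
         (auto simp: past_avg_add i ennreal_plus[symmetric] add_diff_add simp del: ennreal_plus intro!: ennreal_leI norm_triangle_ineq)
    also have "\<dots> = (\<integral>\<^sup>+s. ennreal (norm (past_avg k f s - f s)) \<partial>lborel) + (\<integral>\<^sup>+s. ennreal (norm (past_avg k g s - g s)) \<partial>lborel)"
      by (intro nn_integral_add) measurable
    finally show ?thesis .
  qed
  moreover have "(\<lambda>k. (\<integral>\<^sup>+s. ennreal (norm (past_avg k f s - f s)) \<partial>lborel) + (\<integral>\<^sup>+s. ennreal (norm (past_avg k g s - g s)) \<partial>lborel)) \<longlonglongrightarrow> 0 + 0"
    using assms unfolding past_approx_def by (intro tendsto_add) auto
  ultimately have "(\<lambda>k. \<integral>\<^sup>+s. ennreal (norm (past_avg k (\<lambda>r. f r + g r) s - (f s + g s))) \<partial>lborel) \<longlonglongrightarrow> 0"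
    by (intro ennreal_tendsto_0_mono[where f = "\<lambda>k. \<integral>\<^sup>+s. ennreal (norm (past_avg k (\<lambda>r. f r + g r) s - (f s + g s))) \<partial>lborel"]) simp_all
  then show ?thesis using i unfolding past_approx_def by simp
qed

lemma past_approx_uminus:
  assumes "past_approx f"
  shows "past_approx (\<lambda>r. - f r)"
proof -
  have "past_avg k (\<lambda>r. - f r) s = - past_avg k f s" for k s
    by (simp add: past_avg_kernel)
  then have "norm (past_avg k (\<lambda>r. - f r) s - (- f s)) = norm (past_avg k f s - f s)" for k s
    by (simp add: norm_minus_commute)
  then show ?thesis using assms unfolding past_approx_def by simp
qed

text \<open>A three-term estimate: the averages of \<open>f - g\<close> are controlled by
  \<open>f - g\<close> itself because averaging contracts, uniformly in the level
  \<open>k\<close>.\<close>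

lemma past_approx_limit:
  assumes f: "integrable lborel f"
    and app: "\<And>\<epsilon>. \<epsilon> > (0::real) \<Longrightarrow> \<exists>g. past_approx g \<and> (\<integral>\<^sup>+s. ennreal (norm (f s - g s)) \<partial>lborel) \<le> ennreal \<epsilon>"
  shows "past_approx f"
  unfolding past_approx_def
proof (intro conjI f)
  show "(\<lambda>k. \<integral>\<^sup>+s. ennreal (norm (past_avg k f s - f s)) \<partial>lborel) \<longlonglongrightarrow> 0"
  proof (rule order_tendstoI)
    fix a :: ennreal assume "0 < a"
    then obtain e where e: "e > 0" "ennreal e < a"
    proof -
      obtain y where y: "0 < y" "y < a" using dense[OF \<open>0 < a\<close>] by auto
      then have "y < \<top>" using order.strict_trans2[OF y(2)] by simp
      then have "ennreal (enn2real y) = y" by simp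
      then show ?thesis using that[of "enn2real y"] y by (metis ennreal_0 enn2real_nonneg less_eq_real_def less_irrefl)
    qed
    obtain g where g: "past_approx g" "(\<integral>\<^sup>+s. ennreal (norm (f s - g s)) \<partial>lborel) \<le> ennreal (e / 3)"
      using app[of "e / 3"] e by auto
    have gi: "integrable lborel g" and
      [measurable]: "f \<in> borel_measurable borel" "g \<in> borel_measurable borel"
      using g f unfolding past_approx_def by auto
    have "(\<integral>\<^sup>+s. ennreal (norm (past_avg k f s - f s)) \<partial>lborel) \<le>
       ennreal (e/3) + (\<integral>\<^sup>+s. ennreal (norm (past_avg k g s - g s)) \<partial>lborel) + ennreal (e/3)" for k
    proof -
      have *: "norm (past_avg k f s - f s) \<le> norm (past_avg k (\<lambda>s. f s - g s) s) + norm (past_avg k g s - g s) + norm (f s - g s)" for s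
        unfolding past_avg_diff[OF f gi]
        using norm_triangle_ineq4[of "past_avg k f s - past_avg k g s + (past_avg k g s - g s)" "f s - g s"]
          norm_triangle_ineq[of "past_avg k f s - past_avg k g s" "past_avg k g s - g s"]
        by (simp add: algebra_simps)
      have "(\<integral>\<^sup>+s. ennreal (norm (past_avg k f s - f s)) \<partial>lborel) \<le>
        (\<integral>\<^sup>+s. ennreal (norm (past_avg k (\<lambda>s. f s - g s) s)) + ennreal (norm (past_avg k g s - g s)) + ennreal (norm (f s - g s)) \<partial>lborel)"
        by (intro nn_integral_mono)
           (use * in \<open>auto simp: ennreal_plus[symmetric] simp del: ennreal_plus intro!: ennreal_leI\<close>)
      also have "\<dots> = (\<integral>\<^sup>+s. ennreal (norm (past_avg k (\<lambda>s. f s - g s) s)) \<partial>lborel) +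
          (\<integral>\<^sup>+s. ennreal (norm (past_avg k g s - g s)) \<partial>lborel) + (\<integral>\<^sup>+s. ennreal (norm (f s - g s)) \<partial>lborel)"
        by (simp add: nn_integral_add)
      also have "\<dots> \<le> ennreal (e/3) + (\<integral>\<^sup>+s. ennreal (norm (past_avg k g s - g s)) \<partial>lborel) + ennreal (e/3)"
        by (intro add_mono order_refl g order_trans[OF past_avg_L1 g(2)]) measurable
      finally show ?thesis .
    qed
    moreover have "\<forall>\<^sub>F k in sequentially. (\<integral>\<^sup>+s. ennreal (norm (past_avg k g s - g s)) \<partial>lborel) < ennreal (e/3)"
      using g e unfolding past_approx_def by (intro order_tendstoD) auto
    ultimately show "\<forall>\<^sub>F k in sequentially. (\<integral>\<^sup>+s. ennreal (norm (past_avg k f s - f s)) \<partial>lborel) < a"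
    proof (elim eventually_mono)
      fix k assume a: "(\<integral>\<^sup>+s. ennreal (norm (past_avg k g s - g s)) \<partial>lborel) < ennreal (e/3)"
        and b: "\<And>k. (\<integral>\<^sup>+s. ennreal (norm (past_avg k f s - f s)) \<partial>lborel) \<le>
       ennreal (e/3) + (\<integral>\<^sup>+s. ennreal (norm (past_avg k g s - g s)) \<partial>lborel) + ennreal (e/3)"
      have "(\<integral>\<^sup>+s. ennreal (norm (past_avg k f s - f s)) \<partial>lborel) \<le> ennreal (e/3) + ennreal (e/3) + ennreal (e/3)"
        by (rule order_trans[OF b]) (intro add_mono order_refl less_imp_le a)
      also have "\<dots> = ennreal e" using e by (simp add: ennreal_plus[symmetric] del: ennreal_plus)
      finally show "(\<integral>\<^sup>+s. ennreal (norm (past_avg k f s - f s)) \<partial>lborel) < a" using e by simp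
    qed
  qed auto
qed

lemma past_approx_Ioc:
  assumes "a \<le> b"
  shows "past_approx (\<lambda>r. indicat_real {a<..b} r *\<^sub>R (c::'h::{banach, second_countable_topology}))"
  unfolding past_approx_def
proof (intro conjI)
  let ?f = "\<lambda>r. indicat_real {a<..b} r *\<^sub>R c"
  show "integrable lborel ?f" using assms by (intro integrable_scaleR_left) (auto simp: integrable_indicator_iff)
  \<comment> \<open>The average can differ from the value at \<open>s\<close> only if an endpoint
    separates \<open>s\<close> from a point of the cell before it, that is, if \<open>s\<close> lies
    within two cell lengths to the right of \<open>a\<close> or \<open>b\<close>.\<close>
  have pt: "norm (past_avg k ?f s - ?f s) \<le> 2 * norm c * indicat_real ({a..a + 2/2^k} \<union> {b..b+2/2^k}) s" for k s
  proof (cases "s \<in> {a..a + 2/2^k} \<union> {b..b+2/2^k}")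
    case True
    have "ennreal (norm (past_avg k ?f s)) \<le> (\<integral>\<^sup>+r. ennreal (past_kernel k s r) * ennreal (norm c) \<partial>lborel)"
      by (rule order_trans[OF past_avg_L1_pt]) (auto intro!: nn_integral_mono mult_left_mono simp: indicator_def)
    also have "\<dots> = ennreal (norm c)"
      by (subst nn_integral_multc) (auto simp: past_kernel_right)
    finally have "norm (past_avg k ?f s) \<le> norm c" by simp
    moreover have "norm (?f s) \<le> norm c" by (auto simp: indicator_def)
    ultimately have "norm (past_avg k ?f s - ?f s) \<le> 2 * norm c"
      using norm_triangle_ineq4[of "past_avg k ?f s" "?f s"] by linarith
    then show ?thesis using True by simp
  next
    case False
    have "past_avg k ?f s = (\<integral>r. past_kernel k s r *\<^sub>R ?f s \<partial>lborel)"
      unfolding past_avg_kernel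
    proof (rule Bochner_Integration.integral_cong[OF refl])
      fix r
      show "past_kernel k s r *\<^sub>R ?f r = past_kernel k s r *\<^sub>R ?f s"
      proof (cases "past_kernel k s r = 0")
        case z: False
        have "r \<in> {a<..b} \<longleftrightarrow> s \<in> {a<..b}"
          using False past_kernel_support[OF z] assms by auto
        then show ?thesis by (simp add: indicator_def)
      qed simp
    qed
    then show ?thesis using False by (simp only: past_avg_const) simp
  qed
  have bd: "(\<integral>\<^sup>+s. ennreal (norm (past_avg k ?f s - ?f s)) \<partial>lborel) \<le> ennreal (2 * norm c * (4 / 2 ^ k))" for k
  proof -
    let ?U = "{a..a + 2/2^k} \<union> {b..b+2/2^k}"
    have "emeasure lborel ?U \<le> emeasure lborel {a..a + 2/2^k} + emeasure lborel {b..b + 2/2^k}"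
      by (rule emeasure_subadditive) auto
    also have "\<dots> = ennreal (4 / 2^k)"
      by (simp add: ennreal_plus[symmetric] del: ennreal_plus)
    finally have U: "emeasure lborel ?U \<le> ennreal (4 / 2^k)" .
    have "(\<integral>\<^sup>+s. ennreal (norm (past_avg k ?f s - ?f s)) \<partial>lborel) \<le> (\<integral>\<^sup>+s. ennreal (2 * norm c) * indicator ?U s \<partial>lborel)"
      by (intro nn_integral_mono order_trans[OF ennreal_leI[OF pt]]) (auto simp: indicator_def)
    also have "\<dots> = ennreal (2 * norm c) * emeasure lborel ?U"
      by (rule nn_integral_cmult_indicator) auto
    also have "\<dots> \<le> ennreal (2 * norm c) * ennreal (4 / 2^k)" by (intro mult_left_mono U) auto
    also have "\<dots> = ennreal (2 * norm c * (4 / 2 ^ k))" by (rule ennreal_mult[symmetric]) auto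
    finally show ?thesis .
  qed
  have "(\<lambda>k. 2 * norm c * (4 * (1/2) ^ k)) \<longlonglongrightarrow> 2 * norm c * (4 * 0)"
    by (intro tendsto_intros LIMSEQ_power_zero) auto
  then have "(\<lambda>k. ennreal (2 * norm c * (4 / 2 ^ k))) \<longlonglongrightarrow> ennreal 0"
    by (intro tendsto_ennrealI) (simp add: power_one_over field_simps)
  then show "(\<lambda>k. \<integral>\<^sup>+s. ennreal (norm (past_avg k ?f s - ?f s)) \<partial>lborel) \<longlonglongrightarrow> 0"
    using ennreal_tendsto_0_mono[OF _ bd] by (simp only: ennreal_0)
qed

lemma past_approx_dominated:
  assumes [measurable]: "f \<in> borel_measurable borel" and w: "integrable lborel w"
    and g: "\<And>n. past_approx (g n)"
    and lim: "\<And>x. (\<lambda>n. g n x) \<longlonglongrightarrow> f x"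
    and bd: "\<And>n x. norm (g n x) \<le> w x"
  shows "past_approx f"
proof -
  have gm: "g n \<in> borel_measurable lborel" for n using g[of n] unfolding past_approx_def by auto
  have w0: "0 \<le> w x" for x using bd[of 0 x] norm_ge_zero order_trans by blast
  have wfin: "(\<integral>\<^sup>+x. ennreal (w x) \<partial>lborel) < \<infinity>"
    using w w0 by (simp add: integrable_iff_bounded)
  have f: "integrable lborel f"
    by (rule integrable_dominated_convergence[where s = g and w = w]) (use w lim bd gm in auto)
  have "(\<lambda>n. \<integral>\<^sup>+x. ennreal (norm (f x - g n x)) \<partial>lborel) \<longlonglongrightarrow> 0"
    using w lim bd gm wfin
    by (intro nn_integral_dominated_convergence_norm[where w = w]) auto
  show ?thesis
  proof (rule past_approx_limit[OF f])
    fix \<epsilon> :: real assume "\<epsilon> > 0"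
    have "\<forall>\<^sub>F n in sequentially. (\<integral>\<^sup>+x. ennreal (norm (f x - g n x)) \<partial>lborel) < ennreal \<epsilon>"
      by (rule order_tendstoD(2)[OF \<open>_ \<longlonglongrightarrow> 0\<close>]) (use \<open>\<epsilon> > 0\<close> in auto)
    then obtain n where "(\<integral>\<^sup>+x. ennreal (norm (f x - g n x)) \<partial>lborel) < ennreal \<epsilon>"
      by (auto simp: eventually_sequentially)
    then show "\<exists>g. past_approx g \<and> (\<integral>\<^sup>+s. ennreal (norm (f s - g s)) \<partial>lborel) \<le> ennreal \<epsilon>"
      using g[of n] by (intro exI[of _ "g n"]) auto
  qed
qed

text \<open>Dynkin induction over the half-lines, which generate the Borel sets and are stable under
  intersection. The window \<open>{-T<..T}\<close> keeps complements integrable, so that they can be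
  written as differences.\<close>

lemma past_approx_indicator_bounded:
  fixes c :: "'h::{banach, second_countable_topology}"
  assumes "A \<in> sets borel" and T: "0 \<le> T"
  shows "past_approx (\<lambda>r. indicat_real (A \<inter> {-T<..T}) r *\<^sub>R c)"
proof -
  have A: "A \<in> sigma_sets UNIV (range (\<lambda>a::real. {..a}))"
    using assms(1) unfolding borel_eq_atMost by simp
  have st: "Int_stable (range (\<lambda>a::real. {..a}))" by (auto simp: Int_stable_def)
  have po: "range (\<lambda>a::real. {..a}) \<subseteq> Pow UNIV" by simp
  from st po A show ?thesis
  proof (induct rule: sigma_sets_induct_disjoint)
    case (basic A)
    then obtain a where "A = {..a}" by auto
    then have "A \<inter> {-T<..T} = {-T<..max (-T) (min a T)}" using T by auto
    then show ?case using past_approx_Ioc[of "-T" "max (-T) (min a T)" c] by simp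
  next
    case empty show ?case using past_approx_Ioc[of 0 0 c] by simp
  next
    case (compl A)
    have "(\<lambda>r. indicat_real ((UNIV - A) \<inter> {-T<..T}) r *\<^sub>R c)
      = (\<lambda>r. indicat_real {-T<..T} r *\<^sub>R c + - (indicat_real (A \<inter> {-T<..T}) r *\<^sub>R c))"
      by (auto simp: indicator_def)
    then show ?case
      using past_approx_add[OF past_approx_Ioc[of "-T" T c] past_approx_uminus[OF compl(2)]] T by simp
  next
    case (union A)
    have [measurable]: "A i \<in> sets borel" for i using union(2) unfolding borel_eq_atMost by (auto simp: sets_measure_of)
    have fin: "past_approx (\<lambda>r. \<Sum>i<n. indicat_real (A i \<inter> {-T<..T}) r *\<^sub>R c)" for n
    proof (induction n)
      case 0 show ?case using past_approx_Ioc[of 0 0 c] by simp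
    next
      case (Suc n) then show ?case using past_approx_add[OF Suc union(3)[of n]] by simp
    qed
    have eq: "(\<Sum>i<n. indicat_real (A i \<inter> {-T<..T}) r *\<^sub>R c) = indicat_real ((\<Union>i<n. A i) \<inter> {-T<..T}) r *\<^sub>R c" for n r
    proof -
      have "indicat_real (\<Union>i<n. A i \<inter> {-T<..T}) r = (\<Sum>i<n. indicat_real (A i \<inter> {-T<..T}) r)"
        by (rule indicator_UN_disjoint) (use union(1) in \<open>auto simp: disjoint_family_on_def\<close>)
      then show ?thesis by (simp add: scaleR_sum_left)
    qed
    show ?case
    proof (rule past_approx_dominated[where w = "\<lambda>r. indicat_real {-T<..T} r *\<^sub>R norm c", OF _ _ fin])
      show "(\<lambda>r. indicat_real ((\<Union>i. A i) \<inter> {-T<..T}) r *\<^sub>R c) \<in> borel_measurable borel" by measurable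
      show "integrable lborel (\<lambda>r. indicat_real {-T<..T} r *\<^sub>R norm c)"
        using T by (intro integrable_scaleR_left) (auto simp: integrable_indicator_iff)
      fix x
      show "(\<lambda>n. \<Sum>i<n. indicat_real (A i \<inter> {-T<..T}) x *\<^sub>R c) \<longlonglongrightarrow> indicat_real ((\<Union>i. A i) \<inter> {-T<..T}) x *\<^sub>R c"
      proof (cases "x \<in> (\<Union>i. A i) \<inter> {-T<..T}")
        case True
        then obtain i where i: "x \<in> A i" by auto
        have "\<forall>\<^sub>F n in sequentially. (\<Sum>i<n. indicat_real (A i \<inter> {-T<..T}) x *\<^sub>R c) = indicat_real ((\<Union>i. A i) \<inter> {-T<..T}) x *\<^sub>R c"
          unfolding eq
          using eventually_gt_at_top[of i] by eventually_elim (use i True in \<open>auto simp: eq indicator_def\<close>)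
        then show ?thesis by (rule tendsto_eventually)
      qed (auto simp: eq indicator_def)
      fix n
      show "norm (\<Sum>i<n. indicat_real (A i \<inter> {-T<..T}) x *\<^sub>R c) \<le> indicat_real {-T<..T} x *\<^sub>R norm c"
        unfolding eq by (auto simp: indicator_def)
    qed
  qed
qed

lemma past_approx_indicator:
  fixes c :: "'h::{banach, second_countable_topology}"
  assumes [measurable]: "A \<in> sets borel" and fin: "emeasure lborel A < \<infinity>"
  shows "past_approx (\<lambda>r. indicat_real A r *\<^sub>R c)"
proof (rule past_approx_dominated[where w = "\<lambda>r. indicat_real A r *\<^sub>R norm c"
    and g = "\<lambda>n r. indicat_real (A \<inter> {- real n<..real n}) r *\<^sub>R c"])
  show "integrable lborel (\<lambda>r. indicat_real A r *\<^sub>R norm c)"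
    using fin by (intro integrable_scaleR_left) (auto simp: integrable_indicator_iff)
  show "past_approx (\<lambda>r. indicat_real (A \<inter> {- real n<..real n}) r *\<^sub>R c)" for n
    by (rule past_approx_indicator_bounded) auto
  fix x :: real
  obtain N where N: "\<bar>x\<bar> < real N" using reals_Archimedean2 by blast
  have "\<forall>\<^sub>F n in sequentially. indicat_real (A \<inter> {- real n<..real n}) x *\<^sub>R c = indicat_real A x *\<^sub>R c"
    using eventually_ge_at_top[of N] by eventually_elim (use N in \<open>auto simp: indicator_def\<close>)
  then show "(\<lambda>n. indicat_real (A \<inter> {- real n<..real n}) x *\<^sub>R c) \<longlonglongrightarrow> indicat_real A x *\<^sub>R c"
    by (rule tendsto_eventually)
qed (auto simp: indicator_def)

lemma past_approx_integrable:
  assumes "integrable lborel f"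
  shows "past_approx f"
  using assms
proof (induction rule: integrable_induct)
  case (base A c) then show ?case by (intro past_approx_indicator) auto
next
  case (add f g) then show ?case by (intro past_approx_add)
next
  case (lim f s)
  show ?case
    by (rule past_approx_dominated[where w = "\<lambda>x. 2 * norm (f x)" and g = s]) (use lim in auto)
qed

section \<open>Truncation and convergence in mean square\<close>

definition cutoff :: "nat \<Rightarrow> (real \<Rightarrow> 'h::real_normed_vector) \<Rightarrow> real \<Rightarrow> 'h" where
  "cutoff k f r = (if 0 \<le> r \<and> norm (f r) \<le> real k then f r else 0)"

lemma norm_cutoff: "norm (cutoff k f r) \<le> real k" "norm (cutoff k f r) \<le> norm (f r)"
  by (auto simp: cutoff_def)

lemma norm_cell_mean_cutoff:
  "norm (cell_mean k (cutoff k f) j) \<le> real k"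
proof -
  \<comment> \<open>At the point \<open>(j + 1) / 2 ^ k\<close> the preceding cell is the one with
    index \<open>j\<close>, so every cell mean is a value of \<open>past_avg\<close>.\<close>
  have "ennreal (norm (cell_mean k (cutoff k f) j))
      \<le> (\<integral>\<^sup>+r. ennreal (past_kernel k ((of_int j + 1) / 2 ^ k) r) * ennreal (norm (cutoff k f r)) \<partial>lborel)"
    using past_avg_L1_pt[of k "cutoff k f" "(of_int j + 1) / 2 ^ k"] by (simp add: past_avg_def)
  also have "\<dots> \<le> (\<integral>\<^sup>+r. ennreal (past_kernel k ((of_int j + 1) / 2 ^ k) r) * ennreal (real k) \<partial>lborel)"
    by (intro nn_integral_mono mult_left_mono ennreal_leI norm_cutoff) auto
  also have "\<dots> = ennreal (real k)"
    by (subst nn_integral_multc) (auto simp: past_kernel_right)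
  finally show ?thesis by simp
qed

lemma sum3_square_le:
  fixes a b c :: real
  shows "(a + b + c)\<^sup>2 \<le> 3 * a\<^sup>2 + 3 * b\<^sup>2 + 3 * c\<^sup>2"
proof -
  have "0 \<le> (a - b)\<^sup>2 + (b - c)\<^sup>2 + (a - c)\<^sup>2" by simp
  then show ?thesis by (simp add: power2_eq_square algebra_simps)
qed

lemma norm3_square_le:
  fixes x y z :: "'h::real_normed_vector"
  shows "(norm (x + y + z))\<^sup>2 \<le> 3 * (norm x)\<^sup>2 + 3 * (norm y)\<^sup>2 + 3 * (norm z)\<^sup>2"
proof -
  have "norm (x + y + z) \<le> norm x + norm y + norm z"
    using norm_triangle_ineq[of "x + y" z] norm_triangle_ineq[of x y] by linarith
  then have "(norm (x + y + z))\<^sup>2 \<le> (norm x + norm y + norm z)\<^sup>2" by (intro power_mono) auto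
  then show ?thesis using sum3_square_le[of "norm x" "norm y" "norm z"] by linarith
qed

lemma norm_past_avg_le:
  assumes "\<And>r. norm (f r) \<le> K"
  shows "norm (past_avg k f s) \<le> K"
proof -
  have K: "0 \<le> K" using assms[of 0] norm_ge_zero order_trans by blast
  have "ennreal (norm (past_avg k f s)) \<le> (\<integral>\<^sup>+r. ennreal (past_kernel k s r) * ennreal K \<partial>lborel)"
    by (rule order_trans[OF past_avg_L1_pt]) (auto intro!: nn_integral_mono mult_left_mono ennreal_leI assms)
  also have "\<dots> = ennreal K"
    by (subst nn_integral_multc) (auto simp: past_kernel_right)
  finally show ?thesis using K by simp
qed

text \<open>For a bounded function the error is at most \<open>2 * K\<close>, so its square is at
  most \<open>2 * K\<close> times its norm, and convergence in the mean suffices.\<close>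

lemma past_avg_L2_bounded:
  assumes f: "integrable lborel f" and K: "\<And>r. norm (f r) \<le> K"
  shows "(\<lambda>k. \<integral>\<^sup>+s. nsq (past_avg k f s - f s) \<partial>lborel) \<longlonglongrightarrow> 0"
proof -
  have [measurable]: "f \<in> borel_measurable borel" using f by auto
  have K0: "0 \<le> K" using K[of 0] norm_ge_zero order_trans by blast
  have "(\<integral>\<^sup>+s. nsq (past_avg k f s - f s) \<partial>lborel)
     \<le> ennreal (2 * K) * (\<integral>\<^sup>+s. ennreal (norm (past_avg k f s - f s)) \<partial>lborel)" for k
  proof -
    have "norm (past_avg k f s - f s) \<le> 2 * K" for s
      using norm_triangle_ineq4[of "past_avg k f s" "f s"] norm_past_avg_le[of f K k s, OF K] K[of s] by linarith
    then have "(\<integral>\<^sup>+s. nsq (past_avg k f s - f s) \<partial>lborel)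
      \<le> (\<integral>\<^sup>+s. ennreal (2 * K) * ennreal (norm (past_avg k f s - f s)) \<partial>lborel)"
      using K0 by (intro nn_integral_mono) (auto simp: ennreal_mult[symmetric] power2_eq_square intro!: ennreal_leI mult_right_mono)
    also have "\<dots> = ennreal (2 * K) * (\<integral>\<^sup>+s. ennreal (norm (past_avg k f s - f s)) \<partial>lborel)"
      by (intro nn_integral_cmult) measurable
    finally show ?thesis .
  qed
  moreover have "(\<lambda>k. ennreal (2 * K) * (\<integral>\<^sup>+s. ennreal (norm (past_avg k f s - f s)) \<partial>lborel)) \<longlonglongrightarrow> ennreal (2 * K) * 0"
    using past_approx_integrable[OF f] unfolding past_approx_def by (intro ennreal_tendsto_cmult) auto
  ultimately show ?thesis
    using ennreal_tendsto_0_mono by (metis (no_types, lifting) mult_zero_right)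
qed

text \<open>Truncation level and grid level grow together, so the bounded case does not apply
  directly. Comparison with a fixed level \<open>m \<le> k\<close> costs only
  \<open>f - cutoff m f\<close>, by the contraction property.\<close>

lemma past_avg_cutoff_L2:
  fixes f :: "real \<Rightarrow> 'h::{banach, second_countable_topology}"
  assumes [measurable]: "f \<in> borel_measurable borel"
    and supp: "\<And>r. r \<notin> {0..T} \<Longrightarrow> f r = 0"
    and fin: "(\<integral>\<^sup>+s. nsq (f s) \<partial>lborel) < \<infinity>"
  shows "(\<lambda>k. \<integral>\<^sup>+s. nsq (past_avg k (cutoff k f) s - f s) \<partial>lborel) \<longlonglongrightarrow> 0"
proof -
  have [measurable]: "cutoff k f \<in> borel_measurable borel" for k
    unfolding cutoff_def by measurable
  have ci: "integrable lborel (cutoff k f)" for k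
  proof (rule Bochner_Integration.integrable_bound)
    show "integrable lborel (\<lambda>r. indicat_real {0..T} r *\<^sub>R real k)"
      by (intro integrable_scaleR_left) (auto simp: integrable_indicator_iff emeasure_lborel_Icc_eq)
    show "AE r in lborel. norm (cutoff k f (r::real)) \<le> norm (indicat_real {0..T} r *\<^sub>R real k)"
      using supp by (auto simp: cutoff_def indicator_def)
  qed measurable
  define a where "a m = (\<integral>\<^sup>+s. nsq (cutoff m f s - f s) \<partial>lborel)" for m
  define c where "c m k = (\<integral>\<^sup>+s. nsq (past_avg k (cutoff m f) s - cutoff m f s) \<partial>lborel)" for m k
  have a0: "a \<longlonglongrightarrow> 0"
  proof -
    have "a \<longlonglongrightarrow> (\<integral>\<^sup>+s. 0 \<partial>(lborel :: real measure))"
      unfolding a_def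
    proof (rule nn_integral_dominated_convergence[where w = "\<lambda>s. nsq (f s)"])
      show "AE s in lborel. nsq (cutoff j f s - f s) \<le> nsq (f s)" for j
        by (auto simp: cutoff_def)
      show "AE s in lborel. (\<lambda>m. nsq (cutoff m f s - f s)) \<longlonglongrightarrow> 0"
      proof (rule AE_I2)
        fix s
        obtain N where N: "norm (f s) \<le> real N" using real_arch_simple by blast
        have "\<forall>\<^sub>F m in sequentially. nsq (cutoff m f s - f s) = 0"
          using eventually_ge_at_top[of N] by eventually_elim (use N supp[of s] in \<open>auto simp: cutoff_def\<close>)
        then show "(\<lambda>m. nsq (cutoff m f s - f s)) \<longlonglongrightarrow> 0" by (rule tendsto_eventually)
      qed
    qed (use fin in \<open>auto simp: less_top\<close>)
    then show ?thesis by simp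
  qed
  have c0: "c m \<longlonglongrightarrow> 0" for m
    unfolding c_def by (rule past_avg_L2_bounded[OF ci norm_cutoff(1)])
  have main: "(\<integral>\<^sup>+s. nsq (past_avg k (cutoff k f) s - f s) \<partial>lborel) \<le> 3 * a m + 3 * c m k + 3 * a m" if "m \<le> k" for m k
  proof -
    let ?d = "\<lambda>s. cutoff k f s - cutoff m f s"
    have "nsq (past_avg k (cutoff k f) s - f s) \<le>
      3 * nsq (past_avg k ?d s) + 3 * nsq (past_avg k (cutoff m f) s - cutoff m f s)
      + 3 * nsq (cutoff m f s - f s)" for s
      using norm3_square_le[of "past_avg k ?d s" "past_avg k (cutoff m f) s - cutoff m f s" "cutoff m f s - f s"]
      unfolding past_avg_diff[OF ci ci]
      by (auto simp: ennreal_plus[symmetric] ennreal_mult[symmetric] simp flip: ennreal_numeral simp del: ennreal_plus intro!: ennreal_leI)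
    then have "(\<integral>\<^sup>+s. nsq (past_avg k (cutoff k f) s - f s) \<partial>lborel) \<le>
      (\<integral>\<^sup>+s. 3 * nsq (past_avg k ?d s) + 3 * nsq (past_avg k (cutoff m f) s - cutoff m f s)
      + 3 * nsq (cutoff m f s - f s) \<partial>lborel)"
      by (intro nn_integral_mono) auto
    also have "\<dots> = 3 * (\<integral>\<^sup>+s. nsq (past_avg k ?d s) \<partial>lborel) + 3 * c m k + 3 * a m"
      unfolding a_def c_def by (simp add: nn_integral_add nn_integral_cmult)
    also have "\<dots> \<le> 3 * a m + 3 * c m k + 3 * a m"
    \<comment> \<open>For \<open>m \<le> k\<close> the two truncations can differ only where the
      norm of \<open>f\<close> exceeds \<open>m\<close> but not \<open>k\<close>, and there the
      difference is \<open>f\<close> itself.\<close>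
    proof (intro add_mono mult_left_mono order_refl)
      have "(\<integral>\<^sup>+s. nsq (past_avg k ?d s) \<partial>lborel) \<le> (\<integral>\<^sup>+s. nsq (?d s) \<partial>lborel)"
        by (rule past_avg_L2) measurable
      also have "\<dots> \<le> a m"
        unfolding a_def using that by (intro nn_integral_mono) (auto simp: cutoff_def)
      finally show "(\<integral>\<^sup>+s. nsq (past_avg k ?d s) \<partial>lborel) \<le> a m" .
    qed auto
    finally show ?thesis .
  qed
  show ?thesis
  proof (rule order_tendstoI)
    fix e :: ennreal assume "0 < e"
    \<comment> \<open>Each of the three error terms carries a factor 3, whence the nine
      parts.\<close>
    then have e: "0 < e / 9" by (simp add: ennreal_divide_eq_0_iff zero_less_iff_neq_zero)
    obtain m where m: "a m < e / 9" using order_tendstoD(2)[OF a0 e] by (auto simp: eventually_sequentially)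
    have "\<forall>\<^sub>F k in sequentially. c m k < e / 9" by (rule order_tendstoD(2)[OF c0 e])
    then show "\<forall>\<^sub>F k in sequentially. (\<integral>\<^sup>+s. nsq (past_avg k (cutoff k f) s - f s) \<partial>lborel) < e"
      using eventually_ge_at_top[of m]
    proof eventually_elim
      case (elim k)
      have fin: "e / 9 < \<top>" if "e < \<top>" using that by (simp add: ennreal_divide_eq_top_iff less_top[symmetric])
      show ?case
      proof (cases "e = \<top>")
        case True
        have "a m < \<top>" "c m k < \<top>" using m elim by (auto dest!: order.strict_trans2[OF _ top_greatest])
        then have "3 * a m + 3 * c m k + 3 * a m < \<top>" by (auto simp: ennreal_mult_less_top)
        then show ?thesis using main[OF elim(2)] True by (auto intro: order.strict_trans1)
      next
        case False
        then obtain e' where e': "e = ennreal e'" "e' \<ge> 0" by (cases e) auto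
        have "e / 9 = ennreal (e' / 9)" using e' by (simp add: divide_ennreal[symmetric])
        then obtain x y where "a m = ennreal x" "x < e' / 9" "x \<ge> 0" "c m k = ennreal y" "y < e' / 9" "y \<ge> 0"
          using m elim by (cases "a m"; cases "c m k") (auto simp: ennreal_less_iff)
        then have "3 * a m + 3 * c m k + 3 * a m < e"
          using e' by (auto simp: ennreal_plus[symmetric] ennreal_mult[symmetric] ennreal_less_iff simp flip: ennreal_numeral simp del: ennreal_plus)
        then show ?thesis using main[OF elim(2)] by (rule order.strict_trans1[rotated])
      qed
    qed
  qed auto
qed

text \<open>The kernel sees only times before \<open>s\<close>, and \<open>cutoff\<close> has
  already discarded the negative ones, where nothing is known about the process.\<close>

lemma past_avg_cutoff_localize:
  assumes "s \<le> T"
  shows "past_avg k (cutoff k f) s = past_avg k (cutoff k (\<lambda>r. indicat_real {0..T} r *\<^sub>R f r)) s"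
  unfolding past_avg_kernel
proof (rule Bochner_Integration.integral_cong[OF refl])
  fix r
  show "past_kernel k s r *\<^sub>R cutoff k f r = past_kernel k s r *\<^sub>R cutoff k (\<lambda>r. indicat_real {0..T} r *\<^sub>R f r) r"
    using past_kernel_support(2)[of k s r] assms by (auto simp: cutoff_def indicator_def)
qed

text \<open>Paths of a progressive process are known to be measurable only after restriction to
  \<open>{0..T}\<close>, hence the hypothesis on the extension by zero and the integrals over
  \<open>{0..T}\<close>.\<close>

lemma
  fixes f :: "real \<Rightarrow> 'h::{banach, second_countable_topology}"
  assumes meas: "(\<lambda>r. indicat_real {0..T} r *\<^sub>R f r) \<in> borel_measurable borel"
  shows past_avg_cutoff_contraction:
      "(sq_integral T (\<lambda>s. past_avg k (cutoff k f) s))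
        \<le> (sq_integral T (\<lambda>s. f s))"
    and past_avg_cutoff_tendsto:
      "(sq_integral T (\<lambda>s. f s)) < \<infinity> \<Longrightarrow>
       (\<lambda>k. sq_integral T (\<lambda>s. past_avg k (cutoff k f) s - f s)) \<longlonglongrightarrow> 0"
proof -
  define g where "g r = indicat_real {0..T} r *\<^sub>R f r" for r
  have [measurable]: "g \<in> borel_measurable borel" using meas unfolding g_def .
  have [measurable]: "cutoff k g \<in> borel_measurable borel" for k
    unfolding cutoff_def by measurable
  have loc: "past_avg k (cutoff k f) s = past_avg k (cutoff k g) s" if "s \<in> {0..T}" for k s
    using past_avg_cutoff_localize[of s T k f] that unfolding g_def by auto
  have gf: "(\<integral>\<^sup>+s. nsq (g s) \<partial>lborel) = (sq_integral T (\<lambda>s. f s))"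
    by (intro nn_integral_cong) (auto simp: g_def indicator_def)
  have "(sq_integral T (\<lambda>s. past_avg k (cutoff k f) s))
      \<le> (\<integral>\<^sup>+s. nsq (past_avg k (cutoff k g) s) \<partial>lborel)"
    by (intro nn_integral_mono) (auto simp: indicator_def loc)
  also have "\<dots> \<le> (\<integral>\<^sup>+s. nsq (cutoff k g s) \<partial>lborel)"
    by (rule past_avg_L2) measurable
  also have "\<dots> \<le> (\<integral>\<^sup>+s. nsq (g s) \<partial>lborel)"
    by (intro nn_integral_mono ennreal_leI power_mono norm_cutoff) auto
  finally show "(sq_integral T (\<lambda>s. past_avg k (cutoff k f) s))
        \<le> (sq_integral T (\<lambda>s. f s))" unfolding gf .
  assume fin: "(sq_integral T (\<lambda>s. f s)) < \<infinity>"
  have "(\<lambda>k. \<integral>\<^sup>+s. nsq (past_avg k (cutoff k g) s - g s) \<partial>lborel) \<longlonglongrightarrow> 0"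
    by (rule past_avg_cutoff_L2[where T = T]) (use fin gf in \<open>auto simp: g_def\<close>)
  moreover have le: "(sq_integral T (\<lambda>s. past_avg k (cutoff k f) s - f s))
      \<le> (\<integral>\<^sup>+s. nsq (past_avg k (cutoff k g) s - g s) \<partial>lborel)" for k
    by (intro nn_integral_mono) (auto simp: indicator_def loc g_def)
  ultimately show "(\<lambda>k. sq_integral T (\<lambda>s. past_avg k (cutoff k f) s - f s)) \<longlonglongrightarrow> 0"
    by (rule ennreal_tendsto_0_mono)
qed

section \<open>Increments of the Brownian motions\<close>

lemma product_le_squares: "\<bar>x * y\<bar> \<le> x\<^sup>2 + (y::real)\<^sup>2"
proof -
  have "0 \<le> (\<bar>x\<bar> - \<bar>y\<bar>)\<^sup>2" by simp
  then have "2 * (\<bar>x\<bar> * \<bar>y\<bar>) \<le> x\<^sup>2 + y\<^sup>2" by (simp add: power2_diff)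
  moreover have "0 \<le> \<bar>x\<bar> * \<bar>y\<bar>" by simp
  ultimately show ?thesis unfolding abs_mult by linarith
qed

lemma integrable_mult_of_squares:
  fixes f g :: "'a \<Rightarrow> real"
  assumes [measurable]: "f \<in> borel_measurable M" "g \<in> borel_measurable M"
    and i: "integrable M (\<lambda>x. (f x)\<^sup>2)" "integrable M (\<lambda>x. (g x)\<^sup>2)"
  shows "integrable M (\<lambda>x. f x * g x)"
  by (rule Bochner_Integration.integrable_bound[OF Bochner_Integration.integrable_add[OF i]])
     (use product_le_squares in auto)

locale cylindrical_bm = filtered_prob_space M F for M :: "'a measure" and F +
  fixes W :: "nat \<Rightarrow> real \<Rightarrow> 'a \<Rightarrow> real"
  assumes cylindrical: "cylindrical_brownian_motion M F W"
begin

lemma space_F: "0 \<le> t \<Longrightarrow> space (F t) = space M"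
  using subalgebra_F by (auto simp: subalgebra_def)

lemma measurable_F_M: "0 \<le> t \<Longrightarrow> f \<in> measurable (F t) N \<Longrightarrow> f \<in> measurable M N"
  using measurable_from_subalg[OF subalgebra_F] by blast

lemma subalgebra_F_F: "0 \<le> s \<Longrightarrow> s \<le> t \<Longrightarrow> subalgebra (F t) (F s)"
  using mono_F space_F by (auto simp: subalgebra_def)

lemma measurable_F_mono: "0 \<le> s \<Longrightarrow> s \<le> t \<Longrightarrow> f \<in> measurable (F s) N \<Longrightarrow> f \<in> measurable (F t) N"
  using measurable_from_subalg[OF subalgebra_F_F] by blast

lemma W_bm: "std_brownian_motion M F (W i)"
  using cylindrical by (simp add: cylindrical_brownian_motion_def)

lemma W_measurable: "0 \<le> t \<Longrightarrow> W i t \<in> borel_measurable (F t)"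
  using W_bm by (simp add: std_brownian_motion_def)

definition incr :: "nat \<Rightarrow> real \<Rightarrow> real \<Rightarrow> 'a \<Rightarrow> real" where
  "incr i a b \<omega> = W i b \<omega> - W i a \<omega>"

lemma incr_measurable: "0 \<le> a \<Longrightarrow> a \<le> b \<Longrightarrow> incr i a b \<in> borel_measurable (F b)"
  unfolding incr_def
  by (intro borel_measurable_diff W_measurable measurable_F_mono[OF _ _ W_measurable]) auto

lemma incr_measurable_M: "0 \<le> a \<Longrightarrow> a \<le> b \<Longrightarrow> incr i a b \<in> borel_measurable M"
  using incr_measurable measurable_F_M by (meson order_trans)

lemma
  assumes "0 \<le> a" "a \<le> b"
  shows integrable_incr: "integrable M (incr i a b)"
    and expectation_incr: "(\<integral>\<omega>. incr i a b \<omega> \<partial>M) = 0"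
    and integrable_incr_sq: "integrable M (\<lambda>\<omega>. (incr i a b \<omega>)\<^sup>2)"
    and expectation_incr_sq: "(\<integral>\<omega>. (incr i a b \<omega>)\<^sup>2 \<partial>M) = b - a"
proof -
  have "integrable M (incr i a b) \<and> (\<integral>\<omega>. incr i a b \<omega> \<partial>M) = 0 \<and>
    integrable M (\<lambda>\<omega>. (incr i a b \<omega>)\<^sup>2) \<and> (\<integral>\<omega>. (incr i a b \<omega>)\<^sup>2 \<partial>M) = b - a"
  \<comment> \<open>The normal law is prescribed for \<open>s < t\<close> only, since the zero
    increment has no density; the degenerate interval is therefore separate.\<close>
  proof (cases "a = b")
    case True
    then have "incr i a b = (\<lambda>_. 0)" by (simp add: incr_def fun_eq_iff)
    then show ?thesis using True by simp
  next
    case False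
    then have ab: "a < b" using assms by simp
    define \<sigma> where "\<sigma> = sqrt (b - a)"
    have \<sigma>: "\<sigma> > 0" "\<sigma>\<^sup>2 = b - a" using ab by (auto simp: \<sigma>_def)
    have D: "distributed M lborel (incr i a b) (normal_density 0 \<sigma>)"
      using W_bm[of i] ab assms unfolding std_brownian_motion_def incr_def \<sigma>_def by auto
    have 1: "integrable M (incr i a b)"
      using distributed_integrable[OF D, of "\<lambda>x. x"] integrable_normal_moment_nz_1[OF \<sigma>(1), of 0] by auto
    have 2: "(\<integral>\<omega>. incr i a b \<omega> \<partial>M) = 0"
      by (rule normal_distributed_expectation[OF \<sigma>(1) D])
    have 3: "integrable M (\<lambda>\<omega>. (incr i a b \<omega>)\<^sup>2)"
      using distributed_integrable[OF D, of "\<lambda>x. x\<^sup>2"] integrable_normal_moment[OF \<sigma>(1), of 0 2] by auto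
    have 4: "(\<integral>\<omega>. (incr i a b \<omega>)\<^sup>2 \<partial>M) = b - a"
      using normal_distributed_variance[OF \<sigma>(1) D] unfolding 2 by (simp add: \<sigma>)
    show ?thesis using 1 2 3 4 by simp
  qed
  then show "integrable M (incr i a b)" "(\<integral>\<omega>. incr i a b \<omega> \<partial>M) = 0"
    "integrable M (\<lambda>\<omega>. (incr i a b \<omega>)\<^sup>2)" "(\<integral>\<omega>. (incr i a b \<omega>)\<^sup>2 \<partial>M) = b - a" by auto
qed

text \<open>The sigma-algebra generated by \<open>\<eta>\<close> is contained in \<open>F a\<close>,
  so it inherits the independence of \<open>F a\<close> from the increment.\<close>

lemma indep_past_incr:
  assumes "0 \<le> a" "a < b" and \<eta>: "(\<eta> :: 'a \<Rightarrow> real) \<in> borel_measurable (F a)"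
  shows "indep_var borel \<eta> borel (incr i a b)"
proof -
  have ind: "indep_set (sets (F a)) (sets (vimage_algebra (space M) (incr i a b) borel))"
    using W_bm[of i] assms unfolding std_brownian_motion_def incr_def by auto
  have rv: "random_variable borel \<eta>" "random_variable borel (incr i a b)"
    using measurable_F_M[OF assms(1) \<eta>] incr_measurable_M[of a b i] assms by auto
  have 1: "sigma_sets (space M) {\<eta> -` A \<inter> space M |A. A \<in> sets borel} \<subseteq> sets (F a)"
    unfolding space_F[OF assms(1), symmetric]
    by (rule sets.sigma_sets_subset) (use \<eta> in \<open>auto dest: measurable_sets\<close>)
  have 2: "sigma_sets (space M) {incr i a b -` A \<inter> space M |A. A \<in> sets borel} = sets (vimage_algebra (space M) (incr i a b) borel)"
    by (simp add: sets_vimage_algebra)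
  show ?thesis unfolding indep_var_eq 2
    using rv ind 1 unfolding indep_sets2_eq by blast
qed

text \<open>The martingale properties of the increment and of its compensated square, tested against
  a variable known at time \<open>a\<close>. By independence, integrability of \<open>\<eta>\<close>
  is enough for the products to be integrable.\<close>

lemma
  assumes a: "0 \<le> a" "a \<le> b" and \<eta>: "(\<eta> :: 'a \<Rightarrow> real) \<in> borel_measurable (F a)" and i: "integrable M \<eta>"
  shows integrable_past_incr: "integrable M (\<lambda>\<omega>. \<eta> \<omega> * incr i a b \<omega>)"
    and expectation_past_incr: "(\<integral>\<omega>. \<eta> \<omega> * incr i a b \<omega> \<partial>M) = 0"
    and integrable_past_incr_sq: "integrable M (\<lambda>\<omega>. \<eta> \<omega> * (incr i a b \<omega>)\<^sup>2)"
    and expectation_past_incr_sq: "(\<integral>\<omega>. \<eta> \<omega> * (incr i a b \<omega>)\<^sup>2 \<partial>M) = (b - a) * (\<integral>\<omega>. \<eta> \<omega> \<partial>M)"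
proof -
  have "integrable M (\<lambda>\<omega>. \<eta> \<omega> * incr i a b \<omega>) \<and> (\<integral>\<omega>. \<eta> \<omega> * incr i a b \<omega> \<partial>M) = 0 \<and>
    integrable M (\<lambda>\<omega>. \<eta> \<omega> * (incr i a b \<omega>)\<^sup>2) \<and> (\<integral>\<omega>. \<eta> \<omega> * (incr i a b \<omega>)\<^sup>2 \<partial>M) = (b - a) * (\<integral>\<omega>. \<eta> \<omega> \<partial>M)"
  proof (cases "a = b")
    case True then show ?thesis by (auto simp: incr_def)
  next
    case False
    then have ind: "indep_var borel \<eta> borel (incr i a b)" using indep_past_incr[OF a(1) _ \<eta>] a by simp
    have ind2: "indep_var borel \<eta> borel (\<lambda>\<omega>. (incr i a b \<omega>)\<^sup>2)"
      using indep_var_compose[OF ind, of "\<lambda>x. x" borel "\<lambda>x. x\<^sup>2" borel] by (simp add: comp_def)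
    show ?thesis
      using indep_var_integrable[OF ind i integrable_incr] indep_var_integrable[OF ind2 i integrable_incr_sq]
        indep_var_lebesgue_integral[OF ind i integrable_incr] indep_var_lebesgue_integral[OF ind2 i integrable_incr_sq]
        expectation_incr[OF a, of i] expectation_incr_sq[OF a, of i] a by auto
  qed
  then show "integrable M (\<lambda>\<omega>. \<eta> \<omega> * incr i a b \<omega>)" "(\<integral>\<omega>. \<eta> \<omega> * incr i a b \<omega> \<partial>M) = 0"
    "integrable M (\<lambda>\<omega>. \<eta> \<omega> * (incr i a b \<omega>)\<^sup>2)" "(\<integral>\<omega>. \<eta> \<omega> * (incr i a b \<omega>)\<^sup>2 \<partial>M) = (b - a) * (\<integral>\<omega>. \<eta> \<omega> \<partial>M)"
    by auto
qed

text \<open>Both variables are the same functional of two independent paths. Products over two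
  intervals are what the square of a discrete covariation consists of.\<close>

lemma indep_incr_products:
  assumes "i \<noteq> j" "0 \<le> a" "0 \<le> b" "0 \<le> c" "0 \<le> d"
  shows "indep_var borel (\<lambda>\<omega>. incr i a b \<omega> * incr i c d \<omega>) borel (\<lambda>\<omega>. incr j a b \<omega> * incr j c d \<omega>)"
proof -
  let ?P = "\<Pi>\<^sub>M t\<in>{0::real..}. (borel :: real measure)"
  let ?X = "\<lambda>i \<omega>. \<lambda>t\<in>{0..}. W i t \<omega>"
  let ?g = "\<lambda>p. (p b - p a) * (p d - p c) :: real"
  have iv: "indep_vars (\<lambda>_. ?P) ?X UNIV"
    using cylindrical by (simp add: cylindrical_brownian_motion_def)
  have g: "?g \<in> borel_measurable ?P" using assms
    by (intro borel_measurable_times borel_measurable_diff measurable_component_singleton) auto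
  have "indep_vars (\<lambda>_. borel) (\<lambda>i \<omega>. ?g (?X i \<omega>)) UNIV"
    using indep_vars_compose2[OF iv, of "\<lambda>_. ?g" "\<lambda>_. borel"] g by simp
  then have "indep_vars (\<lambda>_. borel) (\<lambda>i \<omega>. incr i a b \<omega> * incr i c d \<omega>) UNIV"
    using assms by (simp add: incr_def)
  then have v: "indep_vars (\<lambda>_. borel) (\<lambda>i \<omega>. incr i a b \<omega> * incr i c d \<omega>) {i, j}"
    by (rule indep_vars_subset) auto
  have "indep_var (PiM {i} (\<lambda>_. borel)) (\<lambda>\<omega>. \<lambda>i\<in>{i}. incr i a b \<omega> * incr i c d \<omega>)
      (PiM {j} (\<lambda>_. borel)) (\<lambda>\<omega>. \<lambda>i\<in>{j}. incr i a b \<omega> * incr i c d \<omega>)"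
    by (rule indep_var_restrict[OF v]) (use assms(1) in auto)
  then have "indep_var borel ((\<lambda>p. p i) \<circ> (\<lambda>\<omega>. \<lambda>i\<in>{i}. incr i a b \<omega> * incr i c d \<omega>))
      borel ((\<lambda>p. p j) \<circ> (\<lambda>\<omega>. \<lambda>i\<in>{j}. incr i a b \<omega> * incr i c d \<omega>))"
    by (rule indep_var_compose) measurable
  then show ?thesis by (simp add: comp_def)
qed

lemma integrable_incr_mult:
  assumes "0 \<le> a" "a \<le> b" "0 \<le> c" "c \<le> d"
  shows "integrable M (\<lambda>\<omega>. incr i a b \<omega> * incr j c d \<omega>)"
  using assms by (intro integrable_mult_of_squares incr_measurable_M integrable_incr_sq)

text \<open>The product of two independent Brownian motions is a martingale for the ambient filtration
  although their increments are only separately assumed to be independent of the past: the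
  quadratic covariation, which is determined by the joint law of the paths, vanishes.\<close>

lemma expectation_past_incr_incr:
  assumes a: "0 \<le> a" "a \<le> b" and ij: "i \<noteq> j"
    and \<eta>: "(\<eta> :: 'a \<Rightarrow> real) \<in> borel_measurable (F a)" and B: "\<And>\<omega>. \<omega> \<in> space M \<Longrightarrow> \<bar>\<eta> \<omega>\<bar> \<le> B"
  shows "(\<integral>\<omega>. \<eta> \<omega> * (incr i a b \<omega> * incr j a b \<omega>) \<partial>M) = 0"
proof -
  have [measurable]: "\<eta> \<in> borel_measurable M" using measurable_F_M a \<eta> by blast
  let ?E = "\<integral>\<omega>. \<eta> \<omega> * (incr i a b \<omega> * incr j a b \<omega>) \<partial>M"
  \<comment> \<open>The interval is cut into \<open>n\<close> equal pieces. In expectation only the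
    diagonal products survive, and their sum has second moment of order \<open>1 / n\<close>;
    letting \<open>n\<close> grow forces the expectation to vanish.\<close>
  have bound: "?E\<^sup>2 \<le> B\<^sup>2 * (b - a)\<^sup>2 / real n" if n: "n > 0" for n
  proof -
    define p where "p k = a + real k * ((b - a) / real n)" for k
    define \<delta> where "\<delta> = (b - a) / real n"
    have \<delta>: "0 \<le> \<delta>" using a by (simp add: \<delta>_def)
    have p0: "p 0 = a" and pn: "p n = b" using n by (auto simp: p_def)
    have pm: "k \<le> l \<Longrightarrow> p k \<le> p l" for k l
      unfolding p_def using a by (intro add_left_mono mult_right_mono) auto
    have pa: "a \<le> p k" for k using pm[of 0 k] p0 by simp
    have p_pos: "0 \<le> p k" for k using pa[of k] a by simp
    have pS: "p (Suc k) - p k = \<delta>" for k by (simp add: p_def \<delta>_def distrib_right add_divide_distrib)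
    define d where "d h k = incr h (p k) (p (Suc k))" for h k
    have [measurable]: "d h k \<in> borel_measurable M" for h k
      unfolding d_def by (intro incr_measurable_M p_pos pm) auto
    have dsum: "incr h a b \<omega> = (\<Sum>k<n. d h k \<omega>)" for h \<omega>
      unfolding d_def incr_def using sum_lessThan_telescope[of "\<lambda>k. W h (p k) \<omega>" n] by (simp add: p0 pn)
    have dd: "integrable M (\<lambda>\<omega>. d h k \<omega> * d h' l \<omega>)" for h h' k l
      unfolding d_def by (intro integrable_incr_mult p_pos pm) auto
    have \<eta>dd: "integrable M (\<lambda>\<omega>. \<eta> \<omega> * (d h k \<omega> * d h' l \<omega>))" for h h' k l
    proof (rule Bochner_Integration.integrable_bound)
      show "integrable M (\<lambda>\<omega>. B * (d h k \<omega> * d h' l \<omega>))" using dd by simp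
      show "AE \<omega> in M. norm (\<eta> \<omega> * (d h k \<omega> * d h' l \<omega>)) \<le> norm (B * (d h k \<omega> * d h' l \<omega>))"
        using B by (intro AE_I2) (auto simp: abs_mult intro!: mult_right_mono order_trans[OF B])
    qed measurable
    \<comment> \<open>The increment over the later piece is centred given the past, and everything
      else in the product, whichever Brownian motion it comes from, is known when that piece
      begins.\<close>
    have past: "(\<integral>\<omega>. \<eta> \<omega> * (d h k \<omega> * d h' l \<omega>) \<partial>M) = 0" if "k < l" for h h' k l
    proof -
      have m: "(\<lambda>\<omega>. \<eta> \<omega> * d h k \<omega>) \<in> borel_measurable (F (p l))"
        unfolding d_def using that
        by (intro borel_measurable_times measurable_F_mono[OF _ _ \<eta>] a pa p_pos
            measurable_F_mono[OF _ _ incr_measurable] pm) auto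
      have i: "integrable M (\<lambda>\<omega>. \<eta> \<omega> * d h k \<omega>)"
      proof (rule Bochner_Integration.integrable_bound)
        show "integrable M (\<lambda>\<omega>. B * d h k \<omega>)" using integrable_incr p_pos pm unfolding d_def by simp
        show "AE \<omega> in M. norm (\<eta> \<omega> * d h k \<omega>) \<le> norm (B * d h k \<omega>)"
          using B by (intro AE_I2) (auto simp: abs_mult intro!: mult_right_mono order_trans[OF B])
      qed measurable
      show ?thesis
        using expectation_past_incr[OF p_pos pm[of l "Suc l"] m i, of h'] unfolding d_def by (simp add: mult.assoc)
    qed
    have off: "(\<integral>\<omega>. \<eta> \<omega> * (d i k \<omega> * d j l \<omega>) \<partial>M) = 0" if "k \<noteq> l" for k l
      using past[of k l i j] past[of l k j i] that by (cases k l rule: linorder_cases) (auto simp: mult.commute)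
    define S where "S \<omega> = (\<Sum>k<n. d i k \<omega> * d j k \<omega>)" for \<omega>
    have [measurable]: "S \<in> borel_measurable M" unfolding S_def by measurable
    have "?E = (\<integral>\<omega>. (\<Sum>k<n. \<Sum>l<n. \<eta> \<omega> * (d i k \<omega> * d j l \<omega>)) \<partial>M)"
      unfolding dsum sum_product by (simp only: sum_distrib_left)
    also have "\<dots> = (\<Sum>k<n. \<Sum>l<n. \<integral>\<omega>. \<eta> \<omega> * (d i k \<omega> * d j l \<omega>) \<partial>M)"
      by (simp add: Bochner_Integration.integral_sum \<eta>dd)
    also have "\<dots> = (\<Sum>k<n. \<integral>\<omega>. \<eta> \<omega> * (d i k \<omega> * d j k \<omega>) \<partial>M)"
    proof (intro sum.cong refl)
      fix k assume k: "k \<in> {..<n}"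
      show "(\<Sum>l<n. \<integral>\<omega>. \<eta> \<omega> * (d i k \<omega> * d j l \<omega>) \<partial>M) = (\<integral>\<omega>. \<eta> \<omega> * (d i k \<omega> * d j k \<omega>) \<partial>M)"
        using k by (subst sum.remove[of _ k]) (auto intro!: sum.neutral off)
    qed
    also have "\<dots> = (\<integral>\<omega>. \<eta> \<omega> * S \<omega> \<partial>M)"
      by (simp add: S_def sum_distrib_left Bochner_Integration.integral_sum \<eta>dd)
    finally have E: "?E = (\<integral>\<omega>. \<eta> \<omega> * S \<omega> \<partial>M)" .
    \<comment> \<open>The independence of the two paths enters here, and here alone: without the
      factor \<open>\<eta>\<close> the fourth-order moments factorise.\<close>
    have i4: "integrable M (\<lambda>\<omega>. (d i k \<omega> * d i l \<omega>) * (d j k \<omega> * d j l \<omega>))"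
      and e4: "(\<integral>\<omega>. (d i k \<omega> * d i l \<omega>) * (d j k \<omega> * d j l \<omega>) \<partial>M)
         = (\<integral>\<omega>. d i k \<omega> * d i l \<omega> \<partial>M) * (\<integral>\<omega>. d j k \<omega> * d j l \<omega> \<partial>M)" for k l
    proof -
      have iv: "indep_var borel (\<lambda>\<omega>. d i k \<omega> * d i l \<omega>) borel (\<lambda>\<omega>. d j k \<omega> * d j l \<omega>)"
        unfolding d_def by (intro indep_incr_products ij p_pos)
      show "integrable M (\<lambda>\<omega>. (d i k \<omega> * d i l \<omega>) * (d j k \<omega> * d j l \<omega>))"
        by (rule indep_var_integrable[OF iv dd dd])
      show "(\<integral>\<omega>. (d i k \<omega> * d i l \<omega>) * (d j k \<omega> * d j l \<omega>) \<partial>M)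
         = (\<integral>\<omega>. d i k \<omega> * d i l \<omega> \<partial>M) * (\<integral>\<omega>. d j k \<omega> * d j l \<omega> \<partial>M)"
        by (rule indep_var_lebesgue_integral[OF iv dd dd])
    qed
    have d1: "(\<integral>\<omega>. d h k \<omega> * d h l \<omega> \<partial>M) = 0" if "k < l" for h k l
      using expectation_past_incr[OF p_pos pm[of l "Suc l"], of "d h k" h] that unfolding d_def
      by (simp add: integrable_incr p_pos pm measurable_F_mono[OF _ _ incr_measurable])
    have d2: "(\<integral>\<omega>. d h k \<omega> * d h k \<omega> \<partial>M) = \<delta>" for h k
      using expectation_incr_sq[OF p_pos pm[of k "Suc k"], of h] pS[of k] unfolding d_def by (simp add: power2_eq_square)
    have S2: "(S \<omega>)\<^sup>2 = (\<Sum>k<n. \<Sum>l<n. (d i k \<omega> * d i l \<omega>) * (d j k \<omega> * d j l \<omega>))" for \<omega>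
      unfolding S_def power2_eq_square sum_product by (intro sum.cong refl) (simp add: ac_simps)
    have iS2: "integrable M (\<lambda>\<omega>. (S \<omega>)\<^sup>2)" unfolding S2 by (intro Bochner_Integration.integrable_sum i4)
    have "(\<integral>\<omega>. (S \<omega>)\<^sup>2 \<partial>M) = (\<Sum>k<n. \<Sum>l<n. (\<integral>\<omega>. d i k \<omega> * d i l \<omega> \<partial>M) * (\<integral>\<omega>. d j k \<omega> * d j l \<omega> \<partial>M))"
      unfolding S2 e4[symmetric] by (simp add: Bochner_Integration.integral_sum i4)
    also have "\<dots> = (\<Sum>k<n. \<delta> * \<delta>)"
    proof (intro sum.cong refl)
      fix k assume k: "k \<in> {..<n}"
      have z: "(\<integral>\<omega>. d h k \<omega> * d h l \<omega> \<partial>M) = 0" if "l \<noteq> k" for h l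
      proof (cases "k < l")
        case True then show ?thesis by (rule d1)
      next
        case False
        then have "l < k" using that by simp
        from d1[OF this, of h] show ?thesis by (simp add: mult.commute)
      qed
      show "(\<Sum>l<n. (\<integral>\<omega>. d i k \<omega> * d i l \<omega> \<partial>M) * (\<integral>\<omega>. d j k \<omega> * d j l \<omega> \<partial>M)) = \<delta> * \<delta>"
        using k by (subst sum.remove[of _ k]) (auto intro!: sum.neutral simp: d2 z)
    qed
    also have "\<dots> = (b - a)\<^sup>2 / real n" using n by (simp add: \<delta>_def power2_eq_square)
    finally have ES2: "(\<integral>\<omega>. (S \<omega>)\<^sup>2 \<partial>M) = (b - a)\<^sup>2 / real n" .
    have sqle: "(\<eta> \<omega> * S \<omega>)\<^sup>2 \<le> B\<^sup>2 * (S \<omega>)\<^sup>2" if "\<omega> \<in> space M" for \<omega>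
      unfolding power_mult_distrib using B[OF that] by (intro mult_right_mono) (auto simp: abs_le_square_iff[symmetric])
    have iX2: "integrable M (\<lambda>\<omega>. (\<eta> \<omega> * S \<omega>)\<^sup>2)"
    proof (rule Bochner_Integration.integrable_bound)
      show "integrable M (\<lambda>\<omega>. B\<^sup>2 * (S \<omega>)\<^sup>2)" using iS2 by simp
      show "AE \<omega> in M. norm ((\<eta> \<omega> * S \<omega>)\<^sup>2) \<le> norm (B\<^sup>2 * (S \<omega>)\<^sup>2)"
        by (rule AE_I2) (use sqle in simp)
    qed measurable
    have iX: "integrable M (\<lambda>\<omega>. \<eta> \<omega> * S \<omega>)"
      by (rule square_integrable_imp_integrable[OF _ iX2]) measurable
    \<comment> \<open>Nonnegativity of the variance: the square of a mean is at most the mean of the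
      square.\<close>
    have "?E\<^sup>2 \<le> (\<integral>\<omega>. (\<eta> \<omega> * S \<omega>)\<^sup>2 \<partial>M)"
      unfolding E using variance_eq[OF iX iX2] variance_positive[of "\<lambda>\<omega>. \<eta> \<omega> * S \<omega>"] by linarith
    also have "\<dots> \<le> (\<integral>\<omega>. B\<^sup>2 * (S \<omega>)\<^sup>2 \<partial>M)"
      by (intro integral_mono iX2 sqle) (use iS2 in auto)
    also have "\<dots> = B\<^sup>2 * (b - a)\<^sup>2 / real n" by (simp add: ES2)
    finally show ?thesis .
  qed
  have "(\<lambda>n. B\<^sup>2 * (b - a)\<^sup>2 / real n) \<longlonglongrightarrow> 0" by (rule lim_const_over_n)
  then have "?E\<^sup>2 \<le> 0"
    by (rule LIMSEQ_le_const) (use bound in \<open>auto intro!: exI[of _ 1]\<close>)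
  then show ?thesis by simp
qed

end

section \<open>Dyadic refinement and the maximal inequality\<close>

text \<open>Inside a coarse cell the coefficient is constant and the fine increments of
  \<open>g\<close> telescope. The function \<open>g\<close> is left free so that the stopped path
  and the step function of \<open>indicator_Ioc_diff\<close> are both instances.\<close>

lemma refine_sum:
  fixes g :: "real \<Rightarrow> real" and x :: "nat \<Rightarrow> 'h::real_vector"
  shows "(\<Sum>j<n * 2 ^ d. (g (real (Suc j) / 2 ^ (k + d)) - g (real j / 2 ^ (k + d))) *\<^sub>R x (j div 2 ^ d))
    = (\<Sum>j<n. (g (real (Suc j) / 2 ^ k) - g (real j / 2 ^ k)) *\<^sub>R x j)"
proof -
  let ?q = "2 ^ d :: nat"
  let ?h = "\<lambda>j. g (real j / 2 ^ (k + d))"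
  have "(\<Sum>j<n * ?q. (?h (Suc j) - ?h j) *\<^sub>R x (j div ?q))
    = (\<Sum>m<n. \<Sum>j\<in>{m * ?q..<m * ?q + ?q}. (?h (Suc j) - ?h j) *\<^sub>R x (j div ?q))"
    by (rule sum.nat_group[symmetric])
  also have "\<dots> = (\<Sum>m<n. (g (real (Suc m) / 2 ^ k) - g (real m / 2 ^ k)) *\<^sub>R x m)"
  proof (intro sum.cong refl)
    fix m
    have "(\<Sum>j\<in>{m * ?q..<m * ?q + ?q}. (?h (Suc j) - ?h j) *\<^sub>R x (j div ?q))
      = (\<Sum>j\<in>{m * ?q..<m * ?q + ?q}. (?h (Suc j) - ?h j) *\<^sub>R x m)"
    proof (intro sum.cong refl)
      fix j assume j: "j \<in> {m * ?q..<m * ?q + ?q}"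
      have "j div ?q = m" using j by (intro div_nat_eqI) (auto simp: mult.commute)
      then show "(?h (Suc j) - ?h j) *\<^sub>R x (j div ?q) = (?h (Suc j) - ?h j) *\<^sub>R x m" by simp
    qed
    also have "\<dots> = (\<Sum>j\<in>{m * ?q..<m * ?q + ?q}. ?h (Suc j) - ?h j) *\<^sub>R x m"
      by (rule scaleR_sum_left[symmetric])
    also have "(\<Sum>j\<in>{m * ?q..<m * ?q + ?q}. ?h (Suc j) - ?h j) = ?h (m * ?q + ?q) - ?h (m * ?q)"
      by (rule sum_Suc_diff') simp
    also have "real (m * ?q + ?q) / 2 ^ (k + d) = real (Suc m) / 2 ^ k"
      by (simp add: field_simps power_add)
    also have "real (m * ?q) / 2 ^ (k + d) = real m / 2 ^ k"
      by (simp add: field_simps power_add)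
    finally show "(\<Sum>j\<in>{m * ?q..<m * ?q + ?q}. (?h (Suc j) - ?h j) *\<^sub>R x (j div ?q))
      = (g (real (Suc m) / 2 ^ k) - g (real m / 2 ^ k)) *\<^sub>R x m" .
  qed
  finally show ?thesis .
qed

abbreviation dyadic :: "nat \<Rightarrow> nat \<Rightarrow> real" where
  "dyadic k j \<equiv> real j / 2 ^ k"

lemma elementary_integral_refine:
  "elementary_integral w (n * 2 ^ d) (dyadic (k + d)) (\<lambda>j. \<xi> (j div 2 ^ d)) t \<omega>
    = elementary_integral w n (dyadic k) \<xi> t \<omega>"
  unfolding elementary_integral_def
  using refine_sum[where g = "\<lambda>x. w (min x t) \<omega>" and n = n and d = d and k = k and x = "\<lambda>j. \<xi> j \<omega>"] by simp

text \<open>The value of an elementary process at \<open>s\<close> thereby becomes a sum of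
  increments of the step function that jumps to 1 at \<open>s\<close>, and \<open>refine_sum\<close>
  applies to it.\<close>

lemma indicator_Ioc_diff: "a \<le> b \<Longrightarrow> indicat_real {a<..b} s = indicat_real {s..} b - indicat_real {s..} (a::real)"
  by (auto simp: indicator_def)

lemma elementary_value_refine:
  "elementary_value (n * 2 ^ d) (dyadic (k + d)) (\<lambda>j. \<xi> (j div 2 ^ d)) s \<omega>
    = elementary_value n (dyadic k) \<xi> s \<omega>"
proof -
  have "indicat_real {dyadic k j<..dyadic k (Suc j)} s = indicat_real {s..} (dyadic k (Suc j)) - indicat_real {s..} (dyadic k j)" for k j
    by (rule indicator_Ioc_diff) (simp add: field_simps)
  then show ?thesis
    unfolding elementary_value_def
    using refine_sum[where g = "\<lambda>x. indicat_real {s..} x" and n = n and d = d and k = k and x = "\<lambda>j. \<xi> j \<omega>"] by simp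
qed

lemma elementary_integral_extend:
  assumes "n \<le> n'" "t \<le> dyadic k n"
  shows "elementary_integral w n' (dyadic k) \<xi> t \<omega> = elementary_integral w n (dyadic k) \<xi> t \<omega>"
  unfolding elementary_integral_def
proof (rule sum.mono_neutral_right)
  show "\<forall>j\<in>{..<n'} - {..<n}. (w (min (dyadic k (Suc j)) t) \<omega> - w (min (dyadic k j) t) \<omega>) *\<^sub>R \<xi> j \<omega> = 0"
  proof
    fix j assume "j \<in> {..<n'} - {..<n}"
    then have "dyadic k n \<le> dyadic k j" "dyadic k n \<le> dyadic k (Suc j)" by (auto simp: divide_right_mono)
    then have "min (dyadic k (Suc j)) t = t" "min (dyadic k j) t = t" using assms(2) by auto
    then show "(w (min (dyadic k (Suc j)) t) \<omega> - w (min (dyadic k j) t) \<omega>) *\<^sub>R \<xi> j \<omega> = 0" by simp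
  qed
qed (use assms in auto)

lemma elementary_process_refine:
  assumes "elementary_process M F n (dyadic k) \<xi>"
    and mono: "\<And>s t. 0 \<le> s \<Longrightarrow> s \<le> t \<Longrightarrow> subalgebra (F t) (F s)"
  shows "elementary_process M F (n * 2 ^ d) (dyadic (k + d)) (\<lambda>j. \<xi> (j div 2 ^ d))"
  unfolding elementary_process_def
proof (intro conjI allI impI)
  fix j assume j: "j < n * 2 ^ d"
  have jd: "j div 2 ^ d < n" using j by (simp add: div_less_iff_less_mult)
  have "real (j div 2 ^ d) * 2 ^ d \<le> real j"
    by (metis div_times_less_eq_dividend of_nat_le_iff of_nat_mult of_nat_numeral of_nat_power)
  then have le: "dyadic k (j div 2 ^ d) \<le> dyadic (k + d) j" by (simp add: field_simps power_add)
  have "\<xi> (j div 2 ^ d) \<in> borel_measurable (F (dyadic k (j div 2 ^ d)))"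
    using assms(1) jd unfolding elementary_process_def by blast
  then show "\<xi> (j div 2 ^ d) \<in> borel_measurable (F (dyadic (k + d) j))"
    by (rule measurable_from_subalg[OF mono[OF _ le], rotated]) simp
  show "bounded (\<xi> (j div 2 ^ d) ` space M)"
    using assms(1) jd unfolding elementary_process_def by auto
qed (auto simp: field_simps)

section \<open>Square-integrable vectors and the weak maximal inequality\<close>

lemma inner_product_le_squares: "\<bar>x \<bullet> y\<bar> \<le> (norm x)\<^sup>2 + (norm (y::'h::real_inner))\<^sup>2"
  using Cauchy_Schwarz_ineq2[of x y] product_le_squares[of "norm x" "norm y"] by (simp add: abs_mult)

lemma integrable_inner_of_squares:
  fixes f g :: "'a \<Rightarrow> 'h::{real_inner, second_countable_topology}"
  assumes [measurable]: "f \<in> borel_measurable M" "g \<in> borel_measurable M"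
    and i: "integrable M (\<lambda>x. (norm (f x))\<^sup>2)" "integrable M (\<lambda>x. (norm (g x))\<^sup>2)"
  shows "integrable M (\<lambda>x. f x \<bullet> g x)"
  by (rule Bochner_Integration.integrable_bound[OF Bochner_Integration.integrable_add[OF i]])
     (use inner_product_le_squares in auto)

lemma norm_add_sq_le: "(norm (x + y))\<^sup>2 \<le> 2 * (norm x)\<^sup>2 + 2 * (norm (y::'h::real_normed_vector))\<^sup>2"
proof -
  have "(norm (x + y))\<^sup>2 \<le> (norm x + norm y)\<^sup>2" by (intro power_mono norm_triangle_ineq) auto
  also have "\<dots> \<le> 2 * (norm x)\<^sup>2 + 2 * (norm y)\<^sup>2"
    using zero_le_power2[of "norm x - norm y"] by (simp add: power2_sum power2_diff)
  finally show ?thesis .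
qed

lemma integrable_norm_sq_add:
  fixes f g :: "'a \<Rightarrow> 'h::{banach, second_countable_topology}"
  assumes [measurable]: "f \<in> borel_measurable M" "g \<in> borel_measurable M"
    and i: "integrable M (\<lambda>x. (norm (f x))\<^sup>2)" "integrable M (\<lambda>x. (norm (g x))\<^sup>2)"
  shows "integrable M (\<lambda>x. (norm (f x + g x))\<^sup>2)"
proof (rule Bochner_Integration.integrable_bound)
  show "integrable M (\<lambda>x. 2 * (norm (f x))\<^sup>2 + 2 * (norm (g x))\<^sup>2)" using i by simp
  show "AE x in M. norm ((norm (f x + g x))\<^sup>2) \<le> norm (2 * (norm (f x))\<^sup>2 + 2 * (norm (g x))\<^sup>2)"
    using norm_add_sq_le by (intro AE_I2) simp
qed measurable

lemma integrable_norm_sq_sum: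
  fixes f :: "'i \<Rightarrow> 'a \<Rightarrow> 'h::{banach, second_countable_topology}"
  assumes "finite I" "\<And>i. i \<in> I \<Longrightarrow> f i \<in> borel_measurable M"
    and "\<And>i. i \<in> I \<Longrightarrow> integrable M (\<lambda>x. (norm (f i x))\<^sup>2)"
  shows "integrable M (\<lambda>x. (norm (\<Sum>i\<in>I. f i x))\<^sup>2)"
  using assms by (induction I) (auto intro!: integrable_norm_sq_add borel_measurable_sum)

text \<open>Doob's argument for vector-valued martingales. The martingale property appears as
  orthogonality of \<open>XT - X l\<close> to the square-integrable vectors known at stage
  \<open>l\<close>; it is applied to \<open>X l\<close> restricted to the event that
  \<open>l\<close> is the first index of exceedance.\<close>

lemma (in prob_space) doob_weak_finite:
  fixes X :: "nat \<Rightarrow> 'a \<Rightarrow> 'h::{real_inner, banach, second_countable_topology}"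
  assumes sub: "\<And>l. l \<le> n \<Longrightarrow> subalgebra M (G l)" "\<And>l l'. l' \<le> l \<Longrightarrow> l \<le> n \<Longrightarrow> subalgebra (G l) (G l')"
    and X: "\<And>l. l \<le> n \<Longrightarrow> X l \<in> borel_measurable (G l)"
    and XT [measurable]: "XT \<in> borel_measurable M"
    and X2: "\<And>l. l \<le> n \<Longrightarrow> integrable M (\<lambda>\<omega>. (norm (X l \<omega>))\<^sup>2)" and XT2: "integrable M (\<lambda>\<omega>. (norm (XT \<omega>))\<^sup>2)"
    and orth: "\<And>l \<eta>. l \<le> n \<Longrightarrow> \<eta> \<in> borel_measurable (G l) \<Longrightarrow> integrable M (\<lambda>\<omega>. (norm (\<eta> \<omega>))\<^sup>2) \<Longrightarrow>
        (\<integral>\<omega>. (XT \<omega> - X l \<omega>) \<bullet> \<eta> \<omega> \<partial>M) = 0"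
    and K: "0 \<le> K"
  shows "K\<^sup>2 * prob {\<omega>\<in>space M. \<exists>l\<le>n. norm (X l \<omega>) > K} \<le> (\<integral>\<omega>. (norm (XT \<omega>))\<^sup>2 \<partial>M)"
proof -
  have XM [measurable]: "l \<le> n \<Longrightarrow> X l \<in> borel_measurable M" for l
    using measurable_from_subalg[OF sub(1) X] by blast
  define A where "A l = {\<omega>\<in>space M. norm (X l \<omega>) > K \<and> (\<forall>l'<l. norm (X l' \<omega>) \<le> K)}" for l
  have AG: "A l \<in> sets (G l)" if "l \<le> n" for l
  proof -
    have E: "{\<omega>\<in>space (G l). norm (X l' \<omega>) > K} \<in> sets (G l)" if "l' \<le> l" for l'
    proof -
      have [measurable]: "X l' \<in> borel_measurable (G l)"
        using measurable_from_subalg[OF sub(2)[OF that \<open>l \<le> n\<close>] X] that \<open>l \<le> n\<close> by simp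
      show ?thesis by measurable
    qed
    have "A l = {\<omega>\<in>space (G l). norm (X l \<omega>) > K} - (\<Union>l'\<in>{..<l}. {\<omega>\<in>space (G l). norm (X l' \<omega>) > K})"
      using sub(1)[OF that] unfolding A_def subalgebra_def by auto
    also have "\<dots> \<in> sets (G l)" by (intro sets.Diff sets.finite_UN E) auto
    finally show ?thesis .
  qed
  have AM: "A l \<in> sets M" if "l \<le> n" for l
    using AG[OF that] sub(1)[OF that] by (auto simp: subalgebra_def)
  have disj: "disjoint_family A"
    unfolding disjoint_family_on_def A_def by (auto simp: not_le[symmetric]) (metis linorder_neqE_nat not_less)
  have un: "{\<omega>\<in>space M. \<exists>l\<le>n. norm (X l \<omega>) > K} = (\<Union>l\<in>{..n}. A l)"
  proof (intro equalityI subsetI)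
    fix \<omega> assume "\<omega> \<in> {\<omega>\<in>space M. \<exists>l\<le>n. norm (X l \<omega>) > K}"
    then obtain l where l: "\<omega> \<in> space M" "l \<le> n" "norm (X l \<omega>) > K" by auto
    define l0 where "l0 = (LEAST l. norm (X l \<omega>) > K)"
    have "norm (X l0 \<omega>) > K" unfolding l0_def by (rule LeastI) (rule l)
    moreover have "l0 \<le> l" unfolding l0_def by (rule Least_le) (rule l)
    moreover have "norm (X l' \<omega>) \<le> K" if "l' < l0" for l'
      using not_less_Least[of l' "\<lambda>l. norm (X l \<omega>) > K"] that unfolding l0_def by simp
    ultimately show "\<omega> \<in> (\<Union>l\<in>{..n}. A l)" using l unfolding A_def by (auto intro!: bexI[of _ l0])
  qed (auto simp: A_def)
  have each: "K\<^sup>2 * prob (A l) \<le> (\<integral>\<omega>. indicat_real (A l) \<omega> * (norm (XT \<omega>))\<^sup>2 \<partial>M)" if l: "l \<le> n" for l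
  proof -
    let ?\<eta> = "\<lambda>\<omega>. indicat_real (A l) \<omega> *\<^sub>R X l \<omega>"
    have [measurable]: "A l \<in> sets M" "X l \<in> borel_measurable M" using AM XM l by auto
    have \<eta>G: "?\<eta> \<in> borel_measurable (G l)"
      by (intro borel_measurable_scaleR X borel_measurable_indicator AG l)
    have \<eta>2: "integrable M (\<lambda>\<omega>. (norm (?\<eta> \<omega>))\<^sup>2)"
      by (rule Bochner_Integration.integrable_bound[OF X2[OF l]]) (auto simp: indicator_def)
    have dM: "(\<lambda>\<omega>. XT \<omega> - X l \<omega>) \<in> borel_measurable M" by measurable
    have d2: "integrable M (\<lambda>\<omega>. (norm (XT \<omega> - X l \<omega>))\<^sup>2)"
      using integrable_norm_sq_add[of XT M "\<lambda>\<omega>. - X l \<omega>"] XT2 X2[OF l] by simp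
    have ii: "integrable M (\<lambda>\<omega>. (XT \<omega> - X l \<omega>) \<bullet> ?\<eta> \<omega>)"
      by (rule integrable_inner_of_squares[OF dM _ d2 \<eta>2]) measurable
    \<comment> \<open>Expanding the square of \<open>X l + (XT - X l)\<close> and dropping the last
      square leaves a cross term with mean 0.\<close>
    have pt: "K\<^sup>2 * indicat_real (A l) \<omega> + 2 * ((XT \<omega> - X l \<omega>) \<bullet> ?\<eta> \<omega>) \<le> indicat_real (A l) \<omega> * (norm (XT \<omega>))\<^sup>2" for \<omega>
    proof (cases "\<omega> \<in> A l")
      case True
      then have "K\<^sup>2 \<le> (norm (X l \<omega>))\<^sup>2" using K by (intro power_mono) (auto simp: A_def)
      moreover have "(norm (XT \<omega>))\<^sup>2 = (norm (X l \<omega>))\<^sup>2 + 2 * ((XT \<omega> - X l \<omega>) \<bullet> X l \<omega>) + (norm (XT \<omega> - X l \<omega>))\<^sup>2"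
        by (simp add: power2_norm_eq_inner algebra_simps inner_commute)
      moreover have "0 \<le> (norm (XT \<omega> - X l \<omega>))\<^sup>2" by simp
      ultimately have "K\<^sup>2 + 2 * ((XT \<omega> - X l \<omega>) \<bullet> X l \<omega>) \<le> (norm (XT \<omega>))\<^sup>2" by linarith
      then show ?thesis using True by simp
    qed simp
    have i1: "integrable M (\<lambda>\<omega>. K\<^sup>2 * indicat_real (A l) \<omega>)"
      by (intro integrable_mult_right) (simp add: integrable_indicator_iff less_top[symmetric])
    have i2: "integrable M (\<lambda>\<omega>. 2 * ((XT \<omega> - X l \<omega>) \<bullet> ?\<eta> \<omega>))"
      by (rule integrable_mult_right[OF ii])
    have e1: "(\<integral>\<omega>. K\<^sup>2 * indicat_real (A l) \<omega> \<partial>M) = K\<^sup>2 * prob (A l)"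
      using AM[OF l] by (simp add: sets.Int_space_eq2)
    have e2: "(\<integral>\<omega>. 2 * ((XT \<omega> - X l \<omega>) \<bullet> ?\<eta> \<omega>) \<partial>M) = 0"
      using orth[OF l \<eta>G \<eta>2] by simp
    have "K\<^sup>2 * prob (A l) = (\<integral>\<omega>. K\<^sup>2 * indicat_real (A l) \<omega> + 2 * ((XT \<omega> - X l \<omega>) \<bullet> ?\<eta> \<omega>) \<partial>M)"
      by (simp only: Bochner_Integration.integral_add[OF i1 i2] e1 e2 add_0_right)
    also have "\<dots> \<le> (\<integral>\<omega>. indicat_real (A l) \<omega> * (norm (XT \<omega>))\<^sup>2 \<partial>M)"
    proof (intro integral_mono pt)
      show "integrable M (\<lambda>\<omega>. K\<^sup>2 * indicat_real (A l) \<omega> + 2 * ((XT \<omega> - X l \<omega>) \<bullet> ?\<eta> \<omega>))"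
        by (rule Bochner_Integration.integrable_add[OF i1 i2])
      show "integrable M (\<lambda>\<omega>. indicat_real (A l) \<omega> * (norm (XT \<omega>))\<^sup>2)"
        by (rule Bochner_Integration.integrable_bound[OF XT2]) (auto simp: indicator_def)
    qed
    finally show ?thesis .
  qed
  have AiXT: "integrable M (\<lambda>\<omega>. indicat_real (A l) \<omega> * (norm (XT \<omega>))\<^sup>2)" if "l \<le> n" for l
    using AM[OF that] by (intro Bochner_Integration.integrable_bound[OF XT2]) (auto simp: indicator_def)
  have "K\<^sup>2 * prob (\<Union>l\<in>{..n}. A l) = (\<Sum>l\<le>n. K\<^sup>2 * prob (A l))"
    using AM disj by (subst finite_measure_finite_Union) (auto simp: sum_distrib_left disjoint_family_on_def)
  also have "\<dots> \<le> (\<Sum>l\<le>n. \<integral>\<omega>. indicat_real (A l) \<omega> * (norm (XT \<omega>))\<^sup>2 \<partial>M)"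
    by (intro sum_mono each) auto
  also have "\<dots> = (\<integral>\<omega>. (\<Sum>l\<le>n. indicat_real (A l) \<omega> * (norm (XT \<omega>))\<^sup>2) \<partial>M)"
    using AiXT by (intro Bochner_Integration.integral_sum[symmetric]) auto
  also have "\<dots> \<le> (\<integral>\<omega>. (norm (XT \<omega>))\<^sup>2 \<partial>M)"
  proof (intro integral_mono XT2 Bochner_Integration.integrable_sum AiXT)
    fix \<omega>
    have "(\<Sum>l\<le>n. indicat_real (A l) \<omega>) = indicat_real (\<Union>l\<in>{..n}. A l) \<omega>"
      by (rule indicator_UN_disjoint[symmetric]) (use disj in \<open>auto simp: disjoint_family_on_def\<close>)
    then have "(\<Sum>l\<le>n. indicat_real (A l) \<omega>) \<le> 1" by (simp add: indicator_def)
    then have "(\<Sum>l\<le>n. indicat_real (A l) \<omega>) * (norm (XT \<omega>))\<^sup>2 \<le> 1 * (norm (XT \<omega>))\<^sup>2"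
      by (rule mult_right_mono) simp
    then show "(\<Sum>l\<le>n. indicat_real (A l) \<omega> * (norm (XT \<omega>))\<^sup>2) \<le> (norm (XT \<omega>))\<^sup>2"
      by (simp add: sum_distrib_right)
  qed auto
  finally show ?thesis unfolding un .
qed

section \<open>Elementary integrals\<close>

lemma elementary_process_mono:
  assumes "elementary_process M F n \<tau> \<xi>" "i \<le> j" "j \<le> n"
  shows "\<tau> i \<le> \<tau> j"
  using assms(2,3)
proof (induction j rule: dec_induct)
  case (step m)
  have "\<tau> m \<le> \<tau> (Suc m)" using assms(1) step.hyps step.prems unfolding elementary_process_def by auto
  then show ?case using step by auto
qed simp

lemma elementary_process_pos:
  assumes "elementary_process M F n \<tau> \<xi>" "j \<le> n"
  shows "0 \<le> \<tau> j"
proof -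
  have "0 \<le> \<tau> 0" using assms(1) by (auto simp: elementary_process_def)
  then show ?thesis using elementary_process_mono[OF assms(1) _ assms(2), of 0] by simp
qed

text \<open>The intervals are disjoint, so at most one summand is nonzero at a given time and no
  cross terms arise.\<close>

lemma norm_elementary_value_sq:
  fixes \<xi> :: "nat \<Rightarrow> 'a \<Rightarrow> 'h::real_normed_vector"
  assumes ep: "elementary_process M F n \<tau> \<xi>"
  shows "(norm (elementary_value n \<tau> \<xi> s \<omega>))\<^sup>2 = (\<Sum>j<n. indicat_real {\<tau> j<..\<tau> (Suc j)} s * (norm (\<xi> j \<omega>))\<^sup>2)"
proof (cases "\<exists>j<n. s \<in> {\<tau> j<..\<tau> (Suc j)}")
  case True
  then obtain j where j: "j < n" "s \<in> {\<tau> j<..\<tau> (Suc j)}" by auto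
  have z: "s \<notin> {\<tau> l<..\<tau> (Suc l)}" if "l < n" "l \<noteq> j" for l
  proof (cases "l < j")
    case True
    then have "\<tau> (Suc l) \<le> \<tau> j" using j by (intro elementary_process_mono[OF ep]) auto
    then show ?thesis using j by auto
  next
    case False
    then have "\<tau> (Suc j) \<le> \<tau> l" using that by (intro elementary_process_mono[OF ep]) auto
    then show ?thesis using j by auto
  qed
  have "elementary_value n \<tau> \<xi> s \<omega> = indicat_real {\<tau> j<..\<tau> (Suc j)} s *\<^sub>R \<xi> j \<omega>"
    unfolding elementary_value_def using j z by (subst sum.remove[of _ j]) (auto intro!: sum.neutral)
  moreover have "(\<Sum>j<n. indicat_real {\<tau> j<..\<tau> (Suc j)} s * (norm (\<xi> j \<omega>))\<^sup>2) = indicat_real {\<tau> j<..\<tau> (Suc j)} s * (norm (\<xi> j \<omega>))\<^sup>2"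
    using j z by (subst sum.remove[of _ j]) (auto intro!: sum.neutral)
  ultimately show ?thesis using j by simp
next
  case False
  then have "elementary_value n \<tau> \<xi> s \<omega> = 0" "(\<Sum>j<n. indicat_real {\<tau> j<..\<tau> (Suc j)} s * (norm (\<xi> j \<omega>))\<^sup>2) = 0"
    unfolding elementary_value_def by (auto intro!: sum.neutral)
  then show ?thesis by simp
qed

lemma nn_integral_elementary_value_sq:
  fixes \<xi> :: "nat \<Rightarrow> 'a \<Rightarrow> 'h::real_normed_vector"
  assumes ep: "elementary_process M F n \<tau> \<xi>" and t: "0 \<le> t"
  shows "(sq_integral t (\<lambda>s. elementary_value n \<tau> \<xi> s \<omega>))
    = ennreal (\<Sum>j<n. (min (\<tau> (Suc j)) t - min (\<tau> j) t) * (norm (\<xi> j \<omega>))\<^sup>2)"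
proof -
  have "(sq_integral t (\<lambda>s. elementary_value n \<tau> \<xi> s \<omega>))
    = (\<integral>\<^sup>+s. (\<Sum>j<n. nsq (\<xi> j \<omega>) * indicator {min (\<tau> j) t<..min (\<tau> (Suc j)) t} s) \<partial>lborel)"
  proof (intro nn_integral_cong)
    fix s
    have "(norm (elementary_value n \<tau> \<xi> s \<omega>))\<^sup>2 * indicat_real {0..t} s
      = (\<Sum>j<n. (norm (\<xi> j \<omega>))\<^sup>2 * indicat_real {min (\<tau> j) t<..min (\<tau> (Suc j)) t} s)"
      unfolding norm_elementary_value_sq[OF ep] sum_distrib_right
    proof (intro sum.cong refl)
      fix j assume "j \<in> {..<n}"
      then have "0 \<le> \<tau> j" using elementary_process_pos[OF ep, of j] by simp
      then show "indicat_real {\<tau> j<..\<tau> (Suc j)} s * (norm (\<xi> j \<omega>))\<^sup>2 * indicat_real {0..t} s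
        = (norm (\<xi> j \<omega>))\<^sup>2 * indicat_real {min (\<tau> j) t<..min (\<tau> (Suc j)) t} s"
        by (auto simp: indicator_def)
    qed
    then have "ennreal ((norm (elementary_value n \<tau> \<xi> s \<omega>))\<^sup>2 * indicat_real {0..t} s)
      = ennreal (\<Sum>j<n. (norm (\<xi> j \<omega>))\<^sup>2 * indicat_real {min (\<tau> j) t<..min (\<tau> (Suc j)) t} s)" by simp
    then show "nsq (elementary_value n \<tau> \<xi> s \<omega>) * indicator {0..t} s
      = (\<Sum>j<n. nsq (\<xi> j \<omega>) * indicator {min (\<tau> j) t<..min (\<tau> (Suc j)) t} s)"
      by (subst (asm) sum_ennreal[symmetric]) (auto simp: ennreal_mult ennreal_indicator)
  qed
  also have "\<dots> = (\<Sum>j<n. nsq (\<xi> j \<omega>) * emeasure lborel {min (\<tau> j) t<..min (\<tau> (Suc j)) t})"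
    by (subst nn_integral_sum) (simp_all del: sum_mult_indicator add: nn_integral_cmult_indicator)
  also have "\<dots> = (\<Sum>j<n. ennreal ((min (\<tau> (Suc j)) t - min (\<tau> j) t) * (norm (\<xi> j \<omega>))\<^sup>2))"
  proof (intro sum.cong refl)
    fix j assume "j \<in> {..<n}"
    then have "\<tau> j \<le> \<tau> (Suc j)" using ep by (auto simp: elementary_process_def)
    then have "min (\<tau> j) t \<le> min (\<tau> (Suc j)) t" by auto
    then show "nsq (\<xi> j \<omega>) * emeasure lborel {min (\<tau> j) t<..min (\<tau> (Suc j)) t}
      = ennreal ((min (\<tau> (Suc j)) t - min (\<tau> j) t) * (norm (\<xi> j \<omega>))\<^sup>2)"
      by (subst emeasure_lborel_Ioc) (auto simp: ennreal_mult[symmetric] mult.commute)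
  qed
  also have "\<dots> = ennreal (\<Sum>j<n. (min (\<tau> (Suc j)) t - min (\<tau> j) t) * (norm (\<xi> j \<omega>))\<^sup>2)"
  proof (rule sum_ennreal)
    fix j assume "j \<in> {..<n}"
    then have "\<tau> j \<le> \<tau> (Suc j)" using ep by (auto simp: elementary_process_def)
    then show "0 \<le> (min (\<tau> (Suc j)) t - min (\<tau> j) t) * (norm (\<xi> j \<omega>))\<^sup>2" by auto
  qed
  finally show ?thesis .
qed

context cylindrical_bm
begin

text \<open>All components share one grid: any two summands then use either the same interval or two
  intervals that do not overlap, which settles their correlation.\<close>

definition family_integral :: "nat \<Rightarrow> nat \<Rightarrow> (nat \<Rightarrow> real) \<Rightarrow> (nat \<Rightarrow> nat \<Rightarrow> 'a \<Rightarrow> 'h::real_normed_vector) \<Rightarrow> real \<Rightarrow> 'a \<Rightarrow> 'h" where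
  "family_integral m n \<tau> \<xi> t \<omega> = (\<Sum>i<m. elementary_integral (W i) n \<tau> (\<xi> i) t \<omega>)"

lemma family_integral_pairs:
  "family_integral m n \<tau> \<xi> t \<omega> = (\<Sum>(i, j)\<in>{..<m} \<times> {..<n}. incr i (min (\<tau> j) t) (min (\<tau> (Suc j)) t) \<omega> *\<^sub>R \<xi> i j \<omega>)"
  unfolding family_integral_def elementary_integral_def incr_def
  by (simp add: sum.cartesian_product)

text \<open>Beyond time \<open>t\<close> the increments vanish, so the coefficient may be replaced by \<open>0\<close> there; the
  remaining coefficient is known at the left end of its (stopped) interval.\<close>

lemma coefficient_known:
  assumes "elementary_process M F n \<tau> \<xi>" "j < n" "\<tau> j \<le> a \<or> t < \<tau> j" "0 \<le> a"
  defines "\<zeta> \<equiv> (\<lambda>\<omega>. if \<tau> j \<le> t then \<xi> j \<omega> else 0)"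
  shows "\<zeta> \<in> borel_measurable (F a)" "\<exists>K. \<forall>\<omega>\<in>space M. norm (\<zeta> \<omega>) \<le> K"
proof -
  have "\<xi> j \<in> borel_measurable (F a)" if "\<tau> j \<le> a"
    using assms(1,2) elementary_process_pos[OF assms(1), of j] that
    by (intro measurable_F_mono[of "\<tau> j" a]) (auto simp: elementary_process_def)
  then show "\<zeta> \<in> borel_measurable (F a)" using assms(3) unfolding \<zeta>_def by (cases "\<tau> j \<le> t") auto
  have "bounded (\<xi> j ` space M)" using assms(1,2) by (auto simp: elementary_process_def)
  then obtain K where "\<forall>\<omega>\<in>space M. norm (\<xi> j \<omega>) \<le> K" by (auto simp: bounded_iff)
  then show "\<exists>K. \<forall>\<omega>\<in>space M. norm (\<zeta> \<omega>) \<le> K" unfolding \<zeta>_def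
    by (intro exI[of _ "max K 0"]) auto
qed

text \<open>Stopping the grid at \<open>t\<close> writes the integral as a finite sum of increments
  times coefficients known at the left end of their interval. These terms are pairwise orthogonal,
  which gives the isometry; the part after \<open>s\<close> is centred given the past up to
  \<open>s\<close>, which gives the last claim.\<close>

lemma
  fixes \<xi> :: "nat \<Rightarrow> nat \<Rightarrow> 'a \<Rightarrow> 'h::{real_inner, banach, second_countable_topology}"
  assumes ep: "\<And>i. i < m \<Longrightarrow> elementary_process M F n \<tau> (\<xi> i)" and t: "0 \<le> t"
  shows family_integral_measurable: "family_integral m n \<tau> \<xi> t \<in> borel_measurable (F t)"
    and family_integral_square_integrable: "integrable M (\<lambda>\<omega>. (norm (family_integral m n \<tau> \<xi> t \<omega>))\<^sup>2)"
    and family_integral_isometry: "(\<integral>\<^sup>+\<omega>. nsq (family_integral m n \<tau> \<xi> t \<omega>) \<partial>M)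
      = (\<Sum>i<m. \<integral>\<^sup>+\<omega>. (sq_integral t (\<lambda>s. elementary_value n \<tau> (\<xi> i) s \<omega>)) \<partial>M)"
    and family_integral_orthogonal: "\<And>s \<eta>. 0 \<le> s \<Longrightarrow> s \<le> t \<Longrightarrow> \<eta> \<in> borel_measurable (F s) \<Longrightarrow>
      integrable M (\<lambda>\<omega>. (norm (\<eta> \<omega>))\<^sup>2) \<Longrightarrow>
      (\<integral>\<omega>. (family_integral m n \<tau> \<xi> t \<omega> - family_integral m n \<tau> \<xi> s \<omega>) \<bullet> \<eta> \<omega> \<partial>M) = 0"
proof -
  define a where "a j = min (\<tau> j) t" for j
  define \<zeta> where "\<zeta> i j \<omega> = (if \<tau> j \<le> t then \<xi> i j \<omega> else 0)" for i j \<omega>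
  define Y where "Y = (\<lambda>(i, j) \<omega>. incr i (a j) (a (Suc j)) \<omega> *\<^sub>R \<zeta> i j \<omega>)"
  let ?I = "{..<m} \<times> {..<n}"
  have \<tau>0: "0 \<le> \<tau> j" if "i < m" "j \<le> n" for i j using elementary_process_pos[OF ep[OF that(1)] that(2)] .
  have \<tau>mono: "\<tau> j \<le> \<tau> j'" if "i < m" "j \<le> j'" "j' \<le> n" for i j j'
    using elementary_process_mono[OF ep[OF that(1)] that(2,3)] .
  have a0: "0 \<le> a j" if "i < m" "j \<le> n" for i j using \<tau>0[OF that] t by (simp add: a_def)
  have amono: "a j \<le> a j'" if "i < m" "j \<le> j'" "j' \<le> n" for i j j' using \<tau>mono[OF that] by (auto simp: a_def)
  have alt: "a j \<le> t" for j by (simp add: a_def)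
  have \<zeta>F: "\<zeta> i j \<in> borel_measurable (F b)" if "i < m" "j < n" "a j \<le> b" for i j b
  proof -
    have "\<tau> j \<le> a j \<or> t < \<tau> j" by (auto simp: a_def)
    then have "\<zeta> i j \<in> borel_measurable (F (a j))"
      using coefficient_known(1)[OF ep[OF that(1)] that(2)] a0[OF that(1), of j] that(2) unfolding \<zeta>_def by auto
    then show ?thesis using measurable_F_mono[OF _ that(3)] a0[OF that(1), of j] that(2) by auto
  qed
  have \<zeta>K: "\<exists>K. \<forall>\<omega>\<in>space M. norm (\<zeta> i j \<omega>) \<le> K" if "i < m" "j < n" for i j
    unfolding \<zeta>_def
    by (rule coefficient_known(2)[OF ep[OF that(1)] that(2), of "a j" t])
       (use a0[OF that(1), of j] that(2) in \<open>auto simp: a_def\<close>)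
  have \<zeta>M: "\<zeta> i j \<in> borel_measurable M" if "i < m" "j < n" for i j
    using \<zeta>F[OF that order_refl] a0[OF that(1), of j] that(2) measurable_F_M by auto
  have \<zeta>2: "integrable M (\<lambda>\<omega>. (norm (\<zeta> i j \<omega>))\<^sup>2)" if "i < m" "j < n" for i j
  proof -
    obtain K where "\<forall>\<omega>\<in>space M. norm (\<zeta> i j \<omega>) \<le> K" using \<zeta>K[OF \<open>i < m\<close> \<open>j < n\<close>] by blast
    then have "AE \<omega> in M. norm ((norm (\<zeta> i j \<omega>))\<^sup>2) \<le> K\<^sup>2" by (intro AE_I2) (auto intro!: power_mono)
    then show ?thesis using \<zeta>M[OF \<open>i < m\<close> \<open>j < n\<close>] by (intro integrable_const_bound) measurable
  qed
  have Z: "family_integral m n \<tau> \<xi> t \<omega> = (\<Sum>p\<in>?I. Y p \<omega>)" for \<omega>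
    unfolding family_integral_pairs
  proof (intro sum.cong refl, clarify)
    fix i j assume ij: "i < m" "j < n"
    have "a j = t \<and> a (Suc j) = t" if "\<not> \<tau> j \<le> t"
      using \<tau>mono[of i j "Suc j"] ij that by (auto simp: a_def)
    then show "incr i (min (\<tau> j) t) (min (\<tau> (Suc j)) t) \<omega> *\<^sub>R \<xi> i j \<omega> = Y (i, j) \<omega>"
      unfolding Y_def \<zeta>_def by (auto simp: a_def[symmetric] incr_def)
  qed
  have YF: "Y (i, j) \<in> borel_measurable (F b)" if "i < m" "j < n" "a (Suc j) \<le> b" for i j b
  proof -
    have "a j \<le> b" using amono[of i j "Suc j"] that by auto
    moreover have "0 \<le> a j" "a j \<le> a (Suc j)" "0 \<le> a (Suc j)" using a0[OF that(1)] amono[OF that(1), of j "Suc j"] that(2) by auto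
    ultimately have "incr i (a j) (a (Suc j)) \<in> borel_measurable (F b)" "\<zeta> i j \<in> borel_measurable (F b)"
      using measurable_F_mono[OF _ that(3) incr_measurable] \<zeta>F[OF that(1,2)] by auto
    then show ?thesis unfolding Y_def case_prod_conv by (rule borel_measurable_scaleR)
  qed
  have YM: "Y p \<in> borel_measurable M" if pI: "p \<in> ?I" for p
  proof -
    obtain i j where p: "p = (i, j)" "i < m" "j < n" using pI by (cases p) auto
    have "0 \<le> a (Suc j)" using a0[OF p(2), of "Suc j"] p(3) by simp
    then show ?thesis unfolding p(1) by (rule measurable_F_M[OF _ YF[OF p(2,3) order_refl]])
  qed
  have Y2: "(norm (Y (i, j) \<omega>))\<^sup>2 = (norm (\<zeta> i j \<omega>))\<^sup>2 * (incr i (a j) (a (Suc j)) \<omega>)\<^sup>2" for i j \<omega>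
    by (simp add: Y_def power_mult_distrib)
  have iY2: "integrable M (\<lambda>\<omega>. (norm (Y (i, j) \<omega>))\<^sup>2)"
    and EY2: "(\<integral>\<omega>. (norm (Y (i, j) \<omega>))\<^sup>2 \<partial>M) = (a (Suc j) - a j) * (\<integral>\<omega>. (norm (\<zeta> i j \<omega>))\<^sup>2 \<partial>M)"
    if ij: "i < m" "j < n" for i j
  proof -
    have h: "0 \<le> a j" "a j \<le> a (Suc j)" using a0[OF ij(1)] amono[OF ij(1), of j "Suc j"] ij(2) by auto
    have m: "(\<lambda>\<omega>. (norm (\<zeta> i j \<omega>))\<^sup>2) \<in> borel_measurable (F (a j))"
      using \<zeta>F[OF ij order_refl] by measurable
    show "integrable M (\<lambda>\<omega>. (norm (Y (i, j) \<omega>))\<^sup>2)"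
      unfolding Y2 by (rule integrable_past_incr_sq[OF h m \<zeta>2[OF ij]])
    show "(\<integral>\<omega>. (norm (Y (i, j) \<omega>))\<^sup>2 \<partial>M) = (a (Suc j) - a j) * (\<integral>\<omega>. (norm (\<zeta> i j \<omega>))\<^sup>2 \<partial>M)"
      unfolding Y2 by (rule expectation_past_incr_sq[OF h m \<zeta>2[OF ij]])
  qed
  show meas: "family_integral m n \<tau> \<xi> t \<in> borel_measurable (F t)"
    unfolding Z[abs_def] by (intro borel_measurable_sum) (auto intro!: YF alt)
  show sq: "integrable M (\<lambda>\<omega>. (norm (family_integral m n \<tau> \<xi> t \<omega>))\<^sup>2)"
    unfolding Z by (intro integrable_norm_sq_sum) (auto intro!: iY2 YM)
  have iYY: "integrable M (\<lambda>\<omega>. Y p \<omega> \<bullet> Y q \<omega>)" if "p \<in> ?I" "q \<in> ?I" for p q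
    using that by (cases p; cases q) (auto intro!: integrable_inner_of_squares YM iY2)
  \<comment> \<open>For different intervals the later increment is centred given the other factors,
    all of which are known when its interval begins.\<close>
  have lt: "(\<integral>\<omega>. Y (i, j) \<omega> \<bullet> Y (i', j') \<omega> \<partial>M) = 0" if ij: "i < m" "j < n" "i' < m" "j' < n" "j < j'" for i j i' j'
  proof -
    have h: "0 \<le> a j'" "a j' \<le> a (Suc j')" using a0[OF ij(1)] amono[OF ij(1), of j' "Suc j'"] ij by auto
    have le: "a (Suc j) \<le> a j'" using amono[OF ij(1), of "Suc j" j'] ij by auto
    have m: "(\<lambda>\<omega>. Y (i, j) \<omega> \<bullet> \<zeta> i' j' \<omega>) \<in> borel_measurable (F (a j'))"
      by (intro borel_measurable_inner YF \<zeta>F ij le) auto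
    have i: "integrable M (\<lambda>\<omega>. Y (i, j) \<omega> \<bullet> \<zeta> i' j' \<omega>)"
      by (intro integrable_inner_of_squares YM \<zeta>M iY2 \<zeta>2 ij) (use ij in auto)
    have "Y (i, j) \<omega> \<bullet> Y (i', j') \<omega> = (Y (i, j) \<omega> \<bullet> \<zeta> i' j' \<omega>) * incr i' (a j') (a (Suc j')) \<omega>" for \<omega>
      by (simp add: Y_def)
    then show ?thesis using expectation_past_incr[OF h m i, of i'] by simp
  qed
  \<comment> \<open>On a common interval the two Brownian motions differ, and
    \<open>expectation_past_incr_incr\<close> needs the product of the coefficients to be
    bounded.\<close>
  have ne: "(\<integral>\<omega>. Y (i, j) \<omega> \<bullet> Y (i', j) \<omega> \<partial>M) = 0" if ij: "i < m" "j < n" "i' < m" "i \<noteq> i'" for i j i'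
  proof -
    have h: "0 \<le> a j" "a j \<le> a (Suc j)" using a0[OF ij(1)] amono[OF ij(1), of j "Suc j"] ij by auto
    have m: "(\<lambda>\<omega>. \<zeta> i j \<omega> \<bullet> \<zeta> i' j \<omega>) \<in> borel_measurable (F (a j))"
      by (intro borel_measurable_inner \<zeta>F ij) auto
    obtain K K' where K: "\<forall>\<omega>\<in>space M. norm (\<zeta> i j \<omega>) \<le> K" "\<forall>\<omega>\<in>space M. norm (\<zeta> i' j \<omega>) \<le> K'"
      using \<zeta>K ij by meson
    have b: "\<bar>\<zeta> i j \<omega> \<bullet> \<zeta> i' j \<omega>\<bar> \<le> K\<^sup>2 + K'\<^sup>2" if "\<omega> \<in> space M" for \<omega>
      using inner_product_le_squares[of "\<zeta> i j \<omega>" "\<zeta> i' j \<omega>"] K that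
      by (intro order_trans[OF inner_product_le_squares] add_mono power_mono) auto
    have "Y (i, j) \<omega> \<bullet> Y (i', j) \<omega> = (\<zeta> i j \<omega> \<bullet> \<zeta> i' j \<omega>) * (incr i (a j) (a (Suc j)) \<omega> * incr i' (a j) (a (Suc j)) \<omega>)" for \<omega>
      by (simp add: Y_def)
    then show ?thesis using expectation_past_incr_incr[OF h ij(4) m b] by simp
  qed
  have orthY: "(\<integral>\<omega>. Y p \<omega> \<bullet> Y q \<omega> \<partial>M) = 0" if pq0: "p \<in> ?I" "q \<in> ?I" "p \<noteq> q" for p q
  proof -
    obtain i j i' j' where pq: "p = (i, j)" "q = (i', j')" by (cases p; cases q)
    consider "j < j'" | "j' < j" | "j = j'" "i \<noteq> i'" using pq0 pq by (cases j j' rule: linorder_cases) auto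
    then show ?thesis
    proof cases
      case 1 then show ?thesis using lt[of i j i' j'] pq0 pq by auto
    next
      case 2 then show ?thesis using lt[of i' j' i j] pq0 pq by (auto simp: inner_commute)
    next
      case 3 then show ?thesis using ne[of i j i'] pq0 pq by auto
    qed
  qed
  have "(\<integral>\<omega>. (norm (family_integral m n \<tau> \<xi> t \<omega>))\<^sup>2 \<partial>M) = (\<integral>\<omega>. (\<Sum>p\<in>?I. \<Sum>q\<in>?I. Y p \<omega> \<bullet> Y q \<omega>) \<partial>M)"
    unfolding Z power2_norm_eq_inner inner_sum_left by (simp only: inner_sum_right)
  also have "\<dots> = (\<Sum>p\<in>?I. \<integral>\<omega>. (\<Sum>q\<in>?I. Y p \<omega> \<bullet> Y q \<omega>) \<partial>M)"
    by (rule Bochner_Integration.integral_sum) (intro Bochner_Integration.integrable_sum iYY)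
  also have "\<dots> = (\<Sum>p\<in>?I. \<Sum>q\<in>?I. \<integral>\<omega>. Y p \<omega> \<bullet> Y q \<omega> \<partial>M)"
    by (intro sum.cong refl Bochner_Integration.integral_sum iYY)
  also have "\<dots> = (\<Sum>p\<in>?I. \<integral>\<omega>. Y p \<omega> \<bullet> Y p \<omega> \<partial>M)"
  proof (intro sum.cong refl)
    fix p assume p: "p \<in> ?I"
    have "(\<Sum>q\<in>?I. \<integral>\<omega>. Y p \<omega> \<bullet> Y q \<omega> \<partial>M) = (\<integral>\<omega>. Y p \<omega> \<bullet> Y p \<omega> \<partial>M) + (\<Sum>q\<in>?I - {p}. \<integral>\<omega>. Y p \<omega> \<bullet> Y q \<omega> \<partial>M)"
      by (rule sum.remove) (use p in auto)
    also have "(\<Sum>q\<in>?I - {p}. \<integral>\<omega>. Y p \<omega> \<bullet> Y q \<omega> \<partial>M) = 0"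
      by (rule sum.neutral) (use p orthY in auto)
    finally show "(\<Sum>q\<in>?I. \<integral>\<omega>. Y p \<omega> \<bullet> Y q \<omega> \<partial>M) = (\<integral>\<omega>. Y p \<omega> \<bullet> Y p \<omega> \<partial>M)" by simp
  qed
  also have "\<dots> = (\<Sum>i<m. \<Sum>j<n. (a (Suc j) - a j) * (\<integral>\<omega>. (norm (\<zeta> i j \<omega>))\<^sup>2 \<partial>M))"
    unfolding sum.cartesian_product power2_norm_eq_inner[symmetric] by (intro sum.cong refl) (auto simp: EY2)
  finally have E: "(\<integral>\<omega>. (norm (family_integral m n \<tau> \<xi> t \<omega>))\<^sup>2 \<partial>M)
    = (\<Sum>i<m. \<Sum>j<n. (a (Suc j) - a j) * (\<integral>\<omega>. (norm (\<zeta> i j \<omega>))\<^sup>2 \<partial>M))" .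
  have val: "(\<integral>\<^sup>+\<omega>. (sq_integral t (\<lambda>s. elementary_value n \<tau> (\<xi> i) s \<omega>)) \<partial>M)
     = ennreal (\<Sum>j<n. (a (Suc j) - a j) * (\<integral>\<omega>. (norm (\<zeta> i j \<omega>))\<^sup>2 \<partial>M))" if i: "i < m" for i
  proof -
    have nn: "0 \<le> a (Suc j) - a j" if "j < n" for j using amono[OF i, of j "Suc j"] that by auto
    have "(\<integral>\<^sup>+\<omega>. (sq_integral t (\<lambda>s. elementary_value n \<tau> (\<xi> i) s \<omega>)) \<partial>M)
      = (\<integral>\<^sup>+\<omega>. ennreal (\<Sum>j<n. (a (Suc j) - a j) * (norm (\<zeta> i j \<omega>))\<^sup>2) \<partial>M)"
    proof (intro nn_integral_cong)
      fix \<omega>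
      have "(\<Sum>j<n. (min (\<tau> (Suc j)) t - min (\<tau> j) t) * (norm (\<xi> i j \<omega>))\<^sup>2) = (\<Sum>j<n. (a (Suc j) - a j) * (norm (\<zeta> i j \<omega>))\<^sup>2)"
      proof (intro sum.cong refl)
        fix j assume j: "j \<in> {..<n}"
        have "a j = t \<and> a (Suc j) = t" if "\<not> \<tau> j \<le> t"
          using \<tau>mono[of i j "Suc j"] i j that by (auto simp: a_def)
        then show "(min (\<tau> (Suc j)) t - min (\<tau> j) t) * (norm (\<xi> i j \<omega>))\<^sup>2 = (a (Suc j) - a j) * (norm (\<zeta> i j \<omega>))\<^sup>2"
          by (auto simp: \<zeta>_def a_def[symmetric])
      qed
      then show "(sq_integral t (\<lambda>s. elementary_value n \<tau> (\<xi> i) s \<omega>))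
        = ennreal (\<Sum>j<n. (a (Suc j) - a j) * (norm (\<zeta> i j \<omega>))\<^sup>2)"
        using nn_integral_elementary_value_sq[OF ep[OF i] t, of \<omega>] by simp
    qed
    also have "\<dots> = ennreal (\<integral>\<omega>. (\<Sum>j<n. (a (Suc j) - a j) * (norm (\<zeta> i j \<omega>))\<^sup>2) \<partial>M)"
      by (intro nn_integral_eq_integral Bochner_Integration.integrable_sum integrable_mult_right \<zeta>2 i AE_I2 sum_nonneg mult_nonneg_nonneg nn)
         auto
    also have "(\<integral>\<omega>. (\<Sum>j<n. (a (Suc j) - a j) * (norm (\<zeta> i j \<omega>))\<^sup>2) \<partial>M) = (\<Sum>j<n. (a (Suc j) - a j) * (\<integral>\<omega>. (norm (\<zeta> i j \<omega>))\<^sup>2 \<partial>M))"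
      by (subst Bochner_Integration.integral_sum) (auto intro!: integrable_mult_right \<zeta>2 i)
    finally show ?thesis .
  qed
  have "(\<integral>\<^sup>+\<omega>. nsq (family_integral m n \<tau> \<xi> t \<omega>) \<partial>M)
     = ennreal (\<integral>\<omega>. (norm (family_integral m n \<tau> \<xi> t \<omega>))\<^sup>2 \<partial>M)"
    by (intro nn_integral_eq_integral sq) simp
  also have "\<dots> = (\<Sum>i<m. ennreal (\<Sum>j<n. (a (Suc j) - a j) * (\<integral>\<omega>. (norm (\<zeta> i j \<omega>))\<^sup>2 \<partial>M)))"
    unfolding E
  proof (rule sum_ennreal[symmetric])
    fix i assume "i \<in> {..<m}"
    then show "0 \<le> (\<Sum>j<n. (a (Suc j) - a j) * (\<integral>\<omega>. (norm (\<zeta> i j \<omega>))\<^sup>2 \<partial>M))"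
      using amono[of i] by (intro sum_nonneg mult_nonneg_nonneg) auto
  qed
  also have "\<dots> = (\<Sum>i<m. \<integral>\<^sup>+\<omega>. (sq_integral t (\<lambda>s. elementary_value n \<tau> (\<xi> i) s \<omega>)) \<partial>M)"
    by (intro sum.cong refl) (simp add: val)
  finally show "(\<integral>\<^sup>+\<omega>. nsq (family_integral m n \<tau> \<xi> t \<omega>) \<partial>M)
     = (\<Sum>i<m. \<integral>\<^sup>+\<omega>. (sq_integral t (\<lambda>s. elementary_value n \<tau> (\<xi> i) s \<omega>)) \<partial>M)" .
  fix s and \<eta> :: "'a \<Rightarrow> 'h"
  assume s: "0 \<le> s" "s \<le> t" and \<eta>: "\<eta> \<in> borel_measurable (F s)" "integrable M (\<lambda>\<omega>. (norm (\<eta> \<omega>))\<^sup>2)"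
  have \<eta>M: "\<eta> \<in> borel_measurable M" using measurable_F_M[OF s(1) \<eta>(1)] .
  \<comment> \<open>The integral from \<open>s\<close> to \<open>t\<close> uses the grid pushed up
    to \<open>s\<close>. The coefficient is known at \<open>c j\<close> because \<open>c j\<close>
    is at least \<open>a j\<close>, and \<open>\<eta>\<close> is known there because
    \<open>c j\<close> is at least \<open>s\<close>.\<close>
  define c where "c j = max s (a j)" for j
  have incr_eq: "family_integral m n \<tau> \<xi> t \<omega> - family_integral m n \<tau> \<xi> s \<omega>
     = (\<Sum>(i, j)\<in>?I. incr i (c j) (c (Suc j)) \<omega> *\<^sub>R \<zeta> i j \<omega>)" for \<omega>
    unfolding family_integral_pairs sum_subtractf[symmetric]
  proof (intro sum.cong refl, clarify)
    fix i j assume ij: "i < m" "j < n"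
    have W: "W i (min x t) \<omega> - W i (min x s) \<omega> = W i (max s (min x t)) \<omega> - W i s \<omega>" for x
      using s by (auto simp: min_def max_def)
    have "incr i (min (\<tau> j) t) (min (\<tau> (Suc j)) t) \<omega> - incr i (min (\<tau> j) s) (min (\<tau> (Suc j)) s) \<omega>
       = incr i (c j) (c (Suc j)) \<omega>"
      using W[of "\<tau> j"] W[of "\<tau> (Suc j)"] unfolding incr_def c_def a_def by linarith
    moreover have "incr i (c j) (c (Suc j)) \<omega> *\<^sub>R \<xi> i j \<omega> = incr i (c j) (c (Suc j)) \<omega> *\<^sub>R \<zeta> i j \<omega>"
    proof (cases "\<tau> j \<le> t")
      case False
      then have "c j = c (Suc j)" using \<tau>mono[of i j "Suc j"] ij by (auto simp: c_def a_def)
      then show ?thesis by (simp add: incr_def)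
    qed (simp add: \<zeta>_def)
    ultimately show "incr i (min (\<tau> j) t) (min (\<tau> (Suc j)) t) \<omega> *\<^sub>R \<xi> i j \<omega>
        - incr i (min (\<tau> j) s) (min (\<tau> (Suc j)) s) \<omega> *\<^sub>R \<xi> i j \<omega> = incr i (c j) (c (Suc j)) \<omega> *\<^sub>R \<zeta> i j \<omega>"
      by (simp add: scaleR_left_diff_distrib[symmetric])
  qed
  have c: "0 \<le> c j" "s \<le> c j" "a j \<le> c j" for j using s by (auto simp: c_def)
  have trm: "integrable M (\<lambda>\<omega>. (\<zeta> i j \<omega> \<bullet> \<eta> \<omega>) * incr i (c j) (c (Suc j)) \<omega>)"
     "(\<integral>\<omega>. (\<zeta> i j \<omega> \<bullet> \<eta> \<omega>) * incr i (c j) (c (Suc j)) \<omega> \<partial>M) = 0" if ij: "i < m" "j < n" for i j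
  proof -
    have cm: "c j \<le> c (Suc j)" using amono[OF ij(1), of j "Suc j"] ij by (auto simp: c_def)
    have m: "(\<lambda>\<omega>. \<zeta> i j \<omega> \<bullet> \<eta> \<omega>) \<in> borel_measurable (F (c j))"
      by (intro borel_measurable_inner \<zeta>F ij c measurable_F_mono[OF s(1) _ \<eta>(1)])
    have i: "integrable M (\<lambda>\<omega>. \<zeta> i j \<omega> \<bullet> \<eta> \<omega>)"
      by (intro integrable_inner_of_squares \<zeta>M \<eta>M \<eta> \<zeta>2 ij)
    show "integrable M (\<lambda>\<omega>. (\<zeta> i j \<omega> \<bullet> \<eta> \<omega>) * incr i (c j) (c (Suc j)) \<omega>)"
      by (rule integrable_past_incr[OF c(1) cm m i])
    show "(\<integral>\<omega>. (\<zeta> i j \<omega> \<bullet> \<eta> \<omega>) * incr i (c j) (c (Suc j)) \<omega> \<partial>M) = 0"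
      by (rule expectation_past_incr[OF c(1) cm m i])
  qed
  have "(\<integral>\<omega>. (family_integral m n \<tau> \<xi> t \<omega> - family_integral m n \<tau> \<xi> s \<omega>) \<bullet> \<eta> \<omega> \<partial>M)
    = (\<integral>\<omega>. (\<Sum>(i, j)\<in>?I. (\<zeta> i j \<omega> \<bullet> \<eta> \<omega>) * incr i (c j) (c (Suc j)) \<omega>) \<partial>M)"
    unfolding incr_eq inner_sum_left by (simp add: case_prod_unfold mult.commute)
  also have "\<dots> = (\<Sum>(i, j)\<in>?I. \<integral>\<omega>. (\<zeta> i j \<omega> \<bullet> \<eta> \<omega>) * incr i (c j) (c (Suc j)) \<omega> \<partial>M)"
    unfolding case_prod_unfold by (rule Bochner_Integration.integral_sum) (auto intro!: trm)
  also have "\<dots> = 0" by (rule sum.neutral) (auto simp: trm)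
  finally show "(\<integral>\<omega>. (family_integral m n \<tau> \<xi> t \<omega> - family_integral m n \<tau> \<xi> s \<omega>) \<bullet> \<eta> \<omega> \<partial>M) = 0" .
qed

end

section \<open>Approximation of progressive integrands\<close>

text \<open>Rounding \<open>t\<close> down to the grid stays inside the interval and converges to
  \<open>t\<close>. This carries the maximal inequality, available at dyadic times, over to all
  times.\<close>

lemma dyadic_bound_imp_bound:
  fixes f :: "real \<Rightarrow> 'h::real_normed_vector"
  assumes cont: "continuous_on {0..real T} f"
    and bd: "\<And>N l. l \<le> T * 2 ^ N \<Longrightarrow> norm (f (dyadic N l)) \<le> K"
    and t: "t \<in> {0..real T}"
  shows "norm (f t) \<le> K"
proof -
  define l where "l N = nat \<lfloor>t * 2 ^ N\<rfloor>" for N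
  have l1: "real (l N) \<le> t * 2 ^ N" for N using t by (simp add: l_def)
  have l2: "t * 2 ^ N - 1 \<le> real (l N)" for N using t by (simp add: l_def)
  have lT: "l N \<le> T * 2 ^ N" for N
  proof -
    have "real (l N) \<le> real T * 2 ^ N" by (rule order_trans[OF l1[of N]]) (use t in simp)
    then have "real (l N) \<le> real (T * 2 ^ N)" by simp
    then show ?thesis by (simp only: of_nat_le_iff)
  qed
  have "(\<lambda>N. t - (1 / 2) ^ N) \<longlonglongrightarrow> t - 0"
    by (intro tendsto_intros LIMSEQ_power_zero) auto
  then have low: "(\<lambda>N. t - (1 / 2) ^ N) \<longlonglongrightarrow> t" by simp
  have "(\<lambda>N. dyadic N (l N)) \<longlonglongrightarrow> t"
  proof (rule tendsto_sandwich[OF always_eventually always_eventually low tendsto_const])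
    show "\<forall>N. t - (1 / 2) ^ N \<le> dyadic N (l N)"
    proof
      fix N
      have "(t * 2 ^ N - 1) / 2 ^ N \<le> dyadic N (l N)" by (intro divide_right_mono l2) simp
      then show "t - (1 / 2) ^ N \<le> dyadic N (l N)" by (simp add: diff_divide_distrib power_one_over)
    qed
    show "\<forall>N. dyadic N (l N) \<le> t" using l1 by (auto simp: field_simps)
  qed
  moreover have "dyadic N (l N) \<in> {0..real T}" for N
  proof -
    have "dyadic N (l N) \<le> t" using l1[of N] by (simp add: field_simps)
    then show ?thesis using t by simp
  qed
  ultimately have "(\<lambda>N. f (dyadic N (l N))) \<longlonglongrightarrow> f t"
    by (intro continuous_on_tendsto_compose[OF cont _ t]) auto
  then have "(\<lambda>N. norm (f (dyadic N (l N)))) \<longlonglongrightarrow> norm (f t)" by (rule tendsto_norm)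
  then show ?thesis by (rule LIMSEQ_le_const2) (use bd lT in auto)
qed

context cylindrical_bm
begin

text \<open>The grids of \<open>{0..real T}\<close> increase to all its dyadic points, so the finite
  maximal inequality, whose bound is the same for every grid, passes to the union by continuity of
  the measure from below. Dyadic times keep the event a countable union.\<close>

lemma family_integral_doob:
  fixes \<xi> :: "nat \<Rightarrow> nat \<Rightarrow> 'a \<Rightarrow> 'h::{real_inner, banach, second_countable_topology}"
  assumes ep: "\<And>i. i < m \<Longrightarrow> elementary_process M F n \<tau> (\<xi> i)" and K: "0 \<le> K"
    and c: "0 \<le> c" "(\<integral>\<^sup>+\<omega>. nsq (family_integral m n \<tau> \<xi> (real T) \<omega>) \<partial>M) \<le> ennreal c"
  defines "E \<equiv> {\<omega>\<in>space M. \<exists>N. \<exists>l\<le>T * 2 ^ N. norm (family_integral m n \<tau> \<xi> (dyadic N l) \<omega>) > K}"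
  shows "E \<in> sets M" "K\<^sup>2 * prob E \<le> c"
proof -
  let ?Z = "family_integral m n \<tau> \<xi>"
  define EN where "EN N = {\<omega>\<in>space M. \<exists>l\<le>T * 2 ^ N. norm (?Z (dyadic N l) \<omega>) > K}" for N
  have ZM: "?Z t \<in> borel_measurable M" if "0 \<le> t" for t
    by (rule measurable_F_M[OF that family_integral_measurable[OF ep that]])
  have EN [measurable]: "EN N \<in> sets M" for N
  proof -
    have "EN N = (\<Union>l\<in>{..T * 2 ^ N}. {\<omega>\<in>space M. norm (?Z (dyadic N l) \<omega>) > K})"
      by (auto simp: EN_def)
    also have "\<dots> \<in> sets M"
    proof (intro sets.finite_UN)
      fix l
      have [measurable]: "?Z (dyadic N l) \<in> borel_measurable M" by (rule ZM) simp
      show "{\<omega>\<in>space M. norm (?Z (dyadic N l) \<omega>) > K} \<in> sets M" by measurable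
    qed simp
    finally show ?thesis .
  qed
  have EU: "E = (\<Union>N. EN N)" by (auto simp: E_def EN_def)
  show "E \<in> sets M" unfolding EU by measurable
  have inc: "incseq EN"
  proof (rule incseq_SucI, rule subsetI)
    fix N \<omega> assume "\<omega> \<in> EN N"
    then obtain l where l: "\<omega> \<in> space M" "l \<le> T * 2 ^ N" "norm (?Z (dyadic N l) \<omega>) > K" by (auto simp: EN_def)
    have "dyadic (Suc N) (2 * l) = dyadic N l" by simp
    moreover have "2 * l \<le> T * 2 ^ Suc N" using l(2) by simp
    ultimately show "\<omega> \<in> EN (Suc N)" using l unfolding EN_def by (auto intro!: exI[of _ "2 * l"])
  qed
  have sqZ: "integrable M (\<lambda>\<omega>. (norm (?Z t \<omega>))\<^sup>2)" if "0 \<le> t" for t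
    using family_integral_square_integrable[OF ep that] .
  have "ennreal (\<integral>\<omega>. (norm (?Z (real T) \<omega>))\<^sup>2 \<partial>M) \<le> ennreal c"
    using c(2) by (subst (asm) nn_integral_eq_integral[OF sqZ]) auto
  then have Zc: "(\<integral>\<omega>. (norm (?Z (real T) \<omega>))\<^sup>2 \<partial>M) \<le> c" using c(1) by simp
  have "K\<^sup>2 * prob (EN N) \<le> c" for N
  proof (rule order_trans[OF _ Zc])
    have pT: "dyadic N l \<le> real T" if "l \<le> T * 2 ^ N" for l
    proof -
      have "real l \<le> real (T * 2 ^ N)" using that by (simp only: of_nat_le_iff)
      then show ?thesis by (simp add: field_simps)
    qed
    show "K\<^sup>2 * prob (EN N) \<le> (\<integral>\<omega>. (norm (?Z (real T) \<omega>))\<^sup>2 \<partial>M)"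
      unfolding EN_def
    proof (rule doob_weak_finite[where G = "\<lambda>l. F (dyadic N l)"])
      fix l assume l: "l \<le> T * 2 ^ N"
      show "subalgebra M (F (dyadic N l))" by (rule subalgebra_F) simp
      show "?Z (dyadic N l) \<in> borel_measurable (F (dyadic N l))"
        by (rule family_integral_measurable[OF ep]) auto
      show "integrable M (\<lambda>\<omega>. (norm (?Z (dyadic N l) \<omega>))\<^sup>2)" by (rule sqZ) simp
      fix \<eta> :: "'a \<Rightarrow> 'h" assume "\<eta> \<in> borel_measurable (F (dyadic N l))" "integrable M (\<lambda>\<omega>. (norm (\<eta> \<omega>))\<^sup>2)"
      then show "(\<integral>\<omega>. (?Z (real T) \<omega> - ?Z (dyadic N l) \<omega>) \<bullet> \<eta> \<omega> \<partial>M) = 0"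
        by (intro family_integral_orthogonal[OF ep] pT l) auto
    next
      fix l l' :: nat assume "l' \<le> l"
      then show "subalgebra (F (dyadic N l)) (F (dyadic N l'))"
        by (intro subalgebra_F_F) (auto simp: divide_right_mono)
    qed (use ZM sqZ K in auto)
  qed
  moreover have "(\<lambda>N. K\<^sup>2 * prob (EN N)) \<longlonglongrightarrow> K\<^sup>2 * prob (\<Union>N. EN N)"
    by (intro tendsto_mult_left finite_Lim_measure_incseq inc) auto
  ultimately show "K\<^sup>2 * prob E \<le> c" unfolding EU by (intro LIMSEQ_le_const2) auto
qed

text \<open>Extension by zero makes the process jointly measurable over the whole line, as
  integration against \<open>lborel\<close> requires, while the second factor is still
  \<open>F T\<close>, as adaptedness requires.\<close>

lemma progressive_extend:
  fixes b :: "real \<Rightarrow> 'a \<Rightarrow> 'h::{banach, second_countable_topology}"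
  assumes "progressively_measurable F borel b" and T: "0 \<le> T"
  shows "(\<lambda>(r, \<omega>). indicat_real {0..T} r *\<^sub>R b r \<omega>) \<in> borel_measurable (borel \<Otimes>\<^sub>M F T)"
proof -
  let ?P = "borel \<Otimes>\<^sub>M F T"
  let ?D = "{0..T} \<times> space (F T)"
  have D: "?D \<inter> space ?P \<in> sets ?P" by (auto simp: space_pair_measure)
  have id: "(\<lambda>p. (fst p, snd p)) \<in> restrict_space ?P ?D \<rightarrow>\<^sub>M restrict_space borel {0..T} \<Otimes>\<^sub>M F T"
  proof (rule measurable_Pair)
    show "fst \<in> restrict_space ?P ?D \<rightarrow>\<^sub>M restrict_space borel {0..T}"
      by (intro measurable_restrict_space2 measurable_restrict_space1 measurable_fst) (auto simp: space_restrict_space)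
    show "snd \<in> restrict_space ?P ?D \<rightarrow>\<^sub>M F T"
      by (intro measurable_restrict_space1 measurable_snd)
  qed
  have "(\<lambda>(s, \<omega>). b s \<omega>) \<in> restrict_space borel {0..T} \<Otimes>\<^sub>M F T \<rightarrow>\<^sub>M borel"
    using assms by (simp add: progressively_measurable_def)
  from measurable_compose[OF id this]
  have "(\<lambda>p. b (fst p) (snd p)) \<in> borel_measurable (restrict_space ?P ?D)"
    by (simp add: case_prod_unfold)
  then have "(\<lambda>p. indicat_real ?D p *\<^sub>R b (fst p) (snd p)) \<in> borel_measurable ?P"
    by (subst (asm) borel_measurable_restrict_space_iff[OF D])
  then show ?thesis
    by (rule measurable_cong[THEN iffD1, rotated])
       (auto simp: space_pair_measure indicator_def)
qed

lemma progressive_extend_M: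
  fixes b :: "real \<Rightarrow> 'a \<Rightarrow> 'h::{banach, second_countable_topology}"
  assumes "progressively_measurable F borel b" and T: "0 \<le> T"
  shows "(\<lambda>(r, \<omega>). indicat_real {0..T} r *\<^sub>R b r \<omega>) \<in> borel_measurable (borel \<Otimes>\<^sub>M M)"
proof -
  have "(\<lambda>p. (fst p, snd p)) \<in> borel \<Otimes>\<^sub>M M \<rightarrow>\<^sub>M borel \<Otimes>\<^sub>M F T"
    by (intro measurable_Pair measurable_fst measurable_F_M[OF T, THEN measurable_compose[OF measurable_snd]]) auto
  from measurable_compose[OF this progressive_extend[OF assms]] show ?thesis
    by (simp add: case_prod_unfold)
qed

lemma progressive_section:
  fixes b :: "real \<Rightarrow> 'a \<Rightarrow> 'h::{banach, second_countable_topology}"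
  assumes "progressively_measurable F borel b" and "\<omega> \<in> space M"
  shows "(\<lambda>r. indicat_real {0..T} r *\<^sub>R b r \<omega>) \<in> borel_measurable borel"
proof (cases "0 \<le> T")
  case True
  have "(\<lambda>r. (r, \<omega>)) \<in> borel \<rightarrow>\<^sub>M borel \<Otimes>\<^sub>M M" using assms(2) by measurable
  from measurable_compose[OF this progressive_extend_M[OF assms(1) True]] show ?thesis by simp
qed (simp add: indicator_def)

section \<open>Elementary approximations of a family of integrands\<close>

definition approx_coef :: "nat \<Rightarrow> (nat \<Rightarrow> real \<Rightarrow> 'a \<Rightarrow> 'h::{banach, second_countable_topology}) \<Rightarrow> nat \<Rightarrow> nat \<Rightarrow> 'a \<Rightarrow> 'h" where
  "approx_coef k b i j \<omega> = (if i < k then cell_mean k (cutoff k (\<lambda>r. b i r \<omega>)) (int j) else 0)"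

text \<open>One parameter \<open>k\<close> governs the grid, the truncation and the number of noise
  components, so that each approximation is bounded and involves finitely many Brownian
  motions.\<close>

definition approx_val :: "nat \<Rightarrow> (nat \<Rightarrow> real \<Rightarrow> 'a \<Rightarrow> 'h::{banach, second_countable_topology}) \<Rightarrow> nat \<Rightarrow> real \<Rightarrow> 'a \<Rightarrow> 'h" where
  "approx_val k b i s \<omega> = (if i < k then past_avg k (cutoff k (\<lambda>r. b i r \<omega>)) s else 0)"

text \<open>The grid has enough cells to cover \<open>{0..t}\<close> and thus varies with
  \<open>t\<close>; by \<open>approx_int_extend\<close> any longer one gives the same value, so the
  paths can be studied on a fixed grid.\<close>

definition approx_int :: "nat \<Rightarrow> (nat \<Rightarrow> real \<Rightarrow> 'a \<Rightarrow> 'h::{banach, second_countable_topology}) \<Rightarrow> real \<Rightarrow> 'a \<Rightarrow> 'h" where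
  "approx_int k b t = family_integral k (nat \<lceil>t\<rceil> * 2 ^ k) (dyadic k) (approx_coef k b) t"

lemma cell_mean_negative:
  assumes "j < 0" shows "cell_mean k (cutoff k f) j = 0"
proof -
  have "(2 ^ k * indicat_real {r. \<lceil>r * 2 ^ k\<rceil> = j} r) *\<^sub>R cutoff k f r = 0" for r
  proof (cases "0 \<le> r")
    case True
    then have "0 \<le> \<lceil>r * 2 ^ k\<rceil>" by (simp add: order_less_le_trans[of "-1" 0])
    then show ?thesis using assms by (auto simp: indicator_def)
  qed (simp add: cutoff_def)
  then show ?thesis by (simp only: cell_mean_def integral_zero)
qed

text \<open>The cell with index \<open>j\<close> ends at \<open>dyadic k j\<close>, so only the
  restriction of the process to times up to that point enters, and progressive measurability applies
  there. This is the adaptedness of the coefficients.\<close>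

lemma cell_mean_measurable:
  fixes b :: "real \<Rightarrow> 'a \<Rightarrow> 'h::{banach, second_countable_topology}"
  assumes b: "progressively_measurable F borel b"
  shows "(\<lambda>\<omega>. cell_mean k (cutoff k (\<lambda>r. b r \<omega>)) (int j)) \<in> borel_measurable (F (dyadic k j))"
proof -
  let ?T = "dyadic k j"
  let ?g = "\<lambda>r \<omega>. indicat_real {0..?T} r *\<^sub>R b r \<omega>"
  have g [measurable]: "(\<lambda>(r, \<omega>). ?g r \<omega>) \<in> borel_measurable (borel \<Otimes>\<^sub>M F ?T)"
    by (rule progressive_extend[OF b]) simp
  have [measurable]: "{r::real. \<lceil>r * 2 ^ k\<rceil> = int j} \<in> sets borel" using sets_cell[of k "int j"] by simp
  have eq: "cell_mean k (cutoff k (\<lambda>r. b r \<omega>)) (int j)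
     = (\<integral>r. (2 ^ k * indicat_real {r. \<lceil>r * 2 ^ k\<rceil> = int j} r) *\<^sub>R (if norm (?g r \<omega>) \<le> real k then ?g r \<omega> else 0) \<partial>lborel)" for \<omega>
    unfolding cell_mean_def
  proof (rule Bochner_Integration.integral_cong[OF refl])
    fix r
    have "\<lceil>r * 2 ^ k\<rceil> = int j \<Longrightarrow> r \<le> ?T" by (simp add: ceiling_eq_iff field_simps)
    then show "(2 ^ k * indicat_real {r. \<lceil>r * 2 ^ k\<rceil> = int j} r) *\<^sub>R cutoff k (\<lambda>r. b r \<omega>) r
      = (2 ^ k * indicat_real {r. \<lceil>r * 2 ^ k\<rceil> = int j} r) *\<^sub>R (if norm (?g r \<omega>) \<le> real k then ?g r \<omega> else 0)"
      by (auto simp: cutoff_def indicator_def)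
  qed
  have "(\<lambda>(\<omega>, r). (2 ^ k * indicat_real {r. \<lceil>r * 2 ^ k\<rceil> = int j} r) *\<^sub>R (if norm (?g r \<omega>) \<le> real k then ?g r \<omega> else 0))
     \<in> borel_measurable (F ?T \<Otimes>\<^sub>M lborel)"
  proof -
    have [measurable]: "(\<lambda>p. ?g (snd p) (fst p)) \<in> borel_measurable (F ?T \<Otimes>\<^sub>M lborel)"
      using measurable_compose[OF measurable_pair_swap' g] by (simp add: case_prod_unfold)
    show ?thesis unfolding case_prod_unfold by measurable
  qed
  then show ?thesis unfolding eq by (rule lborel.borel_measurable_lebesgue_integral)
qed

lemma approx_coef_elementary:
  fixes b :: "nat \<Rightarrow> real \<Rightarrow> 'a \<Rightarrow> 'h::{banach, second_countable_topology}"
  assumes b: "\<And>i. progressively_measurable F borel (b i)"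
  shows "elementary_process M F n (dyadic k) (approx_coef k b i)"
  unfolding elementary_process_def
proof (intro conjI allI impI)
  fix j
  show "approx_coef k b i j \<in> borel_measurable (F (dyadic k j))"
    unfolding approx_coef_def using cell_mean_measurable[OF b] by (cases "i < k") auto
  show "bounded (approx_coef k b i j ` space M)"
    unfolding bounded_iff approx_coef_def using norm_cell_mean_cutoff[of k] by (auto intro!: exI[of _ "real k"])
qed (auto simp: divide_right_mono)

lemma elementary_value_approx:
  assumes "0 \<le> s" "s \<le> dyadic k n"
  shows "elementary_value n (dyadic k) (approx_coef k b i) s \<omega> = approx_val k b i s \<omega>"
proof (cases "s = 0")
  case True
  then have "elementary_value n (dyadic k) (approx_coef k b i) s \<omega> = 0"
    unfolding elementary_value_def by (auto intro!: sum.neutral simp: indicator_def not_less)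
  \<comment> \<open>At time 0 the intervals, open on the left, give 0. The average gives 0 as well,
    because it is taken over the cell with index -1, where \<open>cutoff\<close> vanishes.\<close>
  moreover have "approx_val k b i s \<omega> = 0"
    using True unfolding approx_val_def past_avg_def by (simp add: cell_mean_negative)
  ultimately show ?thesis by simp
next
  case False
  then have s: "0 < s" using assms by simp
  define j where "j = nat (\<lceil>s * 2 ^ k\<rceil> - 1)"
  have c1: "1 \<le> \<lceil>s * 2 ^ k\<rceil>" using s by (simp add: order_less_le_trans[OF zero_less_one])
  have jj: "int j = \<lceil>s * 2 ^ k\<rceil> - 1" using c1 by (simp add: j_def)
  have b1: "real j < s * 2 ^ k" "s * 2 ^ k \<le> real j + 1" using jj by linarith+
  have "s * 2 ^ k \<le> real n" using assms(2) by (simp add: field_simps)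
  then have jn: "j < n" using b1 by linarith
  have ind: "s \<in> {dyadic k l<..dyadic k (Suc l)} \<longleftrightarrow> l = j" for l
  proof -
    have "s \<in> {dyadic k l<..dyadic k (Suc l)} \<longleftrightarrow> real l < s * 2 ^ k \<and> s * 2 ^ k \<le> real l + 1"
      by (auto simp: field_simps)
    also have "\<dots> \<longleftrightarrow> l = j" using b1 by (auto; linarith)
    finally show ?thesis .
  qed
  have "elementary_value n (dyadic k) (approx_coef k b i) s \<omega> = approx_coef k b i j \<omega>"
    unfolding elementary_value_def indicator_def ind using jn by (subst sum.remove[of _ j]) (auto intro!: sum.neutral)
  then show ?thesis unfolding approx_coef_def approx_val_def past_avg_def jj by simp
qed

lemma approx_int_extend:
  assumes "0 \<le> t" "k \<le> m" "t \<le> real T"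
  shows "approx_int k b t \<omega> = family_integral m (T * 2 ^ k) (dyadic k) (approx_coef k b) t \<omega>"
proof -
  have "approx_int k b t \<omega> = family_integral k (T * 2 ^ k) (dyadic k) (approx_coef k b) t \<omega>"
    unfolding approx_int_def family_integral_def
  proof (intro sum.cong refl elementary_integral_extend[symmetric])
    have "nat \<lceil>t\<rceil> \<le> T" using assms by (simp add: ceiling_le_iff)
    then show "nat \<lceil>t\<rceil> * 2 ^ k \<le> T * 2 ^ k" by simp
    show "t \<le> dyadic k (nat \<lceil>t\<rceil> * 2 ^ k)" using assms(1) by (simp add: of_nat_nat le_of_int_ceiling)
  qed
  also have "\<dots> = family_integral m (T * 2 ^ k) (dyadic k) (approx_coef k b) t \<omega>"
    unfolding family_integral_def
    by (rule sum.mono_neutral_left) (use assms in \<open>auto simp: elementary_integral_def approx_coef_def\<close>)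
  finally show ?thesis .
qed

text \<open>The squared norm in the product of samples, times and components, with values in
  \<open>ennreal\<close> so that finiteness can be stated separately.\<close>

definition energy :: "(nat \<Rightarrow> real \<Rightarrow> 'a \<Rightarrow> 'h::real_normed_vector) \<Rightarrow> real \<Rightarrow> ennreal" where
  "energy b t = (\<Sum>i. \<integral>\<^sup>+\<omega>. (sq_integral t (\<lambda>s. b i s \<omega>)) \<partial>M)"

definition ito_integrand :: "(nat \<Rightarrow> real \<Rightarrow> 'a \<Rightarrow> 'h::{banach, second_countable_topology}) \<Rightarrow> bool" where
  "ito_integrand b \<longleftrightarrow> (\<forall>i. progressively_measurable F borel (b i)) \<and> (\<forall>t. energy b t < \<infinity>)"

text \<open>Both processes are rewritten on their common dyadic grid.\<close>

lemma approx_int_diff: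
  fixes b b' :: "nat \<Rightarrow> real \<Rightarrow> 'a \<Rightarrow> 'h::{real_inner, banach, second_countable_topology}"
  assumes b: "\<And>i. progressively_measurable F borel (b i)" and b': "\<And>i. progressively_measurable F borel (b' i)"
  obtains m n \<tau> \<xi> where
    "\<And>i. elementary_process M F n \<tau> (\<xi> i)"
    "\<And>t \<omega>. 0 \<le> t \<Longrightarrow> t \<le> real T \<Longrightarrow> family_integral m n \<tau> \<xi> t \<omega> = approx_int k b t \<omega> - approx_int l b' t \<omega>"
    "\<And>i s \<omega>. 0 \<le> s \<Longrightarrow> s \<le> real T \<Longrightarrow> elementary_value n \<tau> (\<xi> i) s \<omega> = approx_val k b i s \<omega> - approx_val l b' i s \<omega>"
    "\<And>i s \<omega>. m \<le> i \<Longrightarrow> approx_val k b i s \<omega> - approx_val l b' i s \<omega> = 0"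
proof -
  define m where "m = max k l"
  define d where "d = m - k"
  define d' where "d' = m - l"
  have m: "m = k + d" "m = l + d'" by (auto simp: m_def d_def d'_def)
  let ?\<tau> = "dyadic m"
  let ?n = "T * 2 ^ m"
  define \<xi>1 where "\<xi>1 i j = approx_coef k b i (j div 2 ^ d)" for i j
  define \<xi>2 where "\<xi>2 i j = approx_coef l b' i (j div 2 ^ d')" for i j
  define \<xi> where "\<xi> i j \<omega> = \<xi>1 i j \<omega> - \<xi>2 i j \<omega>" for i j \<omega>
  have n: "?n = T * 2 ^ k * 2 ^ d" "?n = T * 2 ^ l * 2 ^ d'"
    by (simp add: m(1) power_add, simp add: m(2) power_add)
  have ep1: "elementary_process M F ?n ?\<tau> (\<xi>1 i)" for i
    using elementary_process_refine[where d = d, OF approx_coef_elementary[where b = b and n = "T * 2 ^ k" and k = k and i = i, OF b] subalgebra_F_F]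
    unfolding \<xi>1_def[abs_def] n(1) by (simp add: m(1)[symmetric])
  have ep2: "elementary_process M F ?n ?\<tau> (\<xi>2 i)" for i
    using elementary_process_refine[where d = d', OF approx_coef_elementary[where b = b' and n = "T * 2 ^ l" and k = l and i = i, OF b'] subalgebra_F_F]
    unfolding \<xi>2_def[abs_def] n(2) by (simp add: m(2)[symmetric])
  have "elementary_process M F ?n ?\<tau> (\<xi> i)" for i
    unfolding elementary_process_def
  proof (intro conjI allI impI)
    fix j assume j: "j < ?n"
    have "\<xi>1 i j \<in> borel_measurable (F (?\<tau> j))" "\<xi>2 i j \<in> borel_measurable (F (?\<tau> j))"
      using ep1[of i] ep2[of i] j unfolding elementary_process_def by blast+
    then show "\<xi> i j \<in> borel_measurable (F (?\<tau> j))" unfolding \<xi>_def by (rule borel_measurable_diff)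
    have "bounded (\<xi>1 i j ` space M)" "bounded (\<xi>2 i j ` space M)"
      using ep1[of i] ep2[of i] j unfolding elementary_process_def by blast+
    then obtain K K' where K: "\<forall>\<omega>\<in>space M. norm (\<xi>1 i j \<omega>) \<le> K" "\<forall>\<omega>\<in>space M. norm (\<xi>2 i j \<omega>) \<le> K'"
      unfolding bounded_iff by blast
    have "norm (\<xi> i j \<omega>) \<le> K + K'" if "\<omega> \<in> space M" for \<omega>
      unfolding \<xi>_def using K that by (intro order_trans[OF norm_triangle_ineq4] add_mono) auto
    then show "bounded (\<xi> i j ` space M)" unfolding bounded_iff by blast
  qed (auto simp: divide_right_mono)
  moreover have "family_integral m ?n ?\<tau> \<xi> t \<omega> = approx_int k b t \<omega> - approx_int l b' t \<omega>" if t: "0 \<le> t" "t \<le> real T" for t \<omega>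
  proof -
    have "family_integral m ?n ?\<tau> \<xi> t \<omega> = family_integral m ?n ?\<tau> \<xi>1 t \<omega> - family_integral m ?n ?\<tau> \<xi>2 t \<omega>"
      unfolding family_integral_def elementary_integral_def \<xi>_def by (simp add: scaleR_diff_right sum_subtractf)
    also have "family_integral m ?n ?\<tau> \<xi>1 t \<omega> = family_integral m (T * 2 ^ k) (dyadic k) (approx_coef k b) t \<omega>"
      unfolding family_integral_def \<xi>1_def[abs_def]
    proof (intro sum.cong refl)
      fix i
      show "elementary_integral (W i) ?n ?\<tau> (\<lambda>j. approx_coef k b i (j div 2 ^ d)) t \<omega>
        = elementary_integral (W i) (T * 2 ^ k) (dyadic k) (approx_coef k b i) t \<omega>"
        using elementary_integral_refine[where w = "W i" and n = "T * 2 ^ k" and d = d and k = k and \<xi> = "approx_coef k b i" and t = t and \<omega> = \<omega>]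
        by (simp only: n(1)[symmetric] m(1)[symmetric])
    qed
    also have "\<dots> = approx_int k b t \<omega>" by (rule approx_int_extend[OF t(1) _ t(2), symmetric]) (simp add: m_def)
    also have "family_integral m ?n ?\<tau> \<xi>2 t \<omega> = family_integral m (T * 2 ^ l) (dyadic l) (approx_coef l b') t \<omega>"
      unfolding family_integral_def \<xi>2_def[abs_def]
    proof (intro sum.cong refl)
      fix i
      show "elementary_integral (W i) ?n ?\<tau> (\<lambda>j. approx_coef l b' i (j div 2 ^ d')) t \<omega>
        = elementary_integral (W i) (T * 2 ^ l) (dyadic l) (approx_coef l b' i) t \<omega>"
        using elementary_integral_refine[where w = "W i" and n = "T * 2 ^ l" and d = d' and k = l and \<xi> = "approx_coef l b' i" and t = t and \<omega> = \<omega>]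
        by (simp only: n(2)[symmetric] m(2)[symmetric])
    qed
    also have "\<dots> = approx_int l b' t \<omega>" by (rule approx_int_extend[OF t(1) _ t(2), symmetric]) (simp add: m_def)
    finally show ?thesis .
  qed
  moreover have "elementary_value ?n ?\<tau> (\<xi> i) s \<omega> = approx_val k b i s \<omega> - approx_val l b' i s \<omega>" if s: "0 \<le> s" "s \<le> real T" for i s \<omega>
  proof -
    have "elementary_value ?n ?\<tau> (\<xi> i) s \<omega> = elementary_value ?n ?\<tau> (\<xi>1 i) s \<omega> - elementary_value ?n ?\<tau> (\<xi>2 i) s \<omega>"
      unfolding elementary_value_def \<xi>_def by (simp add: scaleR_diff_right sum_subtractf)
    also have "elementary_value ?n ?\<tau> (\<xi>1 i) s \<omega> = elementary_value (T * 2 ^ k) (dyadic k) (approx_coef k b i) s \<omega>"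
      using elementary_value_refine[where n = "T * 2 ^ k" and d = d and k = k and \<xi> = "approx_coef k b i" and s = s and \<omega> = \<omega>]
      unfolding \<xi>1_def[abs_def] by (simp only: n(1)[symmetric] m(1)[symmetric])
    also have "\<dots> = approx_val k b i s \<omega>" using s by (intro elementary_value_approx) auto
    also have "elementary_value ?n ?\<tau> (\<xi>2 i) s \<omega> = elementary_value (T * 2 ^ l) (dyadic l) (approx_coef l b' i) s \<omega>"
      using elementary_value_refine[where n = "T * 2 ^ l" and d = d' and k = l and \<xi> = "approx_coef l b' i" and s = s and \<omega> = \<omega>]
      unfolding \<xi>2_def[abs_def] by (simp only: n(2)[symmetric] m(2)[symmetric])
    also have "\<dots> = approx_val l b' i s \<omega>" using s by (intro elementary_value_approx) auto
    finally show ?thesis .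
  qed
  moreover have "approx_val k b i s \<omega> - approx_val l b' i s \<omega> = 0" if "m \<le> i" for i s \<omega>
    using that by (simp add: approx_val_def m_def)
  ultimately show ?thesis by (rule that)
qed

lemma approx_int_measurable:
  fixes b :: "nat \<Rightarrow> real \<Rightarrow> 'a \<Rightarrow> 'h::{real_inner, banach, second_countable_topology}"
  assumes "\<And>i. progressively_measurable F borel (b i)" "0 \<le> t"
  shows "approx_int k b t \<in> borel_measurable (F t)"
  unfolding approx_int_def by (rule family_integral_measurable[OF approx_coef_elementary[OF assms(1)] assms(2)])

lemma approx_int_continuous:
  assumes W: "\<And>i. continuous_on {0..} (\<lambda>t. W i t \<omega>)"
  shows "continuous_on {0..real T} (\<lambda>t. approx_int k b t \<omega>)"
proof -
  have "continuous_on {0..real T} (\<lambda>t. family_integral k (T * 2 ^ k) (dyadic k) (approx_coef k b) t \<omega>)"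
    unfolding family_integral_def elementary_integral_def
    by (intro continuous_intros continuous_on_compose2[OF W]) auto
  then show ?thesis
    by (rule continuous_on_cong[THEN iffD1, rotated 2]) (auto intro!: approx_int_extend[symmetric])
qed

text \<open>Exact for any two levels and any two integrands, because the difference is elementary on
  the common grid; the terms of the series in \<open>energy\<close> vanish from the larger of the
  two levels on.\<close>

lemma approx_int_isometry:
  fixes b b' :: "nat \<Rightarrow> real \<Rightarrow> 'a \<Rightarrow> 'h::{real_inner, banach, second_countable_topology}"
  assumes b: "\<And>i. progressively_measurable F borel (b i)" and b': "\<And>i. progressively_measurable F borel (b' i)"
    and t: "0 \<le> t"
  shows "(\<integral>\<^sup>+\<omega>. nsq (approx_int k b t \<omega> - approx_int l b' t \<omega>) \<partial>M)
    = energy (\<lambda>i s \<omega>. approx_val k b i s \<omega> - approx_val l b' i s \<omega>) t"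
proof -
  obtain T where T: "t \<le> real T" using real_arch_simple by blast
  obtain m n \<tau> \<xi> where ep: "\<And>i. elementary_process M F n \<tau> (\<xi> i)"
    and int: "\<And>t \<omega>. 0 \<le> t \<Longrightarrow> t \<le> real T \<Longrightarrow> family_integral m n \<tau> \<xi> t \<omega> = approx_int k b t \<omega> - approx_int l b' t \<omega>"
    and val: "\<And>i s \<omega>. 0 \<le> s \<Longrightarrow> s \<le> real T \<Longrightarrow> elementary_value n \<tau> (\<xi> i) s \<omega> = approx_val k b i s \<omega> - approx_val l b' i s \<omega>"
    and z: "\<And>i s \<omega>. m \<le> i \<Longrightarrow> approx_val k b i s \<omega> - approx_val l b' i s \<omega> = 0"
    by (rule approx_int_diff[where b = b and b' = b' and k = k and l = l and T = T, OF b b']) (rule that; assumption)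
  have "(\<integral>\<^sup>+\<omega>. nsq (approx_int k b t \<omega> - approx_int l b' t \<omega>) \<partial>M)
    = (\<Sum>i<m. \<integral>\<^sup>+\<omega>. (sq_integral t (\<lambda>s. elementary_value n \<tau> (\<xi> i) s \<omega>)) \<partial>M)"
    using family_integral_isometry[where m = m and n = n and \<tau> = \<tau> and \<xi> = \<xi>, OF ep t] int[OF t T] by simp
  also have "\<dots> = (\<Sum>i<m. \<integral>\<^sup>+\<omega>. (sq_integral t (\<lambda>s. approx_val k b i s \<omega> - approx_val l b' i s \<omega>)) \<partial>M)"
    using T by (intro sum.cong refl nn_integral_cong) (auto simp: indicator_def val)
  also have "\<dots> = energy (\<lambda>i s \<omega>. approx_val k b i s \<omega> - approx_val l b' i s \<omega>) t"
    unfolding energy_def by (rule suminf_finite[symmetric]) (auto simp: z)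
  finally show ?thesis .
qed

lemma approx_int_doob:
  fixes b b' :: "nat \<Rightarrow> real \<Rightarrow> 'a \<Rightarrow> 'h::{real_inner, banach, second_countable_topology}"
  assumes b: "\<And>i. progressively_measurable F borel (b i)" and b': "\<And>i. progressively_measurable F borel (b' i)"
    and K: "0 \<le> K"
    and c: "0 \<le> c" "energy (\<lambda>i s \<omega>. approx_val k b i s \<omega> - approx_val l b' i s \<omega>) (real T) \<le> ennreal c"
  defines "E \<equiv> {\<omega>\<in>space M. \<exists>N. \<exists>j\<le>T * 2 ^ N. norm (approx_int k b (dyadic N j) \<omega> - approx_int l b' (dyadic N j) \<omega>) > K}"
  shows "E \<in> sets M" "K\<^sup>2 * prob E \<le> c"
proof -
  obtain m n \<tau> \<xi> where ep: "\<And>i. elementary_process M F n \<tau> (\<xi> i)"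
    and int: "\<And>t \<omega>. 0 \<le> t \<Longrightarrow> t \<le> real T \<Longrightarrow> family_integral m n \<tau> \<xi> t \<omega> = approx_int k b t \<omega> - approx_int l b' t \<omega>"
    and "\<And>i s \<omega>. 0 \<le> s \<Longrightarrow> s \<le> real T \<Longrightarrow> elementary_value n \<tau> (\<xi> i) s \<omega> = approx_val k b i s \<omega> - approx_val l b' i s \<omega>"
    and "\<And>i s \<omega>. m \<le> i \<Longrightarrow> approx_val k b i s \<omega> - approx_val l b' i s \<omega> = 0"
    by (rule approx_int_diff[where b = b and b' = b' and k = k and l = l and T = T, OF b b']) (rule that; assumption)
  have pT: "dyadic N j \<le> real T" if "j \<le> T * 2 ^ N" for N j
  proof -
    have "real j \<le> real (T * 2 ^ N)" using that by (simp only: of_nat_le_iff)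
    then show ?thesis by (simp add: field_simps)
  qed
  have E: "E = {\<omega>\<in>space M. \<exists>N. \<exists>l\<le>T * 2 ^ N. norm (family_integral m n \<tau> \<xi> (dyadic N l) \<omega>) > K}"
  proof -
    have "family_integral m n \<tau> \<xi> (dyadic N j) \<omega> = approx_int k b (dyadic N j) \<omega> - approx_int l b' (dyadic N j) \<omega>"
      if "j \<le> T * 2 ^ N" for N j \<omega> by (rule int) (use pT[OF that] in auto)
    then show ?thesis unfolding E_def by (intro Collect_cong conj_cong refl ex_cong1) auto
  qed
  have c': "(\<integral>\<^sup>+\<omega>. nsq (family_integral m n \<tau> \<xi> (real T) \<omega>) \<partial>M) \<le> ennreal c"
    using c(2) approx_int_isometry[where b = b and b' = b' and k = k and l = l and t = "real T", OF b b'] by (simp add: int)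
  show "E \<in> sets M" "K\<^sup>2 * prob E \<le> c"
    unfolding E by (rule family_integral_doob[OF ep K c(1) c'])+
qed

section \<open>Mean-square convergence of the approximations\<close>

lemma norm_diff_sq_le: "nsq (x - y) \<le> 2 * ennreal ((norm x)\<^sup>2) + 2 * nsq (y::'h::real_normed_vector)"
proof -
  have "(norm (x - y))\<^sup>2 \<le> 2 * (norm x)\<^sup>2 + 2 * (norm y)\<^sup>2" using norm_add_sq_le[of x "- y"] by simp
  then have "nsq (x - y) \<le> ennreal (2 * (norm x)\<^sup>2 + 2 * (norm y)\<^sup>2)" by (rule ennreal_leI)
  also have "\<dots> = 2 * ennreal ((norm x)\<^sup>2) + 2 * ennreal ((norm y)\<^sup>2)"
    by (subst ennreal_plus) (auto simp: ennreal_mult)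
  finally show ?thesis .
qed

text \<open>Only countably many cells occur, and on each of them the approximation does not depend
  on the time, so joint measurability reduces to that of single cell means.\<close>

lemma approx_val_measurable:
  fixes b :: "nat \<Rightarrow> real \<Rightarrow> 'a \<Rightarrow> 'h::{banach, second_countable_topology}"
  assumes b: "\<And>i. progressively_measurable F borel (b i)"
  shows "(\<lambda>(s, \<omega>). approx_val k b i s \<omega>) \<in> borel_measurable (borel \<Otimes>\<^sub>M M)"
proof (cases "i < k")
  case True
  have cm: "(\<lambda>\<omega>. cell_mean k (cutoff k (\<lambda>r. b i r \<omega>)) j) \<in> borel_measurable M" for j
  proof (cases "j < 0")
    case False
    then show ?thesis
      using measurable_F_M[OF _ cell_mean_measurable[where k = k and j = "nat j", OF b[of i]]] by simp
  qed (simp add: cell_mean_negative)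
  have "(\<lambda>p :: real \<times> 'a. cell_mean k (cutoff k (\<lambda>r. b i r (snd p))) (\<lceil>fst p * 2 ^ k\<rceil> - 1)) \<in> borel_measurable (borel \<Otimes>\<^sub>M M)"
  proof (rule measurable_compose_countable[where f = "\<lambda>j p. cell_mean k (cutoff k (\<lambda>r. b i r (snd p))) j" and g = "\<lambda>p :: real \<times> 'a. \<lceil>fst p * 2 ^ k\<rceil> - 1"])
    show "(\<lambda>p. cell_mean k (cutoff k (\<lambda>r. b i r (snd p))) j) \<in> borel_measurable (borel \<Otimes>\<^sub>M M)" for j
      by (rule measurable_compose[OF measurable_snd cm])
    show "(\<lambda>p. \<lceil>fst p * 2 ^ k\<rceil> - 1) \<in> (borel :: real measure) \<Otimes>\<^sub>M M \<rightarrow>\<^sub>M count_space UNIV" by measurable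
  qed
  then show ?thesis using True by (simp add: approx_val_def past_avg_def case_prod_unfold)
qed (simp add: approx_val_def)

lemma energy_pair_measurable:
  fixes f :: "real \<Rightarrow> 'a \<Rightarrow> 'h::{banach, second_countable_topology}"
  assumes "(\<lambda>(s, \<omega>). indicat_real {0..t} s *\<^sub>R f s \<omega>) \<in> borel_measurable (borel \<Otimes>\<^sub>M M)"
  shows "(\<lambda>\<omega>. sq_integral t (\<lambda>s. f s \<omega>)) \<in> borel_measurable M"
proof -
  have [measurable]: "(\<lambda>p. indicat_real {0..t} (snd p) *\<^sub>R f (snd p) (fst p)) \<in> borel_measurable (M \<Otimes>\<^sub>M lborel)"
  proof -
    have "(\<lambda>p. (snd p, fst p)) \<in> M \<Otimes>\<^sub>M lborel \<rightarrow>\<^sub>M borel \<Otimes>\<^sub>M M" by measurable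
    from measurable_compose[OF this assms] show ?thesis by simp
  qed
  have "(\<lambda>\<omega>. \<integral>\<^sup>+s. nsq (indicat_real {0..t} s *\<^sub>R f s \<omega>) \<partial>lborel) \<in> borel_measurable M"
    by (rule lborel.borel_measurable_nn_integral) (unfold case_prod_unfold, measurable)
  moreover have "(\<integral>\<^sup>+s. nsq (indicat_real {0..t} s *\<^sub>R f s \<omega>) \<partial>lborel)
     = (sq_integral t (\<lambda>s. f s \<omega>))" for \<omega>
    by (intro nn_integral_cong) (auto simp: indicator_def)
  ultimately show ?thesis by simp
qed

text \<open>Dominated convergence is used twice: over the sample space for each component, and over
  the components with respect to counting measure. The dominating functions come from the
  contraction property of truncated averages.\<close>

lemma approx_val_tendsto:
  fixes b :: "nat \<Rightarrow> real \<Rightarrow> 'a \<Rightarrow> 'h::{banach, second_countable_topology}"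
  assumes b: "ito_integrand b"
  shows "(\<lambda>k. energy (\<lambda>i s \<omega>. approx_val k b i s \<omega> - b i s \<omega>) t) \<longlonglongrightarrow> 0"
proof (cases "0 \<le> t")
  case True
  have pm: "progressively_measurable F borel (b i)" for i using b by (simp add: ito_integrand_def)
  define e where "e i = (\<integral>\<^sup>+\<omega>. (sq_integral t (\<lambda>s. b i s \<omega>)) \<partial>M)" for i
  define Q where "Q k i \<omega> = (sq_integral t (\<lambda>s. approx_val k b i s \<omega> - b i s \<omega>))" for k i \<omega>
  define B where "B i \<omega> = (sq_integral t (\<lambda>s. b i s \<omega>))" for i \<omega>
  have sume: "(\<Sum>i. e i) < \<infinity>" using b unfolding ito_integrand_def energy_def e_def by blast
  have efin: "e i < \<infinity>" for i
    using sume ennreal_suminf_lessD[of e \<infinity>] by auto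
  have BM [measurable]: "B i \<in> borel_measurable M" for i
    unfolding B_def by (rule energy_pair_measurable[OF progressive_extend_M[OF pm True]])
  have QM [measurable]: "Q k i \<in> borel_measurable M" for k i
    unfolding Q_def
  proof (rule energy_pair_measurable)
    have [measurable]: "(\<lambda>p. approx_val k b i (fst p) (snd p)) \<in> borel_measurable (borel \<Otimes>\<^sub>M M)"
      using approx_val_measurable[where b = b and k = k and i = i, OF pm] by (simp add: case_prod_unfold)
    have [measurable]: "(\<lambda>p. indicat_real {0..t} (fst p) *\<^sub>R b i (fst p) (snd p)) \<in> borel_measurable (borel \<Otimes>\<^sub>M M)"
      using progressive_extend_M[OF pm True, of i] by (simp add: case_prod_unfold)
    show "(\<lambda>(s, \<omega>). indicat_real {0..t} s *\<^sub>R (approx_val k b i s \<omega> - b i s \<omega>)) \<in> borel_measurable (borel \<Otimes>\<^sub>M M)"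
      unfolding case_prod_unfold scaleR_diff_right by measurable
  qed
  \<comment> \<open>The 4 is 2 + 2: the doubled triangle inequality, with both squares bounded by
    the energy of the path.\<close>
  have QB: "Q k i \<omega> \<le> 4 * B i \<omega>" if \<omega>: "\<omega> \<in> space M" for k i \<omega>
  proof -
    define g where "g r = indicat_real {0..t} r *\<^sub>R b i r \<omega>" for r
    have sec: "(\<lambda>r. indicat_real {0..t} r *\<^sub>R b i r \<omega>) \<in> borel_measurable borel" by (rule progressive_section[OF pm \<omega>])
    then have [measurable]: "g \<in> borel_measurable borel" by (simp add: g_def[abs_def])
    have [measurable]: "(\<lambda>s. approx_val k b i s \<omega>) \<in> borel_measurable borel"
    proof -
      have "(\<lambda>s. (s, \<omega>)) \<in> borel \<rightarrow>\<^sub>M borel \<Otimes>\<^sub>M M" using \<omega> by measurable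
      from measurable_compose[OF this approx_val_measurable[where b = b and k = k and i = i, OF pm]] show ?thesis by simp
    qed
    have 1: "(sq_integral t (\<lambda>s. approx_val k b i s \<omega>)) \<le> B i \<omega>"
      unfolding B_def approx_val_def using past_avg_cutoff_contraction[OF sec, of k] by (cases "i < k") auto
    have "Q k i \<omega> \<le> (\<integral>\<^sup>+s. 2 * (nsq (approx_val k b i s \<omega>) * indicator {0..t} s) + 2 * nsq (g s) \<partial>lborel)"
      unfolding Q_def by (intro nn_integral_mono) (auto simp: indicator_def norm_diff_sq_le g_def)
    also have "\<dots> = 2 * (sq_integral t (\<lambda>s. approx_val k b i s \<omega>)) + 2 * (\<integral>\<^sup>+s. nsq (g s) \<partial>lborel)"
      by (subst nn_integral_add) (auto simp: nn_integral_cmult)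
    also have "(\<integral>\<^sup>+s. nsq (g s) \<partial>lborel) = B i \<omega>"
      unfolding B_def by (intro nn_integral_cong) (auto simp: indicator_def g_def)
    also have "2 * (sq_integral t (\<lambda>s. approx_val k b i s \<omega>)) + 2 * B i \<omega> \<le> 2 * B i \<omega> + 2 * B i \<omega>"
      by (intro add_mono mult_left_mono 1) auto
    also have "\<dots> = 4 * B i \<omega>" by (simp add: distrib_right[symmetric])
    finally show ?thesis .
  qed
  have eB: "e i = (\<integral>\<^sup>+\<omega>. B i \<omega> \<partial>M)" for i by (simp add: e_def B_def)
  have Bfin: "AE \<omega> in M. B i \<omega> < \<infinity>" for i
    using nn_integral_PInf_AE[OF BM, of i] efin[of i] unfolding eB by (auto simp: less_top)
  have QL: "(\<lambda>k. \<integral>\<^sup>+\<omega>. Q k i \<omega> \<partial>M) \<longlonglongrightarrow> 0" for i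
  proof -
    have "(\<lambda>k. \<integral>\<^sup>+\<omega>. Q k i \<omega> \<partial>M) \<longlonglongrightarrow> (\<integral>\<^sup>+\<omega>. 0 \<partial>M)"
    proof (rule nn_integral_dominated_convergence[where w = "\<lambda>\<omega>. 4 * B i \<omega>"])
      show "AE \<omega> in M. Q k i \<omega> \<le> 4 * B i \<omega>" for k using QB by (intro AE_I2)
      show "(\<integral>\<^sup>+\<omega>. 4 * B i \<omega> \<partial>M) < \<infinity>"
        using efin[of i] by (simp add: nn_integral_cmult eB[symmetric] ennreal_mult_less_top)
      show "AE \<omega> in M. (\<lambda>k. Q k i \<omega>) \<longlonglongrightarrow> 0"
        using Bfin[of i] AE_space
      proof eventually_elim
        case (elim \<omega>)
        have "(\<lambda>k. sq_integral t (\<lambda>s. past_avg k (cutoff k (\<lambda>r. b i r \<omega>)) s - b i s \<omega>)) \<longlonglongrightarrow> 0"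
          by (rule past_avg_cutoff_tendsto[OF progressive_section[OF pm elim(2)]])
             (use elim(1) in \<open>simp add: B_def\<close>)
        \<comment> \<open>Component \<open>i\<close> is absent from the approximation until
          \<open>k\<close> exceeds \<open>i\<close>.\<close>
        moreover have "\<forall>\<^sub>F k in sequentially. (sq_integral t (\<lambda>s. past_avg k (cutoff k (\<lambda>r. b i r \<omega>)) s - b i s \<omega>)) = Q k i \<omega>"
          using eventually_gt_at_top[of i] by eventually_elim (simp add: Q_def approx_val_def)
        ultimately show ?case by (rule Lim_transform_eventually)
      qed
    qed auto
    then show ?thesis by simp
  qed
  have "(\<lambda>k. \<integral>\<^sup>+i. (\<integral>\<^sup>+\<omega>. Q k i \<omega> \<partial>M) \<partial>count_space UNIV) \<longlonglongrightarrow> (\<integral>\<^sup>+i. 0 \<partial>count_space (UNIV :: nat set))"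
  proof (rule nn_integral_dominated_convergence[where w = "\<lambda>i. 4 * e i"])
    show "AE i in count_space UNIV. (\<integral>\<^sup>+\<omega>. Q k i \<omega> \<partial>M) \<le> 4 * e i" for k
    proof (rule AE_I2)
      fix i
      have "(\<integral>\<^sup>+\<omega>. Q k i \<omega> \<partial>M) \<le> (\<integral>\<^sup>+\<omega>. 4 * B i \<omega> \<partial>M)" by (intro nn_integral_mono QB)
      then show "(\<integral>\<^sup>+\<omega>. Q k i \<omega> \<partial>M) \<le> 4 * e i" by (simp add: nn_integral_cmult eB)
    qed
    show "(\<integral>\<^sup>+i. 4 * e i \<partial>count_space UNIV) < \<infinity>"
      using sume by (simp add: nn_integral_cmult nn_integral_count_space_nat ennreal_mult_less_top)
  qed (use QL in auto)
  then show ?thesis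
    unfolding energy_def Q_def by (simp add: nn_integral_count_space_nat)
qed (simp add: energy_def)

end

section \<open>The Ito process\<close>

lemma nn_integral_norm_diff_sq_le:
  fixes f g h :: "'a \<Rightarrow> 'h::{banach, second_countable_topology}"
  assumes [measurable]: "f \<in> borel_measurable M" "g \<in> borel_measurable M" "h \<in> borel_measurable M"
  shows "(\<integral>\<^sup>+x. nsq (f x - g x) \<partial>M)
    \<le> 2 * (\<integral>\<^sup>+x. nsq (f x - h x) \<partial>M) + 2 * (\<integral>\<^sup>+x. nsq (g x - h x) \<partial>M)"
proof -
  have le: "nsq (f x - g x) \<le> 2 * nsq (f x - h x) + 2 * nsq (g x - h x)" for x
  proof -
    have "(norm (f x - g x))\<^sup>2 \<le> 2 * (norm (f x - h x))\<^sup>2 + 2 * (norm (g x - h x))\<^sup>2"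
      using norm_add_sq_le[of "f x - h x" "- (g x - h x)"] unfolding norm_minus_cancel by simp
    then have "nsq (f x - g x) \<le> ennreal (2 * (norm (f x - h x))\<^sup>2 + 2 * (norm (g x - h x))\<^sup>2)" by (rule ennreal_leI)
    then show ?thesis by (subst (asm) ennreal_plus) (auto simp: ennreal_mult)
  qed
  have "(\<integral>\<^sup>+x. nsq (f x - g x) \<partial>M)
      \<le> (\<integral>\<^sup>+x. 2 * nsq (f x - h x) + 2 * nsq (g x - h x) \<partial>M)"
    by (intro nn_integral_mono le)
  also have "\<dots> = 2 * (\<integral>\<^sup>+x. nsq (f x - h x) \<partial>M) + 2 * (\<integral>\<^sup>+x. nsq (g x - h x) \<partial>M)"
    by (simp add: nn_integral_add nn_integral_cmult)
  finally show ?thesis .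
qed

text \<open>The constant is crude, but the number of summands stays fixed whenever the bound is
  used.\<close>

lemma norm_sum_sq_le:
  "nsq (\<Sum>i<m. x i) \<le> 2 ^ m * (\<Sum>i<m. nsq (x i :: 'h::real_normed_vector))"
proof (induction m)
  case (Suc m)
  have "(norm ((\<Sum>i<m. x i) + x m))\<^sup>2 \<le> 2 * (norm (\<Sum>i<m. x i))\<^sup>2 + 2 * (norm (x m))\<^sup>2" by (rule norm_add_sq_le)
  then have "nsq (\<Sum>i<Suc m. x i) \<le> ennreal (2 * (norm (\<Sum>i<m. x i))\<^sup>2 + 2 * (norm (x m))\<^sup>2)"
    by (intro ennreal_leI) simp
  also have "\<dots> = 2 * nsq (\<Sum>i<m. x i) + 2 * nsq (x m)"
    by (subst ennreal_plus) (auto simp: ennreal_mult)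
  also have "\<dots> \<le> 2 * (2 ^ m * (\<Sum>i<m. nsq (x i))) + 2 * (2 ^ m * nsq (x m))"
  proof (intro add_mono mult_left_mono Suc)
    have "1 * nsq (x m) \<le> 2 ^ m * nsq (x m)"
      by (intro mult_right_mono one_le_power) (auto simp: one_le_numeral)
    then show "nsq (x m) \<le> 2 ^ m * nsq (x m)" by simp
  qed auto
  also have "\<dots> = 2 ^ Suc m * (\<Sum>i<Suc m. nsq (x i))"
    by (simp add: distrib_left mult.assoc)
  finally show ?case .
qed simp

context cylindrical_bm
begin

text \<open>Convergence is required along the canonical approximations, not along some elementary
  sequence: two integrals can then be compared by the isometry at equal levels. Continuity of the
  paths is kept apart.\<close>

definition ito_process :: "(nat \<Rightarrow> real \<Rightarrow> 'a \<Rightarrow> 'h::{real_inner, banach, second_countable_topology}) \<Rightarrow> (real \<Rightarrow> 'a \<Rightarrow> 'h) \<Rightarrow> bool" where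
  "ito_process b X \<longleftrightarrow> (\<forall>t\<ge>0. X t \<in> borel_measurable (F t)) \<and>
     (\<forall>t\<ge>0. (\<lambda>k. \<integral>\<^sup>+\<omega>. nsq (approx_int k b t \<omega> - X t \<omega>) \<partial>M) \<longlonglongrightarrow> 0)"

text \<open>The common ground of progressive processes, known to be measurable only on bounded time
  intervals, and of their approximations.\<close>

definition energy_measurable :: "real \<Rightarrow> (nat \<Rightarrow> real \<Rightarrow> 'a \<Rightarrow> 'h::{banach, second_countable_topology}) \<Rightarrow> bool" where
  "energy_measurable t f \<longleftrightarrow> (\<forall>i. (\<lambda>(s, \<omega>). indicat_real {0..t} s *\<^sub>R f i s \<omega>) \<in> borel_measurable (borel \<Otimes>\<^sub>M M))"

lemma energy_measurable_progressive:
  "(\<And>i. progressively_measurable F borel (b i)) \<Longrightarrow> 0 \<le> t \<Longrightarrow> energy_measurable t b"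
  unfolding energy_measurable_def using progressive_extend_M by blast

lemma energy_measurable_approx:
  fixes b :: "nat \<Rightarrow> real \<Rightarrow> 'a \<Rightarrow> 'h::{banach, second_countable_topology}"
  assumes "\<And>i. progressively_measurable F borel (b i)"
  shows "energy_measurable t (approx_val k b)"
  unfolding energy_measurable_def
proof
  fix i
  have [measurable]: "(\<lambda>p. approx_val k b i (fst p) (snd p)) \<in> borel_measurable (borel \<Otimes>\<^sub>M M)"
    using approx_val_measurable[where b = b and k = k and i = i, OF assms] by (simp add: case_prod_unfold)
  show "(\<lambda>(s, \<omega>). indicat_real {0..t} s *\<^sub>R approx_val k b i s \<omega>) \<in> borel_measurable (borel \<Otimes>\<^sub>M M)"
    unfolding case_prod_unfold by measurable
qed

lemma energy_pair_eq:
  fixes f :: "real \<Rightarrow> 'a \<Rightarrow> 'h::{banach, second_countable_topology}"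
  assumes "(\<lambda>(s, \<omega>). indicat_real {0..t} s *\<^sub>R f s \<omega>) \<in> borel_measurable (borel \<Otimes>\<^sub>M M)"
  shows "(\<integral>\<^sup>+\<omega>. (sq_integral t (\<lambda>s. f s \<omega>)) \<partial>M)
    = (\<integral>\<^sup>+p. nsq (indicat_real {0..t} (snd p) *\<^sub>R f (snd p) (fst p)) \<partial>(M \<Otimes>\<^sub>M lborel))"
proof -
  have [measurable]: "(\<lambda>p. indicat_real {0..t} (snd p) *\<^sub>R f (snd p) (fst p)) \<in> borel_measurable (M \<Otimes>\<^sub>M lborel)"
  proof -
    have "(\<lambda>p. (snd p, fst p)) \<in> M \<Otimes>\<^sub>M lborel \<rightarrow>\<^sub>M borel \<Otimes>\<^sub>M M" by measurable
    from measurable_compose[OF this assms] show ?thesis by simp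
  qed
  have g: "(\<lambda>p. nsq (indicat_real {0..t} (snd p) *\<^sub>R f (snd p) (fst p))) \<in> borel_measurable (M \<Otimes>\<^sub>M lborel)"
    by measurable
  have "(\<integral>\<^sup>+p. nsq (indicat_real {0..t} (snd p) *\<^sub>R f (snd p) (fst p)) \<partial>(M \<Otimes>\<^sub>M lborel))
    = (\<integral>\<^sup>+\<omega>. (\<integral>\<^sup>+s. nsq (indicat_real {0..t} s *\<^sub>R f s \<omega>) \<partial>lborel) \<partial>M)"
    using lborel.nn_integral_fst[OF g] by (simp only: fst_conv snd_conv)
  also have "\<dots> = (\<integral>\<^sup>+\<omega>. (sq_integral t (\<lambda>s. f s \<omega>)) \<partial>M)"
    by (intro nn_integral_cong) (auto simp: indicator_def)
  finally show ?thesis by simp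
qed

lemma energy_triangle:
  fixes f g h :: "nat \<Rightarrow> real \<Rightarrow> 'a \<Rightarrow> 'h::{banach, second_countable_topology}"
  assumes m: "energy_measurable t f" "energy_measurable t g" "energy_measurable t h"
  shows "energy (\<lambda>i s \<omega>. f i s \<omega> - g i s \<omega>) t \<le> 2 * energy (\<lambda>i s \<omega>. f i s \<omega> - h i s \<omega>) t + 2 * energy (\<lambda>i s \<omega>. g i s \<omega> - h i s \<omega>) t"
proof -
  let ?e = "\<lambda>f i. \<integral>\<^sup>+\<omega>. (sq_integral t (\<lambda>s. f i s \<omega>)) \<partial>M"
  let ?j = "\<lambda>f i p. indicat_real {0..t} (snd p) *\<^sub>R f i (snd p) (fst p)"
  have jm: "?j f i \<in> borel_measurable (M \<Otimes>\<^sub>M lborel)" if "energy_measurable t f" for f :: "nat \<Rightarrow> real \<Rightarrow> 'a \<Rightarrow> 'h" and i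
  proof -
    have "(\<lambda>p. (snd p, fst p)) \<in> M \<Otimes>\<^sub>M lborel \<rightarrow>\<^sub>M borel \<Otimes>\<^sub>M M" by measurable
    from measurable_compose[OF this that[unfolded energy_measurable_def, rule_format, of i]] show ?thesis by simp
  qed
  have dm: "(\<lambda>(s, \<omega>). indicat_real {0..t} s *\<^sub>R (f i s \<omega> - g i s \<omega>)) \<in> borel_measurable (borel \<Otimes>\<^sub>M M)"
    if "energy_measurable t f" "energy_measurable t g" for f g :: "nat \<Rightarrow> real \<Rightarrow> 'a \<Rightarrow> 'h" and i
    using that unfolding energy_measurable_def case_prod_unfold scaleR_diff_right by (intro borel_measurable_diff) auto
  have each: "?e (\<lambda>i s \<omega>. f i s \<omega> - g i s \<omega>) i \<le> 2 * ?e (\<lambda>i s \<omega>. f i s \<omega> - h i s \<omega>) i + 2 * ?e (\<lambda>i s \<omega>. g i s \<omega> - h i s \<omega>) i" for i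
    unfolding energy_pair_eq[OF dm[OF m(1,2)]] energy_pair_eq[OF dm[OF m(1,3)]] energy_pair_eq[OF dm[OF m(2,3)]] scaleR_diff_right
    by (intro nn_integral_norm_diff_sq_le jm m)
  have "energy (\<lambda>i s \<omega>. f i s \<omega> - g i s \<omega>) t \<le> (\<Sum>i. 2 * ?e (\<lambda>i s \<omega>. f i s \<omega> - h i s \<omega>) i + 2 * ?e (\<lambda>i s \<omega>. g i s \<omega> - h i s \<omega>) i)"
    unfolding energy_def by (intro suminf_le each) auto
  also have "\<dots> = 2 * energy (\<lambda>i s \<omega>. f i s \<omega> - h i s \<omega>) t + 2 * energy (\<lambda>i s \<omega>. g i s \<omega> - h i s \<omega>) t"
    unfolding energy_def by (simp add: suminf_add[symmetric] ennreal_suminf_cmult)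
  finally show ?thesis .
qed

lemma approx_int_cauchy:
  fixes b :: "nat \<Rightarrow> real \<Rightarrow> 'a \<Rightarrow> 'h::{real_inner, banach, second_countable_topology}"
  assumes b: "ito_integrand b" and t: "0 \<le> t"
  shows "(\<integral>\<^sup>+\<omega>. nsq (approx_int k b t \<omega> - approx_int l b t \<omega>) \<partial>M)
    \<le> 2 * energy (\<lambda>i s \<omega>. approx_val k b i s \<omega> - b i s \<omega>) t + 2 * energy (\<lambda>i s \<omega>. approx_val l b i s \<omega> - b i s \<omega>) t"
proof -
  have pm: "progressively_measurable F borel (b i)" for i using b by (simp add: ito_integrand_def)
  show ?thesis
    unfolding approx_int_isometry[where b = b and b' = b, OF pm pm t]
    by (intro energy_triangle energy_measurable_approx energy_measurable_progressive pm t)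
qed

lemma W_continuous_AE: "AE \<omega> in M. \<forall>i. continuous_on {0..} (\<lambda>t. W i t \<omega>)"
  unfolding AE_all_countable using W_bm by (auto simp: std_brownian_motion_def)

text \<open>Completeness of \<open>F 0\<close> puts null sets into every \<open>F t\<close>, so a
  process may be reset on a null set without losing adaptedness.\<close>

lemma complete_measurable:
  assumes t: "0 \<le> t" and N: "N \<in> null_sets M" and f: "f \<in> borel_measurable (F t)"
  shows "(\<lambda>\<omega>. if \<omega> \<in> N then (0::'h::{banach, second_countable_topology}) else f \<omega>) \<in> borel_measurable (F t)"
proof -
  have "N \<in> sets (F t)" using complete_F0[OF N order_refl] mono_F[OF order_refl t] by auto
  then have [measurable]: "Measurable.pred (F t) (\<lambda>\<omega>. \<omega> \<in> N)" by (intro pred_sets2[of N]) auto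
  note f [measurable]
  show ?thesis by measurable
qed

lemma AE_null_set:
  assumes "AE \<omega> in M. P \<omega>"
  obtains N where "N \<in> null_sets M" "\<And>\<omega>. \<omega> \<in> space M \<Longrightarrow> \<omega> \<notin> N \<Longrightarrow> P \<omega>"
  using assms unfolding eventually_ae_filter by auto

text \<open>Along a fast subsequence the maximal inequality makes the increments uniformly small
  outside events of summable probability, so almost all paths converge uniformly on bounded
  intervals. Fatou's lemma then identifies the limit in mean square along the full sequence.\<close>

theorem ito_process_exists:
  fixes b :: "nat \<Rightarrow> real \<Rightarrow> 'a \<Rightarrow> 'h::{real_inner, banach, second_countable_topology}"
  assumes b: "ito_integrand b"
  shows "\<exists>X. ito_process b X \<and> (\<forall>\<omega>\<in>space M. continuous_on {0..} (\<lambda>t. X t \<omega>))"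
proof -
  have pm: "progressively_measurable F borel (b i)" for i using b by (simp add: ito_integrand_def)
  define e where "e k t = energy (\<lambda>i s \<omega>. approx_val k b i s \<omega> - b i s \<omega>) t" for k t
  have e0: "(\<lambda>k. e k t) \<longlonglongrightarrow> 0" for t unfolding e_def by (rule approx_val_tendsto[OF b])
  \<comment> \<open>The threshold is chosen backwards. Two such energies, each with factor 2, add up
    to \<open>(1/8) ^ n\<close>; exceeding the level \<open>(1/2) ^ n\<close> then has probability
    at most \<open>(1/8) ^ n / (1/4) ^ n = (1/2) ^ n\<close>, which is summable.\<close>
  have "\<exists>N. \<forall>k\<ge>N. e k (real n) < ennreal ((1/8) ^ n / 4)" for n
    using order_tendstoD(2)[OF e0[of "real n"], of "ennreal ((1/8) ^ n / 4)"] by (auto simp: eventually_sequentially)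
  then obtain N0 where N0: "\<And>n k. N0 n \<le> k \<Longrightarrow> e k (real n) < ennreal ((1/8) ^ n / 4)" by metis
  \<comment> \<open>Adding up the thresholds makes \<open>r\<close> monotone and at least
    \<open>N0 n\<close>; the summand \<open>n\<close> makes it unbounded.\<close>
  define r where "r n = n + (\<Sum>j\<le>n. N0 j)" for n
  have rN: "N0 n \<le> r n" for n unfolding r_def using member_le_sum[of n "{..n}" N0] by auto
  have rS: "r n \<le> r (Suc n)" for n unfolding r_def by simp
  have rn: "n \<le> r n" for n by (simp add: r_def)
  define D where "D n t \<omega> = approx_int (r (Suc n)) b t \<omega> - approx_int (r n) b t \<omega>" for n t \<omega>
  \<comment> \<open>The horizon grows with \<open>n\<close>, so one sequence of events controls
    every bounded interval.\<close>
  define E where "E n = {\<omega>\<in>space M. \<exists>N. \<exists>j\<le>n * 2 ^ N. norm (D n (dyadic N j) \<omega>) > (1/2) ^ n}" for n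
  have en: "energy (\<lambda>i s \<omega>. approx_val (r (Suc n)) b i s \<omega> - approx_val (r n) b i s \<omega>) (real n) \<le> ennreal ((1/8) ^ n)" for n
  proof -
    have "energy (\<lambda>i s \<omega>. approx_val (r (Suc n)) b i s \<omega> - approx_val (r n) b i s \<omega>) (real n) \<le> 2 * e (r (Suc n)) (real n) + 2 * e (r n) (real n)"
      unfolding e_def by (intro energy_triangle energy_measurable_approx energy_measurable_progressive pm) auto
    also have "\<dots> \<le> 2 * ennreal ((1/8) ^ n / 4) + 2 * ennreal ((1/8) ^ n / 4)"
      using rN[of n] rS[of n] by (intro add_mono mult_left_mono less_imp_le[OF N0]) auto
    also have "\<dots> = ennreal ((1/8) ^ n)"
      by (simp add: ennreal_mult[symmetric] ennreal_plus[symmetric] flip: ennreal_numeral del: ennreal_plus)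
    finally show ?thesis .
  qed
  have EM: "E n \<in> sets M" and Ep: "((1/2) ^ n)\<^sup>2 * prob (E n) \<le> (1/8) ^ n" for n
    unfolding E_def D_def by (rule approx_int_doob[OF pm pm _ _ en]; simp)+
  have "prob (E n) \<le> (1/2) ^ n" for n
  proof -
    have "((1/2) ^ n)\<^sup>2 * prob (E n) \<le> ((1/2) ^ n)\<^sup>2 * (1/2) ^ n"
    proof -
      have "((1/2::real) ^ n)\<^sup>2 * (1/2) ^ n = (1/8) ^ n" by (simp add: power2_eq_square power_mult_distrib[symmetric])
      then show ?thesis using Ep[of n] by simp
    qed
    then show ?thesis by (rule mult_left_le_imp_le) simp
  qed
  then have "summable (\<lambda>n. prob (E n))"
    by (intro summable_comparison_test[OF _ summable_geometric[of "1/2::real"]] exI[of _ 0]) auto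
  then have "AE \<omega> in M. \<forall>\<^sub>F n in sequentially. \<omega> \<in> space M - E n"
    by (intro borel_cantelli_AE1 EM) (auto simp: less_top[symmetric])
  then have "AE \<omega> in M. (\<forall>\<^sub>F n in sequentially. \<omega> \<in> space M - E n) \<and> (\<forall>i. continuous_on {0..} (\<lambda>t. W i t \<omega>))"
    using W_continuous_AE by eventually_elim auto
  then obtain N where N: "N \<in> null_sets M"
    and good: "\<And>\<omega>. \<omega> \<in> space M \<Longrightarrow> \<omega> \<notin> N \<Longrightarrow> (\<forall>\<^sub>F n in sequentially. \<omega> \<in> space M - E n) \<and> (\<forall>i. continuous_on {0..} (\<lambda>t. W i t \<omega>))"
    by (rule AE_null_set) (rule that; assumption)
  \<comment> \<open>On the null set the process is reset to 0, so that all paths, and not just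
    almost all, are continuous.\<close>
  define X where "X t \<omega> = (if \<omega> \<in> N then 0 else approx_int (r 0) b t \<omega> + (\<Sum>n. D n t \<omega>))" for t \<omega>
  have unif: "uniform_limit {0..real T} (\<lambda>n t. approx_int (r n) b t \<omega>) (\<lambda>t. X t \<omega>) sequentially"
    if \<omega>: "\<omega> \<in> space M" "\<omega> \<notin> N" for \<omega> T
  proof -
    have W: "continuous_on {0..} (\<lambda>t. W i t \<omega>)" for i using good[OF \<omega>] by blast
    have bound: "\<forall>\<^sub>F n in sequentially. \<forall>t\<in>{0..real T}. norm (D n t \<omega>) \<le> (1/2) ^ n"
      using good[OF \<omega>, THEN conjunct1] eventually_ge_at_top[of T]
    proof eventually_elim
      case (elim n)
      have "continuous_on {0..real n} (\<lambda>t. D n t \<omega>)"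
        unfolding D_def by (intro continuous_on_diff approx_int_continuous W)
      moreover have "norm (D n (dyadic N' j) \<omega>) \<le> (1/2) ^ n" if "j \<le> n * 2 ^ N'" for N' j
        using elim(1) that unfolding E_def by (auto simp: not_less[symmetric])
      ultimately have "norm (D n t \<omega>) \<le> (1/2) ^ n" if "t \<in> {0..real n}" for t
        using that by (rule dyadic_bound_imp_bound)
      then show ?case using elim(2) by auto
    qed
    have "uniform_limit {0..real T} (\<lambda>n t. \<Sum>i<n. D i t \<omega>) (\<lambda>t. \<Sum>i. D i t \<omega>) sequentially"
      by (rule Weierstrass_m_test_ev[OF bound]) (simp add: summable_geometric)
    then have "uniform_limit {0..real T} (\<lambda>n t. approx_int (r 0) b t \<omega> + (\<Sum>i<n. D i t \<omega>)) (\<lambda>t. approx_int (r 0) b t \<omega> + (\<Sum>i. D i t \<omega>)) sequentially"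
      by (intro uniform_limit_intros)
    moreover have "approx_int (r 0) b t \<omega> + (\<Sum>i<n. D i t \<omega>) = approx_int (r n) b t \<omega>" for n t
      unfolding D_def by (subst sum_lessThan_telescope) simp
    ultimately show ?thesis using \<omega> by (simp add: X_def)
  qed
  have lim: "(\<lambda>n. approx_int (r n) b t \<omega>) \<longlonglongrightarrow> X t \<omega>" if "\<omega> \<in> space M" "\<omega> \<notin> N" "0 \<le> t" for t \<omega>
  proof -
    obtain T where "t \<le> real T" using real_arch_simple by blast
    then show ?thesis using tendsto_uniform_limitI[OF unif[OF that(1,2), of T], of t] that(3) by simp
  qed
  have contX: "continuous_on {0..} (\<lambda>t. X t \<omega>)" if \<omega>: "\<omega> \<in> space M" for \<omega>
  proof (cases "\<omega> \<in> N")
    case True then show ?thesis by (simp add: X_def)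
  next
    case False
    have W: "continuous_on {0..} (\<lambda>t. W i t \<omega>)" for i using good[OF \<omega> False] by blast
    have c: "continuous_on {0..real T} (\<lambda>t. X t \<omega>)" for T
      by (rule uniform_limit_theorem[OF always_eventually unif[OF \<omega> False]])
         (auto intro: approx_int_continuous[OF W])
    show ?thesis
      unfolding continuous_on_eq_continuous_within
    proof
      fix t :: real assume t: "t \<in> {0..}"
      obtain T where T: "t < real T" using reals_Archimedean2 by blast
      have "continuous (at t within {0..real T}) (\<lambda>t. X t \<omega>)"
        using c[of T] T t unfolding continuous_on_eq_continuous_within by auto
      moreover have "at t within {0..real T} = at t within {0..}"
        by (rule at_within_nhd[of _ "{..<real T}"]) (use T in auto)
      ultimately show "continuous (at t within {0..}) (\<lambda>t. X t \<omega>)" by (simp add: continuous_within)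
    qed
  qed
  have XF: "X t \<in> borel_measurable (F t)" if t: "0 \<le> t" for t
  proof (rule borel_measurable_LIMSEQ_metric)
    show "(\<lambda>\<omega>. if \<omega> \<in> N then 0 else approx_int (r n) b t \<omega>) \<in> borel_measurable (F t)" for n
      by (rule complete_measurable[OF t N approx_int_measurable[OF pm t]])
    fix \<omega> assume "\<omega> \<in> space (F t)"
    then show "(\<lambda>n. if \<omega> \<in> N then 0 else approx_int (r n) b t \<omega>) \<longlonglongrightarrow> X t \<omega>"
      using lim[of \<omega> t] t space_F[OF t] by (cases "\<omega> \<in> N") (auto simp: X_def)
  qed
  have L2: "(\<lambda>k. \<integral>\<^sup>+\<omega>. nsq (approx_int k b t \<omega> - X t \<omega>) \<partial>M) \<longlonglongrightarrow> 0" if t: "0 \<le> t" for t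
  proof (rule ennreal_tendsto_0_mono)
    show "(\<lambda>k. 2 * e k t) \<longlonglongrightarrow> 0" using ennreal_tendsto_cmult[OF _ e0[of t], of 2] by simp
    fix k
    have m: "approx_int k b t \<in> borel_measurable M" for k
      by (rule measurable_F_M[OF t approx_int_measurable[OF pm t]])
    have "(\<integral>\<^sup>+\<omega>. nsq (approx_int k b t \<omega> - X t \<omega>) \<partial>M)
       = (\<integral>\<^sup>+\<omega>. liminf (\<lambda>n. nsq (approx_int k b t \<omega> - approx_int (r n) b t \<omega>)) \<partial>M)"
    proof (rule nn_integral_cong_AE)
      show "AE \<omega> in M. nsq (approx_int k b t \<omega> - X t \<omega>) = liminf (\<lambda>n. nsq (approx_int k b t \<omega> - approx_int (r n) b t \<omega>))"
        using AE_not_in[OF N] AE_space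
      proof eventually_elim
        case (elim \<omega>)
        have "(\<lambda>n. nsq (approx_int k b t \<omega> - approx_int (r n) b t \<omega>)) \<longlonglongrightarrow> nsq (approx_int k b t \<omega> - X t \<omega>)"
          using elim t by (intro tendsto_intros tendsto_ennrealI lim) auto
        then show ?case by (intro lim_imp_Liminf[symmetric]) auto
      qed
    qed
    also have "\<dots> \<le> liminf (\<lambda>n. \<integral>\<^sup>+\<omega>. nsq (approx_int k b t \<omega> - approx_int (r n) b t \<omega>) \<partial>M)"
      using m by (intro nn_integral_liminf) measurable
    also have "\<dots> \<le> liminf (\<lambda>n. 2 * e k t + 2 * e (r n) t)"
      unfolding e_def by (intro Liminf_mono always_eventually allI approx_int_cauchy b t)
    also have "\<dots> = 2 * e k t"
    proof (rule lim_imp_Liminf)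
      have "filterlim r at_top sequentially"
        by (rule filterlim_at_top_mono[OF filterlim_ident]) (use rn in auto)
      then have "(\<lambda>n. e (r n) t) \<longlonglongrightarrow> 0" by (rule filterlim_compose[OF e0])
      then have "(\<lambda>n. 2 * e k t + 2 * e (r n) t) \<longlonglongrightarrow> 2 * e k t + 2 * 0"
        by (intro tendsto_add tendsto_const ennreal_tendsto_cmult) auto
      then show "(\<lambda>n. 2 * e k t + 2 * e (r n) t) \<longlonglongrightarrow> 2 * e k t" by simp
    qed simp
    finally show "(\<integral>\<^sup>+\<omega>. nsq (approx_int k b t \<omega> - X t \<omega>) \<partial>M) \<le> 2 * e k t" .
  qed
  show ?thesis unfolding ito_process_def using XF L2 contX by blast
qed

lemma ito_process_measurable: "ito_process b X \<Longrightarrow> 0 \<le> t \<Longrightarrow> X t \<in> borel_measurable M"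
  unfolding ito_process_def using measurable_F_M by blast

text \<open>The integrals are approached by approximations at the same level, for which the isometry
  is exact. The 16 arises from four nested uses of the doubled triangle inequality: two to pass to
  the approximations, two to return to the integrands.\<close>

lemma ito_process_stable:
  fixes b b' :: "nat \<Rightarrow> real \<Rightarrow> 'a \<Rightarrow> 'h::{real_inner, banach, second_countable_topology}"
  assumes b: "ito_integrand b" "ito_process b X" and b': "ito_integrand b'" "ito_process b' X'" and t: "0 \<le> t"
  shows "(\<integral>\<^sup>+\<omega>. nsq (X t \<omega> - X' t \<omega>) \<partial>M) \<le> 16 * energy (\<lambda>i s \<omega>. b i s \<omega> - b' i s \<omega>) t"
proof -
  have pm: "progressively_measurable F borel (b i)" "progressively_measurable F borel (b' i)" for i
    using b b' by (simp_all add: ito_integrand_def)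
  let ?D = "\<lambda>f g. \<integral>\<^sup>+\<omega>. nsq (f \<omega> - g \<omega> :: 'h) \<partial>M"
  let ?En = "\<lambda>f g. energy (\<lambda>i s \<omega>. f i s \<omega> - g i s \<omega> :: 'h) t"
  have sym: "?D f g = ?D g f" for f g by (simp add: norm_minus_commute)
  have symE: "?En f g = ?En g f" for f g unfolding energy_def by (simp add: norm_minus_commute)
  let ?U = "\<lambda>k. approx_int k b t" and ?V = "\<lambda>k. approx_int k b' t"
  have [measurable]: "X t \<in> borel_measurable M" "X' t \<in> borel_measurable M"
    using ito_process_measurable b(2) b'(2) t by blast+
  have [measurable]: "?U k \<in> borel_measurable M" "?V k \<in> borel_measurable M" for k
    by (rule measurable_F_M[OF t approx_int_measurable[OF _ t]], rule pm)+
  have em: "energy_measurable t b" "energy_measurable t b'" "energy_measurable t (approx_val k b)" "energy_measurable t (approx_val k b')" for k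
    by (intro energy_measurable_progressive energy_measurable_approx pm t)+
  have le: "?D (X t) (X' t) \<le> 2 * ?D (?U k) (X t) + (4 * ?D (?V k) (X' t) +
     (8 * ?En (approx_val k b) b + (16 * ?En (approx_val k b') b' + 16 * ?En b b')))" for k
  proof -
    have "?D (X t) (X' t) \<le> 2 * ?D (X t) (?U k) + 2 * ?D (X' t) (?U k)"
      by (rule nn_integral_norm_diff_sq_le) measurable
    also have "?D (X' t) (?U k) \<le> 2 * ?D (X' t) (?V k) + 2 * ?D (?U k) (?V k)"
      by (rule nn_integral_norm_diff_sq_le) measurable
    also have "?D (?U k) (?V k) = ?En (approx_val k b) (approx_val k b')"
      by (rule approx_int_isometry[OF pm(1) pm(2) t])
    also have "?En (approx_val k b) (approx_val k b') \<le> 2 * ?En (approx_val k b) b + 2 * ?En (approx_val k b') b"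
      by (rule energy_triangle[OF em(3,4,1)])
    also have "?En (approx_val k b') b \<le> 2 * ?En (approx_val k b') b' + 2 * ?En b b'"
      by (rule energy_triangle[OF em(4,1,2)])
    finally have "?D (X t) (X' t) \<le> 2 * ?D (X t) (?U k) + 2 * (2 * ?D (X' t) (?V k) + 2 * (2 * ?En (approx_val k b) b + 2 * (2 * ?En (approx_val k b') b' + 2 * ?En b b')))"
      by (simp add: add_mono mult_left_mono)
    also have "\<dots> = 2 * ?D (?U k) (X t) + (4 * ?D (?V k) (X' t) +
     (8 * ?En (approx_val k b) b + (16 * ?En (approx_val k b') b' + 16 * ?En b b')))"
      unfolding sym[of "X t"] sym[of "X' t"] by (simp add: distrib_left mult.assoc[symmetric])
    finally show ?thesis .
  qed
  have "(\<lambda>k. 2 * ?D (?U k) (X t) + (4 * ?D (?V k) (X' t) +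
     (8 * ?En (approx_val k b) b + (16 * ?En (approx_val k b') b' + 16 * ?En b b'))))
     \<longlonglongrightarrow> 2 * 0 + (4 * 0 + (8 * 0 + (16 * 0 + 16 * ?En b b')))"
    using b(2) b'(2) t unfolding ito_process_def
    by (intro tendsto_add tendsto_const ennreal_tendsto_cmult approx_val_tendsto b(1) b'(1)) auto
  then show ?thesis
    by (intro LIMSEQ_le_const[where a = "?D (X t) (X' t)"]) (use le in auto)
qed

section \<open>Agreement with the prescribed cylindrical integral\<close>

definition single :: "(nat \<Rightarrow> real \<Rightarrow> 'a \<Rightarrow> 'h::zero) \<Rightarrow> nat \<Rightarrow> nat \<Rightarrow> real \<Rightarrow> 'a \<Rightarrow> 'h" where
  "single b i j = (if j = i then b j else (\<lambda>s \<omega>. 0))"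

text \<open>Like \<open>single\<close>, a way to treat some of the components as an integrand of the
  same cylindrical kind, so that existence and stability need no separate version for a real
  Brownian motion.\<close>

definition initial :: "(nat \<Rightarrow> real \<Rightarrow> 'a \<Rightarrow> 'h::zero) \<Rightarrow> nat \<Rightarrow> nat \<Rightarrow> real \<Rightarrow> 'a \<Rightarrow> 'h" where
  "initial b m j = (if j < m then b j else (\<lambda>s \<omega>. 0))"

lemma ito_integrand_restrict:
  fixes b :: "nat \<Rightarrow> real \<Rightarrow> 'a \<Rightarrow> 'h::{banach, second_countable_topology}"
  assumes b: "ito_integrand b"
  shows "ito_integrand (\<lambda>j. if P j then b j else (\<lambda>s \<omega>. 0))"
proof -
  have "progressively_measurable F borel (if P j then b j else (\<lambda>s \<omega>. 0))" for j
    using b by (cases "P j") (auto simp: ito_integrand_def progressively_measurable_def)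
  moreover have "energy (\<lambda>j. if P j then b j else (\<lambda>s \<omega>. 0)) t < \<infinity>" for t
  proof (rule order.strict_trans1)
    show "energy (\<lambda>j. if P j then b j else (\<lambda>s \<omega>. 0)) t \<le> energy b t"
      unfolding energy_def by (intro suminf_le) auto
    show "energy b t < \<infinity>" using b by (simp add: ito_integrand_def)
  qed
  ultimately show ?thesis unfolding ito_integrand_def by blast
qed

lemma cell_mean_zero: "cell_mean k (cutoff k (\<lambda>r. 0)) j = 0"
  by (simp add: cell_mean_def cutoff_def)

lemma approx_int_restrict:
  fixes b :: "nat \<Rightarrow> real \<Rightarrow> 'a \<Rightarrow> 'h::{banach, second_countable_topology}"
  shows "approx_int k (\<lambda>j. if P j then b j else (\<lambda>s \<omega>. 0)) t \<omega>
    = (\<Sum>j<k. if P j then elementary_integral (W j) (nat \<lceil>t\<rceil> * 2 ^ k) (dyadic k) (approx_coef k b j) t \<omega> else 0)"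
  unfolding approx_int_def family_integral_def
  by (intro sum.cong refl) (auto simp: elementary_integral_def approx_coef_def cell_mean_zero)

lemma approx_int_initial:
  fixes b :: "nat \<Rightarrow> real \<Rightarrow> 'a \<Rightarrow> 'h::{banach, second_countable_topology}"
  shows "approx_int k (initial b m) t \<omega> = (\<Sum>i<m. approx_int k (single b i) t \<omega>)"
proof -
  let ?h = "\<lambda>j. elementary_integral (W j) (nat \<lceil>t\<rceil> * 2 ^ k) (dyadic k) (approx_coef k b j) t \<omega>"
  have "(\<Sum>i<m. approx_int k (single b i) t \<omega>) = (\<Sum>i<m. \<Sum>j<k. if j = i then ?h j else 0)"
    unfolding single_def[abs_def] by (simp only: approx_int_restrict)
  also have "\<dots> = (\<Sum>j<k. \<Sum>i<m. if j = i then ?h j else 0)" by (rule sum.swap)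
  also have "\<dots> = (\<Sum>j<k. if j < m then ?h j else 0)" by (intro sum.cong refl) (simp add: sum.delta)
  also have "\<dots> = approx_int k (initial b m) t \<omega>"
    unfolding initial_def[abs_def] by (simp only: approx_int_restrict)
  finally show ?thesis by simp
qed

text \<open>Linearity holds exactly for the approximations and survives the limit in mean square. It
  identifies the partial sums in the definition of the cylindrical integral.\<close>

lemma ito_process_initial:
  fixes b :: "nat \<Rightarrow> real \<Rightarrow> 'a \<Rightarrow> 'h::{real_inner, banach, second_countable_topology}"
  assumes b: "ito_integrand b" and J: "\<And>i. ito_process (single b i) (J i)"
  shows "ito_process (initial b m) (\<lambda>t \<omega>. \<Sum>i<m. J i t \<omega>)"
  unfolding ito_process_def
proof (intro conjI allI impI)
  fix t :: real assume t: "0 \<le> t"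
  show "(\<lambda>\<omega>. \<Sum>i<m. J i t \<omega>) \<in> borel_measurable (F t)"
    using J t unfolding ito_process_def by (intro borel_measurable_sum) auto
  let ?d = "\<lambda>i k \<omega>. approx_int k (single b i) t \<omega> - J i t \<omega>"
  have pm: "progressively_measurable F borel (single b i j)" for i j
    using ito_integrand_restrict[OF b, of "\<lambda>j. j = i"] unfolding ito_integrand_def single_def by auto
  have [measurable]: "(?d i k) \<in> borel_measurable M" for i k
    by (intro borel_measurable_diff ito_process_measurable[OF J t] measurable_F_M[OF t approx_int_measurable[OF pm t]])
  show "(\<lambda>k. \<integral>\<^sup>+\<omega>. nsq (approx_int k (initial b m) t \<omega> - (\<Sum>i<m. J i t \<omega>)) \<partial>M) \<longlonglongrightarrow> 0"
  proof (rule ennreal_tendsto_0_mono)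
    have "(\<lambda>k. 2 ^ m * (\<Sum>i<m. \<integral>\<^sup>+\<omega>. nsq (?d i k \<omega>) \<partial>M)) \<longlonglongrightarrow> 2 ^ m * (\<Sum>i<m. 0)"
      using J t unfolding ito_process_def by (intro ennreal_tendsto_cmult tendsto_sum) (auto simp: power_less_top_ennreal)
    then show "(\<lambda>k. 2 ^ m * (\<Sum>i<m. \<integral>\<^sup>+\<omega>. nsq (?d i k \<omega>) \<partial>M)) \<longlonglongrightarrow> 0" by simp
    fix k
    have "(\<integral>\<^sup>+\<omega>. nsq (approx_int k (initial b m) t \<omega> - (\<Sum>i<m. J i t \<omega>)) \<partial>M)
      \<le> (\<integral>\<^sup>+\<omega>. 2 ^ m * (\<Sum>i<m. nsq (?d i k \<omega>)) \<partial>M)"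
      unfolding approx_int_initial sum_subtractf[symmetric] by (intro nn_integral_mono norm_sum_sq_le)
    also have "\<dots> = 2 ^ m * (\<integral>\<^sup>+\<omega>. (\<Sum>i<m. nsq (?d i k \<omega>)) \<partial>M)"
      by (rule nn_integral_cmult) measurable
    also have "(\<integral>\<^sup>+\<omega>. (\<Sum>i<m. nsq (?d i k \<omega>)) \<partial>M) = (\<Sum>i<m. \<integral>\<^sup>+\<omega>. nsq (?d i k \<omega>) \<partial>M)"
      by (rule nn_integral_sum) measurable
    finally show "(\<integral>\<^sup>+\<omega>. nsq (approx_int k (initial b m) t \<omega> - (\<Sum>i<m. J i t \<omega>)) \<partial>M)
      \<le> 2 ^ m * (\<Sum>i<m. \<integral>\<^sup>+\<omega>. nsq (?d i k \<omega>) \<partial>M)" .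
  qed
qed

lemma energy_initial_tendsto:
  fixes b :: "nat \<Rightarrow> real \<Rightarrow> 'a \<Rightarrow> 'h::{banach, second_countable_topology}"
  assumes b: "ito_integrand b"
  shows "(\<lambda>m. energy (\<lambda>i s \<omega>. initial b m i s \<omega> - b i s \<omega>) t) \<longlonglongrightarrow> 0"
proof -
  define e where "e i = (\<integral>\<^sup>+\<omega>. (sq_integral t (\<lambda>s. b i s \<omega>)) \<partial>M)" for i
  have sume: "(\<Sum>i. e i) < \<infinity>" using b unfolding ito_integrand_def energy_def e_def by blast
  have eq: "energy (\<lambda>i s \<omega>. initial b m i s \<omega> - b i s \<omega>) t = (\<integral>\<^sup>+i. (if i < m then 0 else e i) \<partial>count_space UNIV)" for m
    unfolding energy_def nn_integral_count_space_nat
    by (intro suminf_cong) (simp add: initial_def e_def)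
  have "(\<lambda>m. \<integral>\<^sup>+i. (if i < m then 0 else e i) \<partial>count_space UNIV) \<longlonglongrightarrow> (\<integral>\<^sup>+i. 0 \<partial>count_space (UNIV :: nat set))"
  proof (rule nn_integral_dominated_convergence[where w = e])
    show "(\<integral>\<^sup>+i. e i \<partial>count_space UNIV) < \<infinity>" using sume by (simp add: nn_integral_count_space_nat)
    show "AE i in count_space UNIV. (\<lambda>m. if i < m then 0 else e i) \<longlonglongrightarrow> 0"
    proof (rule AE_I2)
      fix i
      have "\<forall>\<^sub>F m in sequentially. (if i < m then 0 else e i) = 0"
        using eventually_gt_at_top[of i] by eventually_elim simp
      then show "(\<lambda>m. if i < m then 0 else e i) \<longlonglongrightarrow> 0" by (rule tendsto_eventually)
    qed
  qed auto
  then show ?thesis unfolding eq by simp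
qed

lemma has_ito_integral_single:
  fixes b :: "nat \<Rightarrow> real \<Rightarrow> 'a \<Rightarrow> 'h::{real_inner, banach, second_countable_topology}"
  assumes b: "ito_integrand b" and J: "ito_process (single b i) J" and t: "0 \<le> t"
  shows "has_ito_integral M F (W i) (b i) t (J t)"
  unfolding has_ito_integral_def
proof (intro conjI allI impI exI)
  show pm: "progressively_measurable F borel (b i)" using b by (simp add: ito_integrand_def)
  have pmb: "progressively_measurable F borel (b j)" for j using b by (simp add: ito_integrand_def)
  show "(\<integral>\<^sup>+\<omega>. (sq_integral T (\<lambda>s. b i s \<omega>)) \<partial>M) < \<infinity>" for T
    using b ennreal_suminf_lessD[of _ \<infinity> i] unfolding ito_integrand_def energy_def by blast
  show "J t \<in> borel_measurable M" by (rule ito_process_measurable[OF J t])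
  \<comment> \<open>The shift by \<open>Suc i\<close> ensures that component \<open>i\<close> is
    present at every level used.\<close>
  let ?K = "\<lambda>k. k + Suc i"
  let ?n = "\<lambda>k. nat \<lceil>t\<rceil> * 2 ^ ?K k"
  show "elementary_process M F (?n k) (dyadic (?K k)) (approx_coef (?K k) b i)" for k
    by (rule approx_coef_elementary[OF pmb])
  show "(\<lambda>k. \<integral>\<^sup>+\<omega>. (sq_integral t (\<lambda>s. elementary_value (?n k) (dyadic (?K k)) (approx_coef (?K k) b i) s \<omega> - b i s \<omega>)) \<partial>M) \<longlonglongrightarrow> 0"
  proof (rule ennreal_tendsto_0_mono)
    show "(\<lambda>k. energy (\<lambda>i s \<omega>. approx_val (?K k) b i s \<omega> - b i s \<omega>) t) \<longlonglongrightarrow> 0"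
      using LIMSEQ_ignore_initial_segment[OF approx_val_tendsto[OF b]] by blast
    fix k
    have tn: "t \<le> dyadic (?K k) (?n k)" using t by (simp add: of_nat_nat le_of_int_ceiling)
    have "(\<integral>\<^sup>+\<omega>. (sq_integral t (\<lambda>s. elementary_value (?n k) (dyadic (?K k)) (approx_coef (?K k) b i) s \<omega> - b i s \<omega>)) \<partial>M)
      = (\<integral>\<^sup>+\<omega>. (sq_integral t (\<lambda>s. approx_val (?K k) b i s \<omega> - b i s \<omega>)) \<partial>M)"
    proof (intro nn_integral_cong)
      fix \<omega> s
      show "nsq (elementary_value (?n k) (dyadic (?K k)) (approx_coef (?K k) b i) s \<omega> - b i s \<omega>) * indicator {0..t} s
        = nsq (approx_val (?K k) b i s \<omega> - b i s \<omega>) * indicator {0..t} s"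
      proof (cases "s \<in> {0..t}")
        case True
        then have "0 \<le> s" "s \<le> dyadic (?K k) (?n k)" using order_trans[OF _ tn] by (simp_all only: atLeastAtMost_iff)
        then show ?thesis by (simp only: elementary_value_approx)
      qed simp
    qed
    also have "\<dots> \<le> energy (\<lambda>i s \<omega>. approx_val (?K k) b i s \<omega> - b i s \<omega>) t"
      unfolding energy_def
      using sum_le_suminf[of "\<lambda>i. \<integral>\<^sup>+\<omega>. (sq_integral t (\<lambda>s. approx_val (?K k) b i s \<omega> - b i s \<omega>)) \<partial>M" "{i}"] by simp
    finally show "(\<integral>\<^sup>+\<omega>. (sq_integral t (\<lambda>s. elementary_value (?n k) (dyadic (?K k)) (approx_coef (?K k) b i) s \<omega> - b i s \<omega>)) \<partial>M)
      \<le> energy (\<lambda>i s \<omega>. approx_val (?K k) b i s \<omega> - b i s \<omega>) t" .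
  qed
  have eq: "approx_int (?K k) (single b i) t \<omega> = elementary_integral (W i) (?n k) (dyadic (?K k)) (approx_coef (?K k) b i) t \<omega>" for k \<omega>
    unfolding single_def[abs_def] approx_int_restrict by (simp add: sum.delta)
  have "(\<lambda>k. \<integral>\<^sup>+\<omega>. nsq (approx_int (?K k) (single b i) t \<omega> - J t \<omega>) \<partial>M) \<longlonglongrightarrow> 0"
    using J t unfolding ito_process_def
    by (intro LIMSEQ_ignore_initial_segment[where f = "\<lambda>k. \<integral>\<^sup>+\<omega>. nsq (approx_int k (single b i) t \<omega> - J t \<omega>) \<partial>M"]) auto
  then show "(\<lambda>k. \<integral>\<^sup>+\<omega>. nsq (elementary_integral (W i) (?n k) (dyadic (?K k)) (approx_coef (?K k) b i) t \<omega> - J t \<omega>) \<partial>M) \<longlonglongrightarrow> 0"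
    unfolding eq .
qed

text \<open>By \<open>ito_process_stable\<close> the distance between the partial sums and
  \<open>X t\<close> is bounded by the energy of the omitted components, the tail of a convergent
  series. Square integrability selects the branch of the definition without localisation.\<close>

lemma has_cylindrical_integral_ito_process:
  fixes B :: "real \<Rightarrow> 'a \<Rightarrow> 'u::real_normed_vector \<Rightarrow>\<^sub>L 'h::{real_inner, banach, second_countable_topology}"
  assumes B: "square_integrable_process M F e B"
    and b: "ito_integrand (\<lambda>i s \<omega>. blinfun_apply (B s \<omega>) (e i))"
    and X: "ito_process (\<lambda>i s \<omega>. blinfun_apply (B s \<omega>) (e i)) X" and t: "0 \<le> t"
  shows "has_cylindrical_integral M F e W B t (X t)"
proof -
  define b where "b i s \<omega> = blinfun_apply (B s \<omega>) (e i)" for i s \<omega>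
  have bb: "(\<lambda>i s \<omega>. blinfun_apply (B s \<omega>) (e i)) = b" by (simp add: b_def fun_eq_iff)
  have b: "ito_integrand b" and X: "ito_process b X" using b X unfolding bb by auto
  have "\<exists>J. ito_process (single b i) J" for i
    using ito_process_exists[of "single b i"] ito_integrand_restrict[OF b, of "\<lambda>j. j = i"]
    unfolding single_def[abs_def] by blast
  then obtain J where J: "\<And>i. ito_process (single b i) (J i)" by metis
  have "has_ito_integral M F (W i) (b i) t (J i t)" for i by (rule has_ito_integral_single[OF b J t])
  moreover have "(\<lambda>m. \<integral>\<^sup>+\<omega>. nsq ((\<Sum>i<m. J i t \<omega>) - X t \<omega>) \<partial>M) \<longlonglongrightarrow> 0"
  proof (rule ennreal_tendsto_0_mono)
    show "(\<lambda>m. 16 * energy (\<lambda>i s \<omega>. initial b m i s \<omega> - b i s \<omega>) t) \<longlonglongrightarrow> 0"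
      using ennreal_tendsto_cmult[OF _ energy_initial_tendsto[OF b, of t], of 16] by simp
    fix m
    have "ito_integrand (initial b m)" unfolding initial_def[abs_def] by (rule ito_integrand_restrict[OF b])
    from ito_process_stable[OF this ito_process_initial[OF b J] b X t]
    show "(\<integral>\<^sup>+\<omega>. nsq ((\<Sum>i<m. J i t \<omega>) - X t \<omega>) \<partial>M) \<le> 16 * energy (\<lambda>i s \<omega>. initial b m i s \<omega> - b i s \<omega>) t" .
  qed
  ultimately have "has_cylindrical_integral_L2 M F e W B t (X t)"
    unfolding has_cylindrical_integral_L2_def using B ito_process_measurable[OF X t]
    by (auto simp: b_def[abs_def] intro!: exI[of _ "\<lambda>i. J i t"])
  then show ?thesis unfolding has_cylindrical_integral_def using B by simp
qed

end

section \<open>Preparations for the stochastic differential equation\<close>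

text \<open>Each splitting off of one increment doubles the remainder, whence the weights
  \<open>2 ^ Suc l\<close>; they are harmless against squares of order
  \<open>(1/8) ^ l\<close>.\<close>

lemma norm_telescope_sq_le:
  fixes f :: "nat \<Rightarrow> 'h::real_normed_vector"
  shows "(norm (f (n + m) - f n))\<^sup>2 \<le> (\<Sum>l<m. 2 ^ Suc l * (norm (f (Suc (n + l)) - f (n + l)))\<^sup>2)"
proof (induction m arbitrary: n)
  case (Suc m)
  have "(norm (f (n + Suc m) - f n))\<^sup>2 = (norm ((f (Suc n) - f n) + (f (Suc n + m) - f (Suc n))))\<^sup>2" by simp
  also have "\<dots> \<le> 2 * (norm (f (Suc n) - f n))\<^sup>2 + 2 * (norm (f (Suc n + m) - f (Suc n)))\<^sup>2" by (rule norm_add_sq_le)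
  also have "\<dots> \<le> 2 * (norm (f (Suc n) - f n))\<^sup>2 + 2 * (\<Sum>l<m. 2 ^ Suc l * (norm (f (Suc (Suc n + l)) - f (Suc n + l)))\<^sup>2)"
    by (intro add_left_mono mult_left_mono Suc.IH) auto
  also have "\<dots> = (\<Sum>l<Suc m. 2 ^ Suc l * (norm (f (Suc (n + l)) - f (n + l)))\<^sup>2)"
    by (subst sum.lessThan_Suc_shift) (simp add: sum_distrib_left mult.assoc)
  finally show ?case .
qed simp

text \<open>The rate leaves room for the weights \<open>4 ^ l\<close> in the pointwise argument and
  \<open>2 ^ l\<close> in the mean-square one. Taking the limit as \<open>lim\<close> makes it
  independent of \<open>D\<close> and of any choice of subsequence.\<close>

lemma fast_cauchy_L2:
  fixes f :: "nat \<Rightarrow> 'a \<Rightarrow> 'h::{banach, second_countable_topology}"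
  assumes [measurable]: "\<And>n. f n \<in> borel_measurable M"
    and D: "0 \<le> D" and bd: "\<And>n. (\<integral>\<^sup>+x. nsq (f (Suc n) x - f n x) \<partial>M) \<le> ennreal (D * (1/8) ^ n)"
  shows "AE x in M. convergent (\<lambda>n. f n x)"
    and "(\<integral>\<^sup>+x. nsq (lim (\<lambda>n. f n x) - f n x) \<partial>M) \<le> ennreal (4 * D * (1/8) ^ n)"
proof -
  let ?d = "\<lambda>l x. (norm (f (Suc l) x - f l x))\<^sup>2"
  have "(\<integral>\<^sup>+x. (\<Sum>l. ennreal (4 ^ l * ?d l x)) \<partial>M) = (\<Sum>l. \<integral>\<^sup>+x. ennreal (4 ^ l * ?d l x) \<partial>M)"
    by (rule nn_integral_suminf) measurable
  also have "\<dots> \<le> (\<Sum>l. ennreal (D * (1/2) ^ l))"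
  proof (intro suminf_le)
    fix l
    have "(\<integral>\<^sup>+x. ennreal (4 ^ l * ?d l x) \<partial>M) = ennreal (4 ^ l) * (\<integral>\<^sup>+x. ennreal (?d l x) \<partial>M)"
      by (subst nn_integral_cmult[symmetric]) (auto simp: ennreal_mult)
    also have "\<dots> \<le> ennreal (4 ^ l) * ennreal (D * (1/8) ^ l)" by (intro mult_left_mono bd) auto
    also have "\<dots> = ennreal (D * (1/2) ^ l)"
    proof -
      have "(4::real) ^ l * (1/8) ^ l = (1/2) ^ l" by (simp add: power_mult_distrib[symmetric])
      then have "4 ^ l * (D * (1/8) ^ l) = D * (1/2) ^ l" by (metis mult.left_commute)
      then show ?thesis using D by (simp add: ennreal_mult[symmetric])
    qed
    finally show "(\<integral>\<^sup>+x. ennreal (4 ^ l * ?d l x) \<partial>M) \<le> ennreal (D * (1/2) ^ l)" .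
  qed auto
  also have "\<dots> = ennreal (\<Sum>l. D * (1/2) ^ l)"
    using D by (intro suminf_ennreal2 summable_mult summable_geometric) auto
  also have "\<dots> < \<infinity>" by simp
  finally have fin: "(\<integral>\<^sup>+x. (\<Sum>l. ennreal (4 ^ l * ?d l x)) \<partial>M) < \<infinity>" .
  have "AE x in M. (\<Sum>l. ennreal (4 ^ l * ?d l x)) \<noteq> \<infinity>"
    using fin by (intro nn_integral_PInf_AE) (auto simp: less_top)
  then show conv: "AE x in M. convergent (\<lambda>n. f n x)"
  proof eventually_elim
    case (elim x)
    have sm: "summable (\<lambda>l. 4 ^ l * ?d l x)"
      using elim by (intro summable_suminf_not_top) auto
    define S where "S = (\<Sum>l. 4 ^ l * ?d l x)"
    \<comment> \<open>Each term of the weighted series is at most its sum \<open>S\<close>; taking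
      roots, the weight \<open>4 ^ l\<close> becomes the geometric factor.\<close>
    have "norm (f (Suc l) x - f l x) \<le> sqrt S * (1/2) ^ l" for l
    proof -
      have "4 ^ l * ?d l x \<le> S"
        unfolding S_def using sum_le_suminf[OF sm, of "{l}"] by auto
      then have "(2 ^ l * norm (f (Suc l) x - f l x))\<^sup>2 \<le> S"
        by (simp add: power_mult_distrib power_mult[symmetric] mult.commute[of l 2] power_mult)
      then have "2 ^ l * norm (f (Suc l) x - f l x) \<le> sqrt S" by (rule real_le_rsqrt)
      then show ?thesis by (simp add: field_simps power_one_over)
    qed
    then have "summable (\<lambda>l. f (Suc l) x - f l x)"
      by (intro summable_comparison_test'[OF summable_mult[OF summable_geometric[of "1/2"]]]) auto
    then have "convergent (\<lambda>n. \<Sum>l<n. f (Suc l) x - f l x)" by (simp add: summable_iff_convergent)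
    then have "convergent (\<lambda>n. f n x - f 0 x)" by (simp only: sum_lessThan_telescope[of "\<lambda>n. f n x"])
    from convergent_add[OF this convergent_const[of "f 0 x"]] show ?case by simp
  qed
  have "(\<integral>\<^sup>+x. nsq (lim (\<lambda>n. f n x) - f n x) \<partial>M)
      \<le> (\<integral>\<^sup>+x. (\<Sum>l. ennreal (2 ^ Suc l * ?d (n + l) x)) \<partial>M)"
  proof (rule nn_integral_mono_AE)
    show "AE x in M. nsq (lim (\<lambda>n. f n x) - f n x) \<le> (\<Sum>l. ennreal (2 ^ Suc l * ?d (n + l) x))"
      using conv
    proof eventually_elim
      case (elim x)
      have "(\<lambda>m. f (m + n) x) \<longlonglongrightarrow> lim (\<lambda>n. f n x)"
        using elim by (intro LIMSEQ_ignore_initial_segment) (simp add: convergent_LIMSEQ_iff)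
      then have L: "(\<lambda>m. nsq (f (n + m) x - f n x)) \<longlonglongrightarrow> nsq (lim (\<lambda>n. f n x) - f n x)"
        by (intro tendsto_ennrealI tendsto_power tendsto_norm tendsto_diff tendsto_const) (simp add: add.commute)
      have B: "nsq (f (n + m) x - f n x) \<le> (\<Sum>l. ennreal (2 ^ Suc l * ?d (n + l) x))" for m
      proof -
        have "nsq (f (n + m) x - f n x) \<le> ennreal (\<Sum>l<m. 2 ^ Suc l * ?d (n + l) x)"
          using norm_telescope_sq_le[of "\<lambda>n. f n x" n m] by (intro ennreal_leI) simp
        also have "\<dots> = (\<Sum>l<m. ennreal (2 ^ Suc l * ?d (n + l) x))" by (rule sum_ennreal[symmetric]) simp
        also have "\<dots> \<le> (\<Sum>l. ennreal (2 ^ Suc l * ?d (n + l) x))" by (rule sum_le_suminf) auto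
        finally show ?thesis .
      qed
      show ?case by (rule LIMSEQ_le_const2[OF L]) (use B in blast)
    qed
  qed
  also have "\<dots> = (\<Sum>l. \<integral>\<^sup>+x. ennreal (2 ^ Suc l * ?d (n + l) x) \<partial>M)"
    by (rule nn_integral_suminf) measurable
  also have "\<dots> \<le> (\<Sum>l. ennreal (2 * D * (1/8) ^ n * (1/4) ^ l))"
  proof (intro suminf_le)
    fix l
    have "(\<integral>\<^sup>+x. ennreal (2 ^ Suc l * ?d (n + l) x) \<partial>M) = ennreal (2 ^ Suc l) * (\<integral>\<^sup>+x. ennreal (?d (n + l) x) \<partial>M)"
      by (subst nn_integral_cmult[symmetric]) (auto simp: ennreal_mult)
    also have "\<dots> \<le> ennreal (2 ^ Suc l) * ennreal (D * (1/8) ^ (n + l))" by (intro mult_left_mono bd) auto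
    also have "\<dots> = ennreal (2 * D * (1/8) ^ n * (1/4) ^ l)"
    proof -
      have "(2::real) ^ l * (1/8) ^ l = (1/4) ^ l" by (simp add: power_mult_distrib[symmetric])
      then have "2 ^ Suc l * (D * (1/8) ^ (n + l)) = 2 * D * (1/8) ^ n * (1/4) ^ l"
        by (simp add: power_add ac_simps)
      then show ?thesis using D by (simp add: ennreal_mult[symmetric])
    qed
    finally show "(\<integral>\<^sup>+x. ennreal (2 ^ Suc l * ?d (n + l) x) \<partial>M) \<le> ennreal (2 * D * (1/8) ^ n * (1/4) ^ l)" .
  qed auto
  also have "\<dots> = ennreal (\<Sum>l. 2 * D * (1/8) ^ n * (1/4) ^ l)"
    using D by (intro suminf_ennreal2 summable_mult summable_geometric) auto
  \<comment> \<open>The geometric series contributes 4/3, and the resulting 8/3 is rounded up to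
    4.\<close>
  also have "(\<Sum>l. 2 * D * (1/8) ^ n * (1/4) ^ l) = 2 * D * (1/8) ^ n * (4/3)"
    by (subst suminf_mult) (auto simp: summable_geometric suminf_geometric)
  also have "ennreal (2 * D * (1/8) ^ n * (4/3)) \<le> ennreal (4 * D * (1/8) ^ n)"
    using D by (intro ennreal_leI) simp
  finally show "(\<integral>\<^sup>+x. nsq (lim (\<lambda>n. f n x) - f n x) \<partial>M) \<le> ennreal (4 * D * (1/8) ^ n)" .
qed

lemma norm_set_integral_sq_le:
  fixes f :: "real \<Rightarrow> 'h::{banach, second_countable_topology}"
  assumes t: "0 \<le> t" and [measurable]: "(\<lambda>s. indicat_real {0..t} s *\<^sub>R f s) \<in> borel_measurable borel"
  shows "nsq (LINT s:{0..t}|lborel. f s) \<le> ennreal t * (sq_integral t (\<lambda>s. f s))"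
proof -
  define g where "g s = indicat_real {0..t} s *\<^sub>R f s" for s
  have [measurable]: "g \<in> borel_measurable borel" using assms(2) by (simp add: g_def[abs_def])
  have "nsq (LINT s:{0..t}|lborel. f s) = (ennreal (norm (\<integral>s. g s \<partial>lborel)))\<^sup>2"
    by (simp add: set_lebesgue_integral_def g_def ennreal_power)
  also have "\<dots> \<le> (\<integral>\<^sup>+s. ennreal (norm (g s)) \<partial>lborel)\<^sup>2"
    by (intro power_mono norm_integral_le_nn_integral) auto
  also have "(\<integral>\<^sup>+s. ennreal (norm (g s)) \<partial>lborel) = (\<integral>\<^sup>+s. indicator {0..t} s * ennreal (norm (g s)) \<partial>lborel)"
    by (intro nn_integral_cong) (auto simp: g_def indicator_def)
  also have "(\<integral>\<^sup>+s. indicator {0..t} s * ennreal (norm (g s)) \<partial>lborel)\<^sup>2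
      \<le> (\<integral>\<^sup>+s. (indicator {0..t} s)\<^sup>2 \<partial>lborel) * (\<integral>\<^sup>+s. (ennreal (norm (g s)))\<^sup>2 \<partial>lborel)"
    by (rule Cauchy_Schwarz_nn_integral) measurable
  also have "(\<integral>\<^sup>+s. (indicator {0..t} s)\<^sup>2 \<partial>lborel) = (\<integral>\<^sup>+s. indicator {0..t} s \<partial>lborel)"
    by (intro nn_integral_cong) (auto simp: indicator_def)
  also have "\<dots> = ennreal t" using t by simp
  also have "(\<integral>\<^sup>+s. (ennreal (norm (g s)))\<^sup>2 \<partial>lborel) = (sq_integral t (\<lambda>s. f s))"
    by (intro nn_integral_cong) (auto simp: g_def indicator_def ennreal_power)
  finally show ?thesis .
qed

lemma set_integrable_of_square:
  fixes f :: "real \<Rightarrow> 'h::{banach, second_countable_topology}"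
  assumes m: "(\<lambda>s. indicat_real {0..t} s *\<^sub>R f s) \<in> borel_measurable borel"
    and fin: "(sq_integral t (\<lambda>s. f s)) < \<infinity>"
  shows "set_integrable lborel {0..t} f"
  unfolding set_integrable_def
proof (rule integrableI_bounded)
  show "(\<lambda>s. indicat_real {0..t} s *\<^sub>R f s) \<in> borel_measurable lborel" using m by simp
  define g where "g s = indicat_real {0..t} s *\<^sub>R f s" for s
  have [measurable]: "g \<in> borel_measurable borel" using m by (simp add: g_def[abs_def])
  have "(\<integral>\<^sup>+s. ennreal (norm (g s)) \<partial>lborel) \<le> (\<integral>\<^sup>+s. indicator {0..t} s + nsq (g s) \<partial>lborel)"
  proof (intro nn_integral_mono)
    fix s
    have "norm (g s) \<le> indicat_real {0..t} s + (norm (g s))\<^sup>2"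
    proof (cases "s \<in> {0..t}")
      case True
      \<comment> \<open>Completing the square bounds the norm by its square plus a constant, which
        is integrable over the bounded interval.\<close>
      have "0 \<le> (norm (g s) - 1/2)\<^sup>2" by simp
      then have "norm (g s) \<le> 1/4 + (norm (g s))\<^sup>2" by (simp add: power2_diff power_divide)
      then show ?thesis using True by simp
    qed (simp add: g_def)
    then have "ennreal (norm (g s)) \<le> ennreal (indicat_real {0..t} s + (norm (g s))\<^sup>2)" by (rule ennreal_leI)
    then show "ennreal (norm (g s)) \<le> indicator {0..t} s + nsq (g s)"
      by (subst (asm) ennreal_plus) (auto simp: ennreal_indicator)
  qed
  also have "\<dots> = emeasure lborel {0..t} + (\<integral>\<^sup>+s. nsq (g s) \<partial>lborel)"
    by (subst nn_integral_add) auto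
  also have "(\<integral>\<^sup>+s. nsq (g s) \<partial>lborel) = (sq_integral t (\<lambda>s. f s))"
    by (intro nn_integral_cong) (auto simp: g_def indicator_def)
  also have "emeasure lborel {0..t} + (sq_integral t (\<lambda>s. f s)) < \<infinity>"
    using fin by (simp add: emeasure_lborel_Icc_eq)
  finally show "(\<integral>\<^sup>+s. ennreal (norm (indicat_real {0..t} s *\<^sub>R f s)) \<partial>lborel) < \<infinity>" by (simp add: g_def)
qed

text \<open>Dominated convergence along a sequence of endpoints: the indicators converge at every
  time except possibly the limit point.\<close>

lemma continuous_indefinite_set_integral:
  fixes f :: "real \<Rightarrow> 'h::{banach, second_countable_topology}"
  assumes int: "\<And>T::nat. set_integrable lborel {0..real T} f"
  shows "continuous_on {0..} (\<lambda>t. LINT s:{0..t}|lborel. f s)"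
  unfolding continuous_on_sequentially
proof (intro allI ballI impI, elim conjE)
  fix x :: "nat \<Rightarrow> real" and t assume t: "t \<in> {0..}" and x: "\<forall>n. x n \<in> {0..}" "x \<longlonglongrightarrow> t"
  obtain B where B: "\<And>n. \<bar>x n\<bar> \<le> B" using convergent_imp_bounded[OF x(2)] by (auto simp: bounded_iff)
  obtain T where T: "B \<le> real T" using real_arch_simple by blast
  have xT: "x n \<le> real T" for n using B[of n] T by linarith
  have tT: "t \<le> real T" by (rule LIMSEQ_le_const2[OF x(2)]) (use xT in auto)
  have i: "integrable lborel (\<lambda>s. indicat_real {0..real T} s *\<^sub>R f s)" using int[of T] by (simp add: set_integrable_def)
  have m: "(\<lambda>s. indicat_real {0..y} s *\<^sub>R f s) \<in> borel_measurable lborel" if "y \<le> real T" for y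
  proof -
    have "set_integrable lborel {0..y} f" by (rule set_integrable_subset[OF int[of T]]) (use that in auto)
    then show ?thesis by (auto simp: set_integrable_def)
  qed
  have "(\<lambda>n. \<integral>s. indicat_real {0..x n} s *\<^sub>R f s \<partial>lborel) \<longlonglongrightarrow> (\<integral>s. indicat_real {0..t} s *\<^sub>R f s \<partial>lborel)"
  proof (rule integral_dominated_convergence[where w = "\<lambda>s. norm (indicat_real {0..real T} s *\<^sub>R f s)"])
    show "AE s in lborel. (\<lambda>n. indicat_real {0..x n} s *\<^sub>R f s) \<longlonglongrightarrow> indicat_real {0..t} s *\<^sub>R f s"
      using AE_lborel_singleton[of t]
    proof eventually_elim
      case (elim s)
      have "\<forall>\<^sub>F n in sequentially. indicat_real {0..x n} s *\<^sub>R f s = indicat_real {0..t} s *\<^sub>R f s"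
      proof (cases "s < t")
        case True
        have "\<forall>\<^sub>F n in sequentially. s < x n" by (rule order_tendstoD(1)[OF x(2) True])
        then show ?thesis by eventually_elim (use True in \<open>auto simp: indicator_def\<close>)
      next
        case False
        then have "t < s" using elim by simp
        then have "\<forall>\<^sub>F n in sequentially. x n < s" by (rule order_tendstoD(2)[OF x(2)])
        then show ?thesis by eventually_elim (use \<open>t < s\<close> in \<open>auto simp: indicator_def\<close>)
      qed
      then show ?case by (rule tendsto_eventually)
    qed
    show "AE s in lborel. norm (indicat_real {0..x n} s *\<^sub>R f s) \<le> norm (indicat_real {0..real T} s *\<^sub>R f s)" for n
      using xT[of n] by (auto simp: indicator_def)
    show "integrable lborel (\<lambda>s. norm (indicat_real {0..real T} s *\<^sub>R f s))" by (rule integrable_norm[OF i])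
    show "(\<lambda>s. indicat_real {0..t} s *\<^sub>R f s) \<in> borel_measurable lborel" by (rule m[OF tT])
    show "(\<lambda>s. indicat_real {0..x n} s *\<^sub>R f s) \<in> borel_measurable lborel" for n by (rule m[OF xT])
  qed
  then show "((\<lambda>t. LINT s:{0..t}|lborel. f s) \<circ> x) \<longlonglongrightarrow> (LINT s:{0..t}|lborel. f s)"
    by (simp add: set_lebesgue_integral_def comp_def)
qed

context cylindrical_bm
begin

section \<open>Progressive and adapted processes\<close>

lemma progressive_compose:
  assumes f: "\<And>T. T > 0 \<Longrightarrow> (\<lambda>(t, \<phi>). f t \<phi>) \<in> restrict_space borel {0..T} \<Otimes>\<^sub>M borel \<rightarrow>\<^sub>M N"
    and X: "progressively_measurable F borel X"
  shows "progressively_measurable F N (\<lambda>s \<omega>. f s (X s \<omega>))"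
  unfolding progressively_measurable_def
proof (intro allI impI)
  fix t :: real assume t: "0 \<le> t"
  let ?P = "restrict_space borel {0..t} \<Otimes>\<^sub>M F t"
  have X': "(\<lambda>(s, \<omega>). X s \<omega>) \<in> ?P \<rightarrow>\<^sub>M borel" using X t by (simp add: progressively_measurable_def)
  \<comment> \<open>Measurability of \<open>f\<close> is given for positive horizons only, hence
    \<open>t + 1\<close>, as \<open>t\<close> may be 0.\<close>
  have id: "(\<lambda>s. s) \<in> restrict_space borel {0..t} \<rightarrow>\<^sub>M restrict_space borel {0..t + 1}"
    by (intro measurable_restrict_space2 measurable_restrict_space1) (auto simp: space_restrict_space)
  have "(\<lambda>p. (fst p, case_prod X p)) \<in> ?P \<rightarrow>\<^sub>M restrict_space borel {0..t + 1} \<Otimes>\<^sub>M borel"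
    by (intro measurable_Pair X' measurable_compose[OF measurable_fst id])
  from measurable_compose[OF this f[of "t + 1"]] t
  show "(\<lambda>(s, \<omega>). f s (X s \<omega>)) \<in> ?P \<rightarrow>\<^sub>M N" by (simp add: case_prod_unfold)
qed

lemma progressive_diff:
  fixes X Y :: "real \<Rightarrow> 'a \<Rightarrow> 'h::{banach, second_countable_topology}"
  assumes "progressively_measurable F borel X" "progressively_measurable F borel Y"
  shows "progressively_measurable F borel (\<lambda>s \<omega>. X s \<omega> - Y s \<omega>)"
  using assms unfolding progressively_measurable_def case_prod_unfold by (auto intro!: borel_measurable_diff)

lemma progressive_lim:
  fixes X :: "nat \<Rightarrow> real \<Rightarrow> 'a \<Rightarrow> 'h::{banach, second_countable_topology}"
  assumes "\<And>n. progressively_measurable F borel (X n)"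
  shows "progressively_measurable F borel (\<lambda>s \<omega>. lim (\<lambda>n. X n s \<omega>))"
  using assms unfolding progressively_measurable_def case_prod_unfold by (auto intro!: borel_measurable_lim_metric)

text \<open>Rounding times down to the dyadic grid uses only values already known and leaves
  countably many times; continuity recovers the process.\<close>

lemma progressive_continuous:
  fixes X :: "real \<Rightarrow> 'a \<Rightarrow> 'h::{banach, second_countable_topology}"
  assumes X: "\<And>t. 0 \<le> t \<Longrightarrow> X t \<in> borel_measurable (F t)"
    and cont: "\<And>\<omega>. \<omega> \<in> space M \<Longrightarrow> continuous_on {0..} (\<lambda>t. X t \<omega>)"
  shows "progressively_measurable F borel X"
  unfolding progressively_measurable_def
proof (intro allI impI)
  fix t :: real assume t: "0 \<le> t"
  let ?P = "restrict_space borel {0..t} \<Otimes>\<^sub>M F t"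
  define q where "q n s = (of_int \<lfloor>s * 2 ^ n\<rfloor> :: real) / 2 ^ n" for n :: nat and s :: real
  show "(\<lambda>(s, \<omega>). X s \<omega>) \<in> ?P \<rightarrow>\<^sub>M borel"
  proof (rule borel_measurable_LIMSEQ_metric)
    fix n
    \<comment> \<open>Clamping to \<open>{0..t}\<close> changes nothing at the times that occur, but
      it makes the section at every grid index measurable with respect to
      \<open>F t\<close>.\<close>
    show "(\<lambda>p. X (max 0 (min t (q n (fst p)))) (snd p)) \<in> borel_measurable ?P"
      unfolding q_def
    proof (rule measurable_compose_countable[where f = "\<lambda>j p. X (max 0 (min t (of_int j / 2 ^ n))) (snd p)" and g = "\<lambda>p :: real \<times> 'a. \<lfloor>fst p * 2 ^ n\<rfloor>"])
      fix j :: int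
      have "X (max 0 (min t (of_int j / 2 ^ n))) \<in> borel_measurable (F t)"
        by (rule measurable_F_mono[OF _ _ X]) (use t in auto)
      then show "(\<lambda>p. X (max 0 (min t (of_int j / 2 ^ n))) (snd p)) \<in> borel_measurable ?P"
        by (rule measurable_compose[OF measurable_snd])
    next
      have "(\<lambda>s::real. \<lfloor>s * 2 ^ n\<rfloor>) \<in> restrict_space borel {0..t} \<rightarrow>\<^sub>M count_space UNIV"
        by (rule measurable_restrict_space1) measurable
      then show "(\<lambda>p. \<lfloor>fst p * 2 ^ n\<rfloor>) \<in> ?P \<rightarrow>\<^sub>M count_space UNIV"
        by (rule measurable_compose[OF measurable_fst])
    qed
  next
    fix p assume "p \<in> space ?P"
    then obtain s \<omega> where p: "p = (s, \<omega>)" and s: "0 \<le> s" "s \<le> t" and \<omega>: "\<omega> \<in> space M"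
      using space_F[OF t] by (auto simp: space_pair_measure space_restrict_space)
    have low: "(\<lambda>n. s - (1/2) ^ n) \<longlonglongrightarrow> s"
    proof -
      have "(\<lambda>n. s - (1/2) ^ n) \<longlonglongrightarrow> s - 0" by (intro tendsto_intros LIMSEQ_power_zero) auto
      then show ?thesis by simp
    qed
    have q1: "s - (1/2) ^ n \<le> q n s" for n
    proof -
      have "(s * 2 ^ n - 1) / 2 ^ n \<le> q n s" unfolding q_def by (intro divide_right_mono) (linarith, simp)
      then show ?thesis by (simp add: diff_divide_distrib power_one_over)
    qed
    have q2: "q n s \<le> s" for n by (simp add: q_def field_simps)
    have q3: "0 \<le> q n s" for n using s by (simp add: q_def)
    have "(\<lambda>n. q n s) \<longlonglongrightarrow> s"
      by (rule tendsto_sandwich[OF always_eventually always_eventually low tendsto_const]) (use q1 q2 in auto)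
    then have "(\<lambda>n. X (q n s) \<omega>) \<longlonglongrightarrow> X s \<omega>"
      by (intro continuous_on_tendsto_compose[OF cont[OF \<omega>]]) (use s q3 in auto)
    moreover have "max 0 (min t (q n s)) = q n s" for n using q2[of n] q3[of n] s by auto
    ultimately show "(\<lambda>n. X (max 0 (min t (q n (fst p)))) (snd p)) \<longlonglongrightarrow> (case p of (s, \<omega>) \<Rightarrow> X s \<omega>)"
      by (simp add: p)
  qed
qed

text \<open>Tonelli's theorem moves the series over the components inside both integrals, where a
  growth or Lipschitz bound on the whole sequence of components can be applied.\<close>

lemma energy_le:
  fixes f :: "nat \<Rightarrow> real \<Rightarrow> 'a \<Rightarrow> 'h::{banach, second_countable_topology}"
  assumes m: "energy_measurable t f"
    and le: "\<And>s \<omega>. s \<in> {0..t} \<Longrightarrow> \<omega> \<in> space M \<Longrightarrow> (\<Sum>i. nsq (f i s \<omega>)) \<le> h s \<omega>"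
  shows "energy f t \<le> (\<integral>\<^sup>+\<omega>. (\<integral>\<^sup>+s\<in>{0..t}. h s \<omega> \<partial>lborel) \<partial>M)"
proof -
  have mi: "(\<lambda>(s, \<omega>). indicat_real {0..t} s *\<^sub>R f i s \<omega>) \<in> borel_measurable (borel \<Otimes>\<^sub>M M)" for i
    using m by (simp add: energy_measurable_def)
  have "energy f t = (\<integral>\<^sup>+\<omega>. (\<Sum>i. sq_integral t (\<lambda>s. f i s \<omega>)) \<partial>M)"
    unfolding energy_def by (rule nn_integral_suminf[symmetric]) (rule energy_pair_measurable[OF mi])
  also have "\<dots> \<le> (\<integral>\<^sup>+\<omega>. (\<integral>\<^sup>+s\<in>{0..t}. h s \<omega> \<partial>lborel) \<partial>M)"
  proof (rule nn_integral_mono)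
    fix \<omega> assume \<omega>: "\<omega> \<in> space M"
    have sec: "(\<lambda>s. indicat_real {0..t} s *\<^sub>R f i s \<omega>) \<in> borel_measurable borel" for i
    proof -
      have "(\<lambda>s. (s, \<omega>)) \<in> borel \<rightarrow>\<^sub>M borel \<Otimes>\<^sub>M M" using \<omega> by measurable
      from measurable_compose[OF this mi[of i]] show ?thesis by simp
    qed
    have eq: "nsq (f i s \<omega>) * indicator {0..t} s = nsq (indicat_real {0..t} s *\<^sub>R f i s \<omega>)" for i s
      by (auto simp: indicator_def)
    have meas: "(\<lambda>s. nsq (f i s \<omega>) * indicator {0..t} s) \<in> borel_measurable lborel" for i
      unfolding eq using sec[of i] by measurable
    have "(\<Sum>i. sq_integral t (\<lambda>s. f i s \<omega>)) = (\<integral>\<^sup>+s. (\<Sum>i. nsq (f i s \<omega>) * indicator {0..t} s) \<partial>lborel)"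
      by (rule nn_integral_suminf[symmetric]) (rule meas)
    also have "\<dots> \<le> (\<integral>\<^sup>+s\<in>{0..t}. h s \<omega> \<partial>lborel)"
    proof (rule nn_integral_mono)
      fix s
      show "(\<Sum>i. nsq (f i s \<omega>) * indicator {0..t} s) \<le> h s \<omega> * indicator {0..t} s"
      proof (cases "s \<in> {0..t}")
        case True
        then have i: "indicator {0..t} s = (1 :: ennreal)" by simp
        show ?thesis unfolding i mult_1_right by (rule le[OF True \<omega>])
      next
        case False
        then have i: "indicator {0..t} s = (0 :: ennreal)" by simp
        show ?thesis unfolding i by simp
      qed
    qed
    finally show "(\<Sum>i. sq_integral t (\<lambda>s. f i s \<omega>)) \<le> (\<integral>\<^sup>+s\<in>{0..t}. h s \<omega> \<partial>lborel)" .
  qed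
  finally show ?thesis .
qed

text \<open>Integer horizons yield one null set outside which all path integrals exist. Resetting
  the integral to 0 on it gives continuous paths everywhere and, by completeness, keeps the process
  adapted.\<close>

lemma drift_process_exists:
  fixes a :: "real \<Rightarrow> 'a \<Rightarrow> 'h::{banach, second_countable_topology}"
  assumes a: "progressively_measurable F borel a"
    and fin: "\<And>T. 0 \<le> T \<Longrightarrow> (\<integral>\<^sup>+\<omega>. (sq_integral T (\<lambda>s. a s \<omega>)) \<partial>M) < \<infinity>"
  shows "\<exists>D. (\<forall>t\<ge>0. D t \<in> borel_measurable (F t)) \<and> (\<forall>\<omega>\<in>space M. continuous_on {0..} (\<lambda>t. D t \<omega>)) \<and>
    (AE \<omega> in M. \<forall>t\<ge>0. set_integrable lborel {0..t} (\<lambda>s. a s \<omega>) \<and> D t \<omega> = (LINT s:{0..t}|lborel. a s \<omega>))"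
proof -
  have "AE \<omega> in M. (sq_integral (real T) (\<lambda>s. a s \<omega>)) < \<infinity>" for T :: nat
  proof -
    have "AE \<omega> in M. (sq_integral (real T) (\<lambda>s. a s \<omega>)) \<noteq> \<infinity>"
      by (rule nn_integral_PInf_AE) (use energy_pair_measurable[OF progressive_extend_M[OF a]] fin[of "real T"] in auto)
    then show ?thesis by eventually_elim (simp add: less_top)
  qed
  then have "AE \<omega> in M. \<forall>T::nat. (sq_integral (real T) (\<lambda>s. a s \<omega>)) < \<infinity>"
    by (simp add: AE_all_countable)
  then obtain N where N: "N \<in> null_sets M"
    and good: "\<And>\<omega>. \<omega> \<in> space M \<Longrightarrow> \<omega> \<notin> N \<Longrightarrow> \<forall>T::nat. (sq_integral (real T) (\<lambda>s. a s \<omega>)) < \<infinity>"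
    by (rule AE_null_set) (rule that; assumption)
  have int: "set_integrable lborel {0..real T} (\<lambda>s. a s \<omega>)" if "\<omega> \<in> space M" "\<omega> \<notin> N" for \<omega> and T :: nat
    using good[OF that] by (intro set_integrable_of_square progressive_section[OF a that(1)]) blast
  define D where "D t \<omega> = (if \<omega> \<in> N then 0 else (LINT s:{0..t}|lborel. a s \<omega>))" for t \<omega>
  have "D t \<in> borel_measurable (F t)" if t: "0 \<le> t" for t
    unfolding D_def
  proof (rule complete_measurable[OF t N])
    have "(\<lambda>p. (snd p, fst p)) \<in> F t \<Otimes>\<^sub>M lborel \<rightarrow>\<^sub>M borel \<Otimes>\<^sub>M F t" by measurable
    from measurable_compose[OF this progressive_extend[OF a t]]
    have "(\<lambda>(\<omega>, s). indicat_real {0..t} s *\<^sub>R a s \<omega>) \<in> borel_measurable (F t \<Otimes>\<^sub>M lborel)" by (simp add: case_prod_unfold)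
    then show "(\<lambda>\<omega>. LINT s:{0..t}|lborel. a s \<omega>) \<in> borel_measurable (F t)"
      unfolding set_lebesgue_integral_def by (rule lborel.borel_measurable_lebesgue_integral)
  qed
  moreover have "continuous_on {0..} (\<lambda>t. D t \<omega>)" if "\<omega> \<in> space M" for \<omega>
    unfolding D_def using continuous_indefinite_set_integral[OF int[OF that]] by (cases "\<omega> \<in> N") auto
  moreover have "AE \<omega> in M. \<forall>t\<ge>0. set_integrable lborel {0..t} (\<lambda>s. a s \<omega>) \<and> D t \<omega> = (LINT s:{0..t}|lborel. a s \<omega>)"
    using AE_not_in[OF N] AE_space
  proof eventually_elim
    case (elim \<omega>)
    have "set_integrable lborel {0..t} (\<lambda>s. a s \<omega>)" for t
    proof -
      obtain T where "t \<le> real T" using real_arch_simple by blast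
      then show ?thesis by (intro set_integrable_subset[OF int[OF elim(2,1), of T]]) auto
    qed
    then show ?case using elim by (simp add: D_def)
  qed
  ultimately show ?thesis by blast
qed

end

section \<open>Picard iteration\<close>

context cylindrical_bm
begin

section \<open>Mean-square norms over bounded horizons\<close>

definition msq :: "(real \<Rightarrow> 'a \<Rightarrow> 'h::{banach, second_countable_topology}) \<Rightarrow> real \<Rightarrow> ennreal" where
  "msq f t = (\<integral>\<^sup>+\<omega>. (sq_integral t (\<lambda>s. f s \<omega>)) \<partial>M)"

text \<open>The space on which the Picard map acts. Continuity is left out because the limit of the
  iterates is formed at each time separately and has no continuous paths a priori.\<close>

definition admissible :: "(real \<Rightarrow> 'a \<Rightarrow> 'h::{banach, second_countable_topology}) \<Rightarrow> bool" where
  "admissible \<Phi> \<longleftrightarrow> progressively_measurable F borel \<Phi> \<and> (\<forall>T\<ge>0. msq \<Phi> T < \<infinity>)"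

lemma msq_mono: "s \<le> t \<Longrightarrow> msq f s \<le> msq f t"
  unfolding msq_def by (intro nn_integral_mono) (auto simp: indicator_def)

text \<open>With the time integral outside, bounds at single times, such as the exponential one for
  the iterates, can be integrated.\<close>

lemma msq_swap:
  fixes f :: "real \<Rightarrow> 'a \<Rightarrow> 'h::{banach, second_countable_topology}"
  assumes f: "progressively_measurable F borel f" and t: "0 \<le> t"
  shows "msq f t = (\<integral>\<^sup>+s\<in>{0..t}. (\<integral>\<^sup>+\<omega>. nsq (f s \<omega>) \<partial>M) \<partial>lborel)"
proof -
  interpret P: pair_sigma_finite M "lborel :: real measure" ..
  have [measurable]: "(\<lambda>p. indicat_real {0..t} (snd p) *\<^sub>R f (snd p) (fst p)) \<in> borel_measurable (M \<Otimes>\<^sub>M lborel)"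
  proof -
    have "(\<lambda>p. (snd p, fst p)) \<in> M \<Otimes>\<^sub>M lborel \<rightarrow>\<^sub>M borel \<Otimes>\<^sub>M M" by measurable
    from measurable_compose[OF this progressive_extend_M[OF f t]] show ?thesis by simp
  qed
  have "(\<lambda>p. nsq (indicat_real {0..t} (snd p) *\<^sub>R f (snd p) (fst p))) \<in> borel_measurable (M \<Otimes>\<^sub>M lborel)"
    by measurable
  then have g: "case_prod (\<lambda>\<omega> s. nsq (indicat_real {0..t} s *\<^sub>R f s \<omega>)) \<in> borel_measurable (M \<Otimes>\<^sub>M lborel)"
    by (simp only: case_prod_unfold)
  have "msq f t = (\<integral>\<^sup>+\<omega>. (\<integral>\<^sup>+s. nsq (indicat_real {0..t} s *\<^sub>R f s \<omega>) \<partial>lborel) \<partial>M)"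
    unfolding msq_def by (intro nn_integral_cong) (auto simp: indicator_def)
  also have "\<dots> = (\<integral>\<^sup>+s. (\<integral>\<^sup>+\<omega>. nsq (indicat_real {0..t} s *\<^sub>R f s \<omega>) \<partial>M) \<partial>lborel)"
    by (rule P.Fubini'[OF g, symmetric])
  also have "\<dots> = (\<integral>\<^sup>+s\<in>{0..t}. (\<integral>\<^sup>+\<omega>. nsq (f s \<omega>) \<partial>M) \<partial>lborel)"
    by (intro nn_integral_cong) (auto simp: indicator_def)
  finally show ?thesis .
qed

lemma msq_le_const:
  fixes f :: "real \<Rightarrow> 'a \<Rightarrow> 'h::{banach, second_countable_topology}"
  assumes f: "progressively_measurable F borel f" and t: "0 \<le> t"
    and B: "\<And>s. 0 \<le> s \<Longrightarrow> s \<le> t \<Longrightarrow> (\<integral>\<^sup>+\<omega>. nsq (f s \<omega>) \<partial>M) \<le> B"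
  shows "msq f t \<le> B * ennreal t"
proof -
  have "msq f t \<le> (\<integral>\<^sup>+s. B * indicator {0..t} s \<partial>lborel)"
    unfolding msq_swap[OF f t]
  proof (rule nn_integral_mono)
    fix s
    show "(\<integral>\<^sup>+\<omega>. nsq (f s \<omega>) \<partial>M) * indicator {0..t} s \<le> B * indicator {0..t} s"
      using B[of s] by (cases "s \<in> {0..t}") auto
  qed
  also have "\<dots> = B * ennreal t" using t by (subst nn_integral_cmult_indicator) auto
  finally show ?thesis .
qed

lemma msq_inner_measurable:
  fixes f :: "real \<Rightarrow> 'a \<Rightarrow> 'h::{banach, second_countable_topology}"
  assumes f: "progressively_measurable F borel f" and t: "0 \<le> t"
  shows "(\<lambda>\<omega>. sq_integral t (\<lambda>s. f s \<omega>)) \<in> borel_measurable M"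
  by (rule energy_pair_measurable[OF progressive_extend_M[OF f t]])

lemma inner_affine:
  fixes f :: "real \<Rightarrow> 'a \<Rightarrow> 'h::{banach, second_countable_topology}"
  assumes f: "progressively_measurable F borel f" and t: "0 \<le> t" and \<omega>: "\<omega> \<in> space M" and k: "0 \<le> k" "0 \<le> c"
  shows "(\<integral>\<^sup>+s\<in>{0..t}. ennreal (k * (c + (norm (f s \<omega>))\<^sup>2)) \<partial>lborel)
    = ennreal k * (ennreal (c * t) + (sq_integral t (\<lambda>s. f s \<omega>)))"
proof -
  define g where "g s = indicat_real {0..t} s *\<^sub>R f s \<omega>" for s
  have [measurable]: "g \<in> borel_measurable borel" using progressive_section[OF f \<omega>, of t] by (simp add: g_def[abs_def])
  have "(\<integral>\<^sup>+s\<in>{0..t}. ennreal (k * (c + (norm (f s \<omega>))\<^sup>2)) \<partial>lborel)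
     = (\<integral>\<^sup>+s. ennreal k * (ennreal c * indicator {0..t} s + nsq (g s)) \<partial>lborel)"
  proof (rule nn_integral_cong)
    fix s
    show "ennreal (k * (c + (norm (f s \<omega>))\<^sup>2)) * indicator {0..t} s = ennreal k * (ennreal c * indicator {0..t} s + nsq (g s))"
      using k by (cases "s \<in> {0..t}") (auto simp: g_def ennreal_mult ennreal_plus)
  qed
  also have "\<dots> = ennreal k * (\<integral>\<^sup>+s. ennreal c * indicator {0..t} s + nsq (g s) \<partial>lborel)"
    by (rule nn_integral_cmult) measurable
  also have "(\<integral>\<^sup>+s. ennreal c * indicator {0..t} s + nsq (g s) \<partial>lborel)
     = (\<integral>\<^sup>+s. ennreal c * indicator {0..t} s \<partial>lborel) + (\<integral>\<^sup>+s. nsq (g s) \<partial>lborel)"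
    by (rule nn_integral_add) measurable
  also have "(\<integral>\<^sup>+s. ennreal c * indicator {0..t} s \<partial>lborel) = ennreal (c * t)"
    using t k by (subst nn_integral_cmult_indicator) (auto simp: ennreal_mult)
  also have "(\<integral>\<^sup>+s. nsq (g s) \<partial>lborel) = (sq_integral t (\<lambda>s. f s \<omega>))"
    by (intro nn_integral_cong) (auto simp: g_def indicator_def)
  finally show ?thesis .
qed

text \<open>One computation for two purposes: \<open>c\<close> is 1 for growth bounds and 0 for
  Lipschitz bounds.\<close>

lemma outer_affine:
  fixes f :: "real \<Rightarrow> 'a \<Rightarrow> 'h::{banach, second_countable_topology}"
  assumes f: "progressively_measurable F borel f" and t: "0 \<le> t" and k: "0 \<le> k" "0 \<le> c"
  shows "(\<integral>\<^sup>+\<omega>. (\<integral>\<^sup>+s\<in>{0..t}. ennreal (k * (c + (norm (f s \<omega>))\<^sup>2)) \<partial>lborel) \<partial>M) = ennreal k * (ennreal (c * t) + msq f t)"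
proof -
  note [measurable] = msq_inner_measurable[OF f t]
  have "(\<integral>\<^sup>+\<omega>. (\<integral>\<^sup>+s\<in>{0..t}. ennreal (k * (c + (norm (f s \<omega>))\<^sup>2)) \<partial>lborel) \<partial>M)
    = (\<integral>\<^sup>+\<omega>. ennreal k * (ennreal (c * t) + (sq_integral t (\<lambda>s. f s \<omega>))) \<partial>M)"
    by (intro nn_integral_cong inner_affine[OF f t _ k])
  also have "\<dots> = ennreal k * (\<integral>\<^sup>+\<omega>. ennreal (c * t) + (sq_integral t (\<lambda>s. f s \<omega>)) \<partial>M)"
    by (rule nn_integral_cmult) measurable
  also have "(\<integral>\<^sup>+\<omega>. ennreal (c * t) + (sq_integral t (\<lambda>s. f s \<omega>)) \<partial>M)
    = (\<integral>\<^sup>+\<omega>. ennreal (c * t) \<partial>M) + msq f t"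
    unfolding msq_def by (rule nn_integral_add) measurable
  also have "(\<integral>\<^sup>+\<omega>. ennreal (c * t) \<partial>M) = ennreal (c * t)" by (simp add: emeasure_space_1)
  finally show ?thesis .
qed

text \<open>Stability applied with the zero integrand, whose approximations vanish
  identically.\<close>

lemma ito_process_bound:
  fixes b :: "nat \<Rightarrow> real \<Rightarrow> 'a \<Rightarrow> 'h::{real_inner, banach, second_countable_topology}"
  assumes b: "ito_integrand b" "ito_process b X" and t: "0 \<le> t"
  shows "(\<integral>\<^sup>+\<omega>. nsq (X t \<omega>) \<partial>M) \<le> 16 * energy b t"
proof -
  let ?z = "\<lambda>(i::nat) (s::real) (\<omega>::'a). 0 :: 'h"
  have "ito_integrand ?z" by (simp add: ito_integrand_def progressively_measurable_def energy_def)
  moreover have "approx_int k ?z t \<omega> = 0" for k t \<omega>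
    by (simp add: approx_int_def family_integral_def elementary_integral_def approx_coef_def cell_mean_zero)
  then have "ito_process ?z (\<lambda>t \<omega>. 0)" by (simp add: ito_process_def)
  ultimately show ?thesis using ito_process_stable[OF b _ _ t, of ?z "\<lambda>t \<omega>. 0"] by simp
qed

end

text \<open>The operator is replaced by its components \<open>g i\<close>, and the time-dependent
  bound by a constant \<open>K T\<close> valid on all of \<open>{0..T}\<close>. Sums of squares are
  taken in \<open>ennreal\<close>, so that a bound on the sum already contains its
  convergence.\<close>

locale sde = cylindrical_bm M F W for M :: "'a measure" and F and W +
  fixes A :: "real \<Rightarrow> 'h \<Rightarrow> 'h::{real_inner, banach, second_countable_topology}"
    and g :: "nat \<Rightarrow> real \<Rightarrow> 'h \<Rightarrow> 'h"
    and K :: "real \<Rightarrow> real"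
    and \<Phi>\<^sub>0 :: "'a \<Rightarrow> 'h"
  assumes A_measurable: "\<And>T. T > 0 \<Longrightarrow> (\<lambda>(t, \<phi>). A t \<phi>) \<in> restrict_space borel {0..T} \<Otimes>\<^sub>M borel \<rightarrow>\<^sub>M borel"
    and g_measurable: "\<And>i T. T > 0 \<Longrightarrow> (\<lambda>(t, \<phi>). g i t \<phi>) \<in> restrict_space borel {0..T} \<Otimes>\<^sub>M borel \<rightarrow>\<^sub>M borel"
    and K_nonneg: "\<And>T. 0 \<le> K T"
    and A_growth: "\<And>T t \<phi>. 0 \<le> t \<Longrightarrow> t \<le> T \<Longrightarrow> (norm (A t \<phi>))\<^sup>2 \<le> K T * (1 + (norm \<phi>)\<^sup>2)"
    and g_growth: "\<And>T t \<phi>. 0 \<le> t \<Longrightarrow> t \<le> T \<Longrightarrow> (\<Sum>i. nsq (g i t \<phi>)) \<le> ennreal (K T * (1 + (norm \<phi>)\<^sup>2))"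
    and A_lipschitz: "\<And>T t \<phi> \<psi>. 0 \<le> t \<Longrightarrow> t \<le> T \<Longrightarrow> (norm (A t \<phi> - A t \<psi>))\<^sup>2 \<le> K T * (norm (\<phi> - \<psi>))\<^sup>2"
    and g_lipschitz: "\<And>T t \<phi> \<psi>. 0 \<le> t \<Longrightarrow> t \<le> T \<Longrightarrow>
      (\<Sum>i. nsq (g i t \<phi> - g i t \<psi>)) \<le> ennreal (K T * (norm (\<phi> - \<psi>))\<^sup>2)"
    and initial_measurable: "\<Phi>\<^sub>0 \<in> borel_measurable (F 0)"
    and initial_square: "(\<integral>\<^sup>+\<omega>. nsq (\<Phi>\<^sub>0 \<omega>) \<partial>M) < \<infinity>"
begin

section \<open>The Picard map in mean square\<close>

lemma A_progressive: "progressively_measurable F borel \<Psi> \<Longrightarrow> progressively_measurable F borel (\<lambda>s \<omega>. A s (\<Psi> s \<omega>))"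
  by (rule progressive_compose[OF A_measurable])

lemma g_progressive: "progressively_measurable F borel \<Psi> \<Longrightarrow> progressively_measurable F borel (\<lambda>s \<omega>. g i s (\<Psi> s \<omega>))"
  by (rule progressive_compose[OF g_measurable])

lemma growth_finite:
  assumes "admissible \<Psi>" "0 \<le> T"
  shows "(\<integral>\<^sup>+\<omega>. (\<integral>\<^sup>+s\<in>{0..T}. ennreal (K T * (1 + (norm (\<Psi> s \<omega>))\<^sup>2)) \<partial>lborel) \<partial>M) < \<infinity>"
proof -
  have "msq \<Psi> T < \<infinity>" and p: "progressively_measurable F borel \<Psi>" using assms by (auto simp: admissible_def)
  then show ?thesis
    unfolding outer_affine[OF p assms(2) K_nonneg zero_le_one] by (simp add: ennreal_mult_less_top)
qed

lemma A_finite: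
  assumes \<Psi>: "admissible \<Psi>" and T: "0 \<le> T"
  shows "msq (\<lambda>s \<omega>. A s (\<Psi> s \<omega>)) T < \<infinity>"
proof (rule order.strict_trans1[OF _ growth_finite[OF assms]])
  show "msq (\<lambda>s \<omega>. A s (\<Psi> s \<omega>)) T \<le> (\<integral>\<^sup>+\<omega>. (\<integral>\<^sup>+s\<in>{0..T}. ennreal (K T * (1 + (norm (\<Psi> s \<omega>))\<^sup>2)) \<partial>lborel) \<partial>M)"
    unfolding msq_def
  proof (intro nn_integral_mono)
    fix \<omega> s
    show "nsq (A s (\<Psi> s \<omega>)) * indicator {0..T} s \<le> ennreal (K T * (1 + (norm (\<Psi> s \<omega>))\<^sup>2)) * indicator {0..T} s"
      by (cases "s \<in> {0..T}") (auto intro!: ennreal_leI A_growth)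
  qed
qed

lemma g_ito_integrand:
  assumes \<Psi>: "admissible \<Psi>"
  shows "ito_integrand (\<lambda>i s \<omega>. g i s (\<Psi> s \<omega>))"
  unfolding ito_integrand_def
proof (intro conjI allI)
  have p: "progressively_measurable F borel (\<lambda>s \<omega>. g i s (\<Psi> s \<omega>))" for i
    using \<Psi> by (intro g_progressive) (simp add: admissible_def)
  then show "progressively_measurable F borel (\<lambda>s \<omega>. g i s (\<Psi> s \<omega>))" for i .
  fix t
  show "energy (\<lambda>i s \<omega>. g i s (\<Psi> s \<omega>)) t < \<infinity>"
  proof (cases "0 \<le> t")
    case True
    have "energy (\<lambda>i s \<omega>. g i s (\<Psi> s \<omega>)) t \<le> (\<integral>\<^sup>+\<omega>. (\<integral>\<^sup>+s\<in>{0..t}. ennreal (K t * (1 + (norm (\<Psi> s \<omega>))\<^sup>2)) \<partial>lborel) \<partial>M)"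
      by (rule energy_le[OF energy_measurable_progressive[OF p True]]) (auto intro: g_growth)
    then show ?thesis using growth_finite[OF \<Psi> True] by (rule order.strict_trans1)
  qed (simp add: energy_def)
qed

text \<open>A relation, since the stochastic integral is determined only up to null sets; the
  exceptional set may depend on \<open>t\<close>. A fixed point \<open>step \<Phi> \<Phi>\<close> is
  a solution with continuous paths.\<close>

definition step :: "(real \<Rightarrow> 'a \<Rightarrow> 'h) \<Rightarrow> (real \<Rightarrow> 'a \<Rightarrow> 'h) \<Rightarrow> bool" where
  "step \<Psi> \<Phi> \<longleftrightarrow> (\<forall>t\<ge>0. \<Phi> t \<in> borel_measurable (F t)) \<and> (\<forall>\<omega>\<in>space M. continuous_on {0..} (\<lambda>t. \<Phi> t \<omega>)) \<and>
     (\<exists>X. ito_process (\<lambda>i s \<omega>. g i s (\<Psi> s \<omega>)) X \<and>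
       (\<forall>t\<ge>0. AE \<omega> in M. set_integrable lborel {0..t} (\<lambda>s. A s (\<Psi> s \<omega>)) \<and>
          \<Phi> t \<omega> = \<Phi>\<^sub>0 \<omega> + (LINT s:{0..t}|lborel. A s (\<Psi> s \<omega>)) + X t \<omega>))"

lemma step_progressive: "step \<Psi> \<Phi> \<Longrightarrow> progressively_measurable F borel \<Phi>"
  by (rule progressive_continuous) (auto simp: step_def)

lemma step_measurable: "step \<Psi> \<Phi> \<Longrightarrow> 0 \<le> t \<Longrightarrow> \<Phi> t \<in> borel_measurable M"
  using measurable_F_M unfolding step_def by blast

lemma step_exists:
  assumes \<Psi>: "admissible \<Psi>"
  shows "\<exists>\<Phi>. step \<Psi> \<Phi>"
proof -
  obtain X where X: "ito_process (\<lambda>i s \<omega>. g i s (\<Psi> s \<omega>)) X" "\<forall>\<omega>\<in>space M. continuous_on {0..} (\<lambda>t. X t \<omega>)"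
    using ito_process_exists[OF g_ito_integrand[OF \<Psi>]] by blast
  have "progressively_measurable F borel (\<lambda>s \<omega>. A s (\<Psi> s \<omega>))"
    using \<Psi> by (intro A_progressive) (simp add: admissible_def)
  from drift_process_exists[OF this A_finite[OF \<Psi>, unfolded msq_def]]
  obtain D where D: "\<forall>t\<ge>0. D t \<in> borel_measurable (F t)" "\<forall>\<omega>\<in>space M. continuous_on {0..} (\<lambda>t. D t \<omega>)"
    "AE \<omega> in M. \<forall>t\<ge>0. set_integrable lborel {0..t} (\<lambda>s. A s (\<Psi> s \<omega>)) \<and> D t \<omega> = (LINT s:{0..t}|lborel. A s (\<Psi> s \<omega>))"
    by blast
  have "step \<Psi> (\<lambda>t \<omega>. \<Phi>\<^sub>0 \<omega> + D t \<omega> + X t \<omega>)"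
    unfolding step_def
  proof (intro conjI allI impI ballI exI[of _ X] X(1))
    fix t :: real assume t: "0 \<le> t"
    show "(\<lambda>\<omega>. \<Phi>\<^sub>0 \<omega> + D t \<omega> + X t \<omega>) \<in> borel_measurable (F t)"
      using D(1) X(1) t measurable_F_mono[OF order_refl t initial_measurable] unfolding ito_process_def
      by (intro borel_measurable_add) auto
    show "AE \<omega> in M. set_integrable lborel {0..t} (\<lambda>s. A s (\<Psi> s \<omega>)) \<and>
        \<Phi>\<^sub>0 \<omega> + D t \<omega> + X t \<omega> = \<Phi>\<^sub>0 \<omega> + (LINT s:{0..t}|lborel. A s (\<Psi> s \<omega>)) + X t \<omega>"
      using D(3) by eventually_elim (use t in auto)
  next
    fix \<omega> assume "\<omega> \<in> space M"
    then show "continuous_on {0..} (\<lambda>t. \<Phi>\<^sub>0 \<omega> + D t \<omega> + X t \<omega>)"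
      using D(2) X(2) by (intro continuous_intros) auto
  qed
  then show ?thesis by blast
qed

text \<open>The first term combines the factor 2 of the triangle inequality with the length
  \<open>T\<close> from the Cauchy-Schwarz inequality for the drift; the second is the same 2 times
  the 16 of \<open>ito_process_stable\<close>. The 1 makes the constant positive, so that it can be
  divided by.\<close>

definition lip :: "real \<Rightarrow> real" where "lip T = 2 * T * K T + 32 * K T + 1"

text \<open>The initial values cancel. The bound involves the difference of the inputs only up to
  time \<open>t\<close>, and this Volterra form is what makes an exponential weight
  effective.\<close>

lemma step_contraction:
  assumes \<Psi>: "admissible \<Psi>" "step \<Psi> \<Phi>" and \<Psi>': "admissible \<Psi>'" "step \<Psi>' \<Phi>'" and t: "0 \<le> t" "t \<le> T"
  shows "(\<integral>\<^sup>+\<omega>. nsq (\<Phi> t \<omega> - \<Phi>' t \<omega>) \<partial>M) \<le> ennreal (lip T) * msq (\<lambda>s \<omega>. \<Psi> s \<omega> - \<Psi>' s \<omega>) t"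
proof -
  let ?a = "\<lambda>s \<omega>. A s (\<Psi> s \<omega>) - A s (\<Psi>' s \<omega>)"
  let ?\<Delta> = "\<lambda>s \<omega>. \<Psi> s \<omega> - \<Psi>' s \<omega>"
  have p: "progressively_measurable F borel \<Psi>" "progressively_measurable F borel \<Psi>'" using \<Psi> \<Psi>' by (auto simp: admissible_def)
  have pa: "progressively_measurable F borel ?a" by (intro progressive_diff A_progressive p)
  have p\<Delta>: "progressively_measurable F borel ?\<Delta>" by (intro progressive_diff p)
  obtain X where X: "ito_process (\<lambda>i s \<omega>. g i s (\<Psi> s \<omega>)) X"
      "AE \<omega> in M. set_integrable lborel {0..t} (\<lambda>s. A s (\<Psi> s \<omega>)) \<and> \<Phi> t \<omega> = \<Phi>\<^sub>0 \<omega> + (LINT s:{0..t}|lborel. A s (\<Psi> s \<omega>)) + X t \<omega>"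
    using \<Psi>(2) t unfolding step_def by blast
  obtain X' where X': "ito_process (\<lambda>i s \<omega>. g i s (\<Psi>' s \<omega>)) X'"
      "AE \<omega> in M. set_integrable lborel {0..t} (\<lambda>s. A s (\<Psi>' s \<omega>)) \<and> \<Phi>' t \<omega> = \<Phi>\<^sub>0 \<omega> + (LINT s:{0..t}|lborel. A s (\<Psi>' s \<omega>)) + X' t \<omega>"
    using \<Psi>'(2) t unfolding step_def by blast
  note [measurable] = ito_process_measurable[OF X(1) t(1)] ito_process_measurable[OF X'(1) t(1)]
    msq_inner_measurable[OF pa t(1)]
  have "(\<integral>\<^sup>+\<omega>. nsq (\<Phi> t \<omega> - \<Phi>' t \<omega>) \<partial>M)
    \<le> (\<integral>\<^sup>+\<omega>. 2 * (ennreal t * (sq_integral t (\<lambda>s. ?a s \<omega>))) + 2 * nsq (X t \<omega> - X' t \<omega>) \<partial>M)"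
  proof (rule nn_integral_mono_AE)
    show "AE \<omega> in M. nsq (\<Phi> t \<omega> - \<Phi>' t \<omega>)
      \<le> 2 * (ennreal t * (sq_integral t (\<lambda>s. ?a s \<omega>))) + 2 * nsq (X t \<omega> - X' t \<omega>)"
      using X(2) X'(2) AE_space
    proof eventually_elim
      case (elim \<omega>)
      let ?I = "LINT s:{0..t}|lborel. ?a s \<omega>"
      have "?I = (LINT s:{0..t}|lborel. A s (\<Psi> s \<omega>)) - (LINT s:{0..t}|lborel. A s (\<Psi>' s \<omega>))"
        using elim by (intro set_integral_diff) auto
      then have "\<Phi> t \<omega> - \<Phi>' t \<omega> = ?I - (X' t \<omega> - X t \<omega>)" using elim by simp
      then have "nsq (\<Phi> t \<omega> - \<Phi>' t \<omega>) \<le> 2 * ennreal ((norm ?I)\<^sup>2) + 2 * nsq (X' t \<omega> - X t \<omega>)"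
        using norm_diff_sq_le by metis
      also have "\<dots> \<le> 2 * (ennreal t * (sq_integral t (\<lambda>s. ?a s \<omega>))) + 2 * nsq (X' t \<omega> - X t \<omega>)"
        by (intro add_mono mult_left_mono order_refl norm_set_integral_sq_le t progressive_section[OF pa elim(3)]) auto
      finally show ?case by (simp add: norm_minus_commute)
    qed
  qed
  also have "\<dots> = (\<integral>\<^sup>+\<omega>. 2 * (ennreal t * (sq_integral t (\<lambda>s. ?a s \<omega>))) \<partial>M) + (\<integral>\<^sup>+\<omega>. 2 * nsq (X t \<omega> - X' t \<omega>) \<partial>M)"
    by (rule nn_integral_add) measurable
  also have "(\<integral>\<^sup>+\<omega>. 2 * (ennreal t * (sq_integral t (\<lambda>s. ?a s \<omega>))) \<partial>M) = 2 * (ennreal t * msq ?a t)"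
    unfolding msq_def by (simp add: nn_integral_cmult)
  also have "(\<integral>\<^sup>+\<omega>. 2 * nsq (X t \<omega> - X' t \<omega>) \<partial>M) = 2 * (\<integral>\<^sup>+\<omega>. nsq (X t \<omega> - X' t \<omega>) \<partial>M)"
    by (simp add: nn_integral_cmult)
  also have "2 * (ennreal t * msq ?a t) + 2 * (\<integral>\<^sup>+\<omega>. nsq (X t \<omega> - X' t \<omega>) \<partial>M)
    \<le> 2 * (ennreal T * (ennreal (K T) * msq ?\<Delta> t)) + 2 * (16 * (ennreal (K T) * msq ?\<Delta> t))"
  proof (intro add_mono mult_left_mono mult_mono)
    have E: "(\<integral>\<^sup>+\<omega>. (\<integral>\<^sup>+s\<in>{0..t}. ennreal (K T * (0 + (norm (?\<Delta> s \<omega>))\<^sup>2)) \<partial>lborel) \<partial>M) = ennreal (K T) * msq ?\<Delta> t"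
      using outer_affine[OF p\<Delta> t(1) K_nonneg[of T] order_refl] by simp
    have "msq ?a t \<le> (\<integral>\<^sup>+\<omega>. (\<integral>\<^sup>+s\<in>{0..t}. ennreal (K T * (0 + (norm (?\<Delta> s \<omega>))\<^sup>2)) \<partial>lborel) \<partial>M)"
      unfolding msq_def
    proof (intro nn_integral_mono)
      fix \<omega> s
      show "nsq (?a s \<omega>) * indicator {0..t} s \<le> ennreal (K T * (0 + (norm (?\<Delta> s \<omega>))\<^sup>2)) * indicator {0..t} s"
        using t(2) by (cases "s \<in> {0..t}") (auto intro!: ennreal_leI A_lipschitz)
    qed
    then show "msq ?a t \<le> ennreal (K T) * msq ?\<Delta> t" unfolding E .
    have "(\<integral>\<^sup>+\<omega>. nsq (X t \<omega> - X' t \<omega>) \<partial>M) \<le> 16 * energy (\<lambda>i s \<omega>. g i s (\<Psi> s \<omega>) - g i s (\<Psi>' s \<omega>)) t"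
      by (rule ito_process_stable[OF g_ito_integrand[OF \<Psi>(1)] X(1) g_ito_integrand[OF \<Psi>'(1)] X'(1) t(1)])
    also have "energy (\<lambda>i s \<omega>. g i s (\<Psi> s \<omega>) - g i s (\<Psi>' s \<omega>)) t
       \<le> (\<integral>\<^sup>+\<omega>. (\<integral>\<^sup>+s\<in>{0..t}. ennreal (K T * (0 + (norm (?\<Delta> s \<omega>))\<^sup>2)) \<partial>lborel) \<partial>M)"
    proof (rule energy_le)
      show "energy_measurable t (\<lambda>i s \<omega>. g i s (\<Psi> s \<omega>) - g i s (\<Psi>' s \<omega>))"
        by (intro energy_measurable_progressive progressive_diff g_progressive p t)
      fix s \<omega> assume "s \<in> {0..t}"
      then have s: "0 \<le> s" "s \<le> T" using t(2) by auto
      show "(\<Sum>i. nsq (g i s (\<Psi> s \<omega>) - g i s (\<Psi>' s \<omega>))) \<le> ennreal (K T * (0 + (norm (?\<Delta> s \<omega>))\<^sup>2))"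
        unfolding add_0 by (rule g_lipschitz[OF s])
    qed
    finally show "(\<integral>\<^sup>+\<omega>. nsq (X t \<omega> - X' t \<omega>) \<partial>M) \<le> 16 * (ennreal (K T) * msq ?\<Delta> t)"
      unfolding E by (simp add: mult_left_mono)
  qed (use t in \<open>auto intro: ennreal_leI\<close>)
  also have "\<dots> = ennreal (2 * T * K T + 32 * K T) * msq ?\<Delta> t"
  proof -
    have "ennreal (2 * T * K T + 32 * K T) = 2 * ennreal T * ennreal (K T) + 32 * ennreal (K T)"
      using t K_nonneg[of T] by (subst ennreal_plus) (auto simp: ennreal_mult)
    then show ?thesis by (simp add: distrib_right mult.assoc[symmetric])
  qed
  also have "\<dots> \<le> ennreal (lip T) * msq ?\<Delta> t"
    by (intro mult_right_mono ennreal_leI) (auto simp: lip_def)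
  finally show ?thesis .
qed

text \<open>Uniformity in \<open>t\<close> is the point: the bound starts the induction for the
  iterates and, integrated in time, shows that the Picard map preserves admissibility.\<close>

lemma step_bounded:
  assumes \<Psi>: "admissible \<Psi>" "step \<Psi> \<Phi>" and T: "0 \<le> T"
  shows "\<exists>B\<ge>0. \<forall>t\<in>{0..T}. (\<integral>\<^sup>+\<omega>. nsq (\<Phi> t \<omega>) \<partial>M) \<le> ennreal B"
proof -
  let ?a = "\<lambda>s \<omega>. A s (\<Psi> s \<omega>)" and ?g = "\<lambda>i s \<omega>. g i s (\<Psi> s \<omega>)"
  define B where "B = 3 * (\<integral>\<^sup>+\<omega>. nsq (\<Phi>\<^sub>0 \<omega>) \<partial>M) + 3 * (ennreal T * msq ?a T) + 3 * (16 * energy ?g T)"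
  have ig: "ito_integrand ?g" by (rule g_ito_integrand[OF \<Psi>(1)])
  have "energy ?g T < \<infinity>" using ig by (simp add: ito_integrand_def)
  then have fin: "B < \<infinity>" unfolding B_def using initial_square A_finite[OF \<Psi>(1) T] by (simp add: ennreal_mult_less_top)
  have p: "progressively_measurable F borel \<Psi>" using \<Psi> by (auto simp: admissible_def)
  have pa: "progressively_measurable F borel ?a" by (intro A_progressive p)
  have [measurable]: "\<Phi>\<^sub>0 \<in> borel_measurable M" by (rule measurable_F_M[OF order_refl initial_measurable])
  obtain X where X: "ito_process ?g X"
      "\<And>t. 0 \<le> t \<Longrightarrow> AE \<omega> in M. set_integrable lborel {0..t} (\<lambda>s. A s (\<Psi> s \<omega>)) \<and> \<Phi> t \<omega> = \<Phi>\<^sub>0 \<omega> + (LINT s:{0..t}|lborel. A s (\<Psi> s \<omega>)) + X t \<omega>"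
    using \<Psi>(2) unfolding step_def by blast
  have "(\<integral>\<^sup>+\<omega>. nsq (\<Phi> t \<omega>) \<partial>M) \<le> B" if t: "0 \<le> t" "t \<le> T" for t
  proof -
    note [measurable] = ito_process_measurable[OF X(1) t(1)] msq_inner_measurable[OF pa t(1)]
    let ?J = "\<lambda>\<omega>. sq_integral t (\<lambda>s. ?a s \<omega>)"
    have "(\<integral>\<^sup>+\<omega>. nsq (\<Phi> t \<omega>) \<partial>M)
      \<le> (\<integral>\<^sup>+\<omega>. 3 * nsq (\<Phi>\<^sub>0 \<omega>) + 3 * (ennreal t * ?J \<omega>) + 3 * nsq (X t \<omega>) \<partial>M)"
    proof (rule nn_integral_mono_AE)
      show "AE \<omega> in M. nsq (\<Phi> t \<omega>) \<le> 3 * nsq (\<Phi>\<^sub>0 \<omega>) + 3 * (ennreal t * ?J \<omega>) + 3 * nsq (X t \<omega>)"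
        using X(2)[OF t(1)] AE_space
      proof eventually_elim
        case (elim \<omega>)
        let ?I = "LINT s:{0..t}|lborel. ?a s \<omega>"
        have "nsq (\<Phi> t \<omega>) \<le> ennreal (3 * (norm (\<Phi>\<^sub>0 \<omega>))\<^sup>2 + 3 * (norm ?I)\<^sup>2 + 3 * (norm (X t \<omega>))\<^sup>2)"
          using elim norm3_square_le[of "\<Phi>\<^sub>0 \<omega>" ?I "X t \<omega>"] by (intro ennreal_leI) simp
        also have "\<dots> = 3 * nsq (\<Phi>\<^sub>0 \<omega>) + 3 * ennreal ((norm ?I)\<^sup>2) + 3 * nsq (X t \<omega>)"
          by (simp add: ennreal_mult)
        also have "\<dots> \<le> 3 * nsq (\<Phi>\<^sub>0 \<omega>) + 3 * (ennreal t * ?J \<omega>) + 3 * nsq (X t \<omega>)"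
          by (intro add_mono mult_left_mono order_refl norm_set_integral_sq_le t progressive_section[OF pa elim(2)]) auto
        finally show ?case .
      qed
    qed
    also have "\<dots> = 3 * (\<integral>\<^sup>+\<omega>. nsq (\<Phi>\<^sub>0 \<omega>) \<partial>M) + 3 * (ennreal t * msq ?a t) + 3 * (\<integral>\<^sup>+\<omega>. nsq (X t \<omega>) \<partial>M)"
      unfolding msq_def by (simp add: nn_integral_add nn_integral_cmult)
    also have "\<dots> \<le> B"
      unfolding B_def
    proof (intro add_mono mult_left_mono mult_mono order_refl msq_mono t ennreal_leI)
      have "(\<integral>\<^sup>+\<omega>. nsq (X t \<omega>) \<partial>M) \<le> 16 * energy ?g t" by (rule ito_process_bound[OF ig X(1) t(1)])
      also have "energy ?g t \<le> energy ?g T"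
        using msq_mono[OF t(2)] unfolding energy_def msq_def by (intro suminf_le) auto
      finally show "(\<integral>\<^sup>+\<omega>. nsq (X t \<omega>) \<partial>M) \<le> 16 * energy ?g T" by (simp add: mult_left_mono)
    qed auto
    finally show ?thesis .
  qed
  then show ?thesis using fin by (intro exI[of _ "enn2real B"]) auto
qed

lemma step_admissible:
  assumes \<Psi>: "admissible \<Psi>" "step \<Psi> \<Phi>"
  shows "admissible \<Phi>"
  unfolding admissible_def
proof (intro conjI allI impI)
  show p: "progressively_measurable F borel \<Phi>" by (rule step_progressive[OF \<Psi>(2)])
  fix T :: real assume T: "0 \<le> T"
  obtain B where B: "0 \<le> B" "\<forall>t\<in>{0..T}. (\<integral>\<^sup>+\<omega>. nsq (\<Phi> t \<omega>) \<partial>M) \<le> ennreal B"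
    using step_bounded[OF \<Psi> T] by blast
  have "msq \<Phi> T \<le> ennreal B * ennreal T" by (rule msq_le_const[OF p T]) (use B in auto)
  also have "\<dots> < \<infinity>" by (simp add: ennreal_mult_less_top)
  finally show "msq \<Phi> T < \<infinity>" .
qed

end

section \<open>Geometric convergence of the iterates\<close>

lemma nn_integral_exp_le:
  assumes a: "0 < a" and t: "0 \<le> t"
  shows "(\<integral>\<^sup>+s\<in>{0..t}. ennreal (exp (a * s)) \<partial>lborel) \<le> ennreal (exp (a * t) / a)"
proof -
  have "(\<integral>\<^sup>+s. ennreal (exp (a * s)) * indicator {0..t} s \<partial>lborel) = ennreal (exp (a * t) / a - exp (a * 0) / a)"
    using a t
    by (intro nn_integral_FTC_Icc[where F = "\<lambda>s. exp (a * s) / a"]) (auto intro!: derivative_eq_intros)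
  also have "\<dots> \<le> ennreal (exp (a * t) / a)" using a by (intro ennreal_leI) simp
  finally show ?thesis .
qed

context sde
begin

lemma lip_pos: "0 \<le> T \<Longrightarrow> 0 < lip T"
  using K_nonneg[of T] by (simp add: lip_def add_nonneg_pos)

text \<open>Integrating \<open>exp (8 * L * s)\<close> over \<open>{0..t}\<close> gives the weight
  at \<open>t\<close> with a factor of at most \<open>1 / (8 * L)\<close>, which against the
  constant \<open>L\<close> of the Picard map leaves 1/8. The 8 is the rate that
  \<open>fast_cauchy_L2\<close> asks for; the weight is bounded on \<open>{0..T}\<close> and
  disappears into \<open>D\<close>.\<close>

lemma picard_rate:
  fixes P :: "nat \<Rightarrow> real \<Rightarrow> 'a \<Rightarrow> 'h"
  assumes P: "\<And>n. admissible (P n)" "\<And>n. step (P n) (P (Suc n))" and P0: "P 0 = (\<lambda>t \<omega>. 0)" and T: "0 \<le> T"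
  shows "\<exists>D\<ge>0. \<forall>t\<in>{0..T}. \<forall>n. (\<integral>\<^sup>+\<omega>. nsq (P (Suc n) t \<omega> - P n t \<omega>) \<partial>M) \<le> ennreal (D * (1/8) ^ n)"
proof -
  define L where "L = lip T"
  have L: "0 < L" unfolding L_def by (rule lip_pos[OF T])
  obtain B where B: "0 \<le> B" "\<forall>t\<in>{0..T}. (\<integral>\<^sup>+\<omega>. nsq (P 1 t \<omega>) \<partial>M) \<le> ennreal B"
    using step_bounded[OF P(1,2)[of 0] T] by auto
  have rate: "(\<integral>\<^sup>+\<omega>. nsq (P (Suc n) t \<omega> - P n t \<omega>) \<partial>M) \<le> ennreal (B * (1/8) ^ n * exp (8 * L * t))"
    if "t \<in> {0..T}" for n t
    using that
  proof (induction n arbitrary: t)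
    case 0
    \<comment> \<open>The iteration starts at 0, so the first difference is \<open>P 1\<close>
      itself.\<close>
    have "ennreal B \<le> ennreal (B * exp (8 * L * t))"
      using 0 L B(1) by (intro ennreal_leI) (simp add: mult_le_cancel_left1)
    then show ?case using B(2) 0 by (auto simp: P0 intro: order_trans)
  next
    case (Suc n)
    have t: "0 \<le> t" "t \<le> T" using Suc.prems by auto
    let ?\<Delta> = "\<lambda>s \<omega>. P (Suc n) s \<omega> - P n s \<omega>"
    have p: "progressively_measurable F borel ?\<Delta>"
      using P(1) by (intro progressive_diff) (auto simp: admissible_def)
    have "msq ?\<Delta> t = (\<integral>\<^sup>+s\<in>{0..t}. (\<integral>\<^sup>+\<omega>. nsq (?\<Delta> s \<omega>) \<partial>M) \<partial>lborel)"
      by (rule msq_swap[OF p t(1)])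
    also have "\<dots> \<le> (\<integral>\<^sup>+s. ennreal (B * (1/8) ^ n) * (ennreal (exp (8 * L * s)) * indicator {0..t} s) \<partial>lborel)"
    proof (rule nn_integral_mono)
      fix s
      show "(\<integral>\<^sup>+\<omega>. nsq (?\<Delta> s \<omega>) \<partial>M) * indicator {0..t} s \<le> ennreal (B * (1/8) ^ n) * (ennreal (exp (8 * L * s)) * indicator {0..t} s)"
      proof (cases "s \<in> {0..t}")
        case True
        then have "s \<in> {0..T}" using t by auto
        from Suc.IH[OF this] show ?thesis using True B(1) by (simp add: ennreal_mult)
      qed simp
    qed
    also have "\<dots> = ennreal (B * (1/8) ^ n) * (\<integral>\<^sup>+s\<in>{0..t}. ennreal (exp (8 * L * s)) \<partial>lborel)"
      by (rule nn_integral_cmult) measurable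
    also have "\<dots> \<le> ennreal (B * (1/8) ^ n) * ennreal (exp (8 * L * t) / (8 * L))"
      using L by (intro mult_left_mono nn_integral_exp_le t) auto
    finally have m: "msq ?\<Delta> t \<le> ennreal (B * (1/8) ^ n) * ennreal (exp (8 * L * t) / (8 * L))" .
    have "(\<integral>\<^sup>+\<omega>. nsq (P (Suc (Suc n)) t \<omega> - P (Suc n) t \<omega>) \<partial>M) \<le> ennreal L * msq ?\<Delta> t"
      unfolding L_def by (rule step_contraction[OF P(1,2) P(1,2) t])
    also have "\<dots> \<le> ennreal L * (ennreal (B * (1/8) ^ n) * ennreal (exp (8 * L * t) / (8 * L)))"
      by (intro mult_left_mono m) auto
    also have "\<dots> = ennreal (L * (B * (1/8) ^ n * (exp (8 * L * t) / (8 * L))))"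
    proof -
      have a: "0 \<le> B * (1/8) ^ n" and b: "0 \<le> exp (8 * L * t) / (8 * L)" using B(1) L by simp_all
      show ?thesis
        unfolding ennreal_mult[OF less_imp_le[OF L] mult_nonneg_nonneg[OF a b]] ennreal_mult[OF a b] ..
    qed
    also have "L * (B * (1/8) ^ n * (exp (8 * L * t) / (8 * L))) = B * (1/8) ^ Suc n * exp (8 * L * t)"
      using L by (simp add: field_simps)
    finally show ?case .
  qed
  show ?thesis
  proof (intro exI[of _ "B * exp (8 * L * T)"] conjI ballI allI)
    fix t n assume t: "t \<in> {0..T}"
    have "B * (1/8) ^ n * exp (8 * L * t) \<le> B * exp (8 * L * T) * (1/8) ^ n"
    proof -
      have "exp (8 * L * t) \<le> exp (8 * L * T)" using t L by simp
      then have "B * (1/8) ^ n * exp (8 * L * t) \<le> B * (1/8) ^ n * exp (8 * L * T)"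
        using B(1) by (intro mult_left_mono) auto
      then show ?thesis by (simp add: ac_simps)
    qed
    then show "(\<integral>\<^sup>+\<omega>. nsq (P (Suc n) t \<omega> - P n t \<omega>) \<partial>M) \<le> ennreal (B * exp (8 * L * T) * (1/8) ^ n)"
      by (intro order_trans[OF rate[OF t]] ennreal_leI)
  qed (use B in auto)
qed

lemma ennreal_geometric_tendsto_0: "0 \<le> c \<Longrightarrow> (\<lambda>n. ennreal (c * (1/8) ^ n)) \<longlonglongrightarrow> 0"
proof -
  have "(\<lambda>n. c * (1/8::real) ^ n) \<longlonglongrightarrow> c * 0" by (intro tendsto_mult tendsto_const LIMSEQ_power_zero) auto
  then have "(\<lambda>n. ennreal (c * (1/8) ^ n)) \<longlonglongrightarrow> ennreal 0" by (intro tendsto_ennrealI) simp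
  then show ?thesis by simp
qed

theorem solution_exists:
  "\<exists>\<Phi>. admissible \<Phi> \<and> step \<Phi> \<Phi>"
proof -
  have "\<exists>P. \<forall>n. (admissible (P n) \<and> (n = 0 \<longrightarrow> P n = (\<lambda>t \<omega>. 0))) \<and> step (P n) (P (Suc n))"
  proof (rule dependent_nat_choice)
    show "\<exists>x. admissible x \<and> (0 = 0 \<longrightarrow> x = (\<lambda>t \<omega>. 0 :: 'h))"
      by (auto simp: admissible_def progressively_measurable_def msq_def)
  next
    fix x :: "real \<Rightarrow> 'a \<Rightarrow> 'h" and n :: nat assume x: "admissible x \<and> (n = 0 \<longrightarrow> x = (\<lambda>t \<omega>. 0))"
    then obtain y where "step x y" using step_exists by blast
    then show "\<exists>y. (admissible y \<and> (Suc n = 0 \<longrightarrow> y = (\<lambda>t \<omega>. 0))) \<and> step x y"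
      using x step_admissible by blast
  qed
  then obtain P where P: "\<And>n. admissible (P n)" "\<And>n. step (P n) (P (Suc n))" and P0: "P 0 = (\<lambda>t \<omega>. 0)" by metis
  have pP: "progressively_measurable F borel (P n)" for n using P(1)[of n] by (simp add: admissible_def)
  have PM: "P n t \<in> borel_measurable M" if "0 \<le> t" for n t
    using step_measurable[OF P(2) that] by (cases n) (simp_all add: P0)
  \<comment> \<open>One formula at all times, so the rates obtained for different horizons concern
    the same process.\<close>
  define \<Psi> where "\<Psi> t \<omega> = lim (\<lambda>n. P n t \<omega>)" for t \<omega>
  have p\<Psi>: "progressively_measurable F borel \<Psi>" unfolding \<Psi>_def[abs_def] by (rule progressive_lim[OF pP])
  have rate: "\<exists>D\<ge>0. \<forall>t\<in>{0..T}. \<forall>n. (\<integral>\<^sup>+\<omega>. nsq (\<Psi> t \<omega> - P n t \<omega>) \<partial>M) \<le> ennreal (4 * D * (1/8) ^ n)"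
    if T: "0 \<le> T" for T
  proof -
    obtain D where D: "0 \<le> D" "\<And>t n. t \<in> {0..T} \<Longrightarrow> (\<integral>\<^sup>+\<omega>. nsq (P (Suc n) t \<omega> - P n t \<omega>) \<partial>M) \<le> ennreal (D * (1/8) ^ n)"
      using picard_rate[OF P P0 T] by blast
    have "(\<integral>\<^sup>+\<omega>. nsq (\<Psi> t \<omega> - P n t \<omega>) \<partial>M) \<le> ennreal (4 * D * (1/8) ^ n)" if t: "t \<in> {0..T}" for t n
      unfolding \<Psi>_def by (rule fast_cauchy_L2(2)[OF PM D(1) D(2)[OF t]]) (use t in auto)
    then show ?thesis using D(1) by blast
  qed
  have msq\<Psi>: "\<exists>E\<ge>0. \<forall>n. msq (\<lambda>s \<omega>. \<Psi> s \<omega> - P n s \<omega>) T \<le> ennreal (E * (1/8) ^ n)" if T: "0 \<le> T" for T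
  proof -
    obtain D where D: "0 \<le> D" "\<forall>t\<in>{0..T}. \<forall>n. (\<integral>\<^sup>+\<omega>. nsq (\<Psi> t \<omega> - P n t \<omega>) \<partial>M) \<le> ennreal (4 * D * (1/8) ^ n)"
      using rate[OF T] by blast
    have "msq (\<lambda>s \<omega>. \<Psi> s \<omega> - P n s \<omega>) T \<le> ennreal (4 * D * T * (1/8) ^ n)" for n
    proof -
      have "msq (\<lambda>s \<omega>. \<Psi> s \<omega> - P n s \<omega>) T \<le> ennreal (4 * D * (1/8) ^ n) * ennreal T"
        by (rule msq_le_const[OF progressive_diff[OF p\<Psi> pP] T]) (use D in auto)
      also have "\<dots> = ennreal (4 * D * T * (1/8) ^ n)"
        using D(1) T by (simp add: ennreal_mult[symmetric] ac_simps)
      finally show ?thesis .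
    qed
    then show ?thesis using D(1) T by (intro exI[of _ "4 * D * T"]) auto
  qed
  have adm\<Psi>: "admissible \<Psi>"
    unfolding admissible_def
  proof (intro conjI allI impI p\<Psi>)
    fix T :: real assume "0 \<le> T"
    then obtain E where "msq (\<lambda>s \<omega>. \<Psi> s \<omega> - P 0 s \<omega>) T \<le> ennreal (E * (1/8) ^ 0)" using msq\<Psi> by blast
    then have "msq \<Psi> T \<le> ennreal E" by (simp add: P0)
    then show "msq \<Psi> T < \<infinity>" by (rule order.strict_trans1) simp
  qed
  obtain \<Phi> where \<Phi>: "step \<Psi> \<Phi>" using step_exists[OF adm\<Psi>] by blast
  have adm\<Phi>: "admissible \<Phi>" by (rule step_admissible[OF adm\<Psi> \<Phi>])
  have p\<Phi>: "progressively_measurable F borel \<Phi>" using adm\<Phi> by (simp add: admissible_def)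
  have \<Psi>M: "\<Psi> t \<in> borel_measurable M" if "0 \<le> t" for t
    unfolding \<Psi>_def[abs_def] by (rule borel_measurable_lim_metric[OF PM[OF that]])
  have eq: "(\<integral>\<^sup>+\<omega>. nsq (\<Phi> t \<omega> - \<Psi> t \<omega>) \<partial>M) = 0" if t: "0 \<le> t" for t
  proof -
    obtain E where E: "0 \<le> E" "\<And>n. msq (\<lambda>s \<omega>. \<Psi> s \<omega> - P n s \<omega>) t \<le> ennreal (E * (1/8) ^ n)" using msq\<Psi>[OF t] by blast
    obtain D where D: "0 \<le> D" "\<And>n. (\<integral>\<^sup>+\<omega>. nsq (\<Psi> t \<omega> - P n t \<omega>) \<partial>M) \<le> ennreal (4 * D * (1/8) ^ n)"
      using rate[OF t] t by auto
    \<comment> \<open>Both \<open>\<Phi>\<close> and \<open>P (Suc n)\<close> are images under the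
      Picard map, of \<open>\<Psi>\<close> and \<open>P n\<close>, so their distance is controlled
      by that of \<open>\<Psi>\<close> and \<open>P n\<close>.\<close>
    have bound: "(\<integral>\<^sup>+\<omega>. nsq (\<Phi> t \<omega> - \<Psi> t \<omega>) \<partial>M) \<le> 2 * (ennreal (lip t) * ennreal (E * (1/8) ^ n)) + 2 * ennreal (4 * D * (1/8) ^ Suc n)" for n
    proof -
      have "(\<integral>\<^sup>+\<omega>. nsq (\<Phi> t \<omega> - \<Psi> t \<omega>) \<partial>M)
        \<le> 2 * (\<integral>\<^sup>+\<omega>. nsq (\<Phi> t \<omega> - P (Suc n) t \<omega>) \<partial>M) + 2 * (\<integral>\<^sup>+\<omega>. nsq (\<Psi> t \<omega> - P (Suc n) t \<omega>) \<partial>M)"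
        by (intro nn_integral_norm_diff_sq_le step_measurable[OF \<Phi> t] \<Psi>M PM t)
      also have "\<dots> \<le> 2 * (ennreal (lip t) * ennreal (E * (1/8) ^ n)) + 2 * ennreal (4 * D * (1/8) ^ Suc n)"
        by (intro add_mono mult_left_mono D(2) order_trans[OF step_contraction[OF adm\<Psi> \<Phi> P(1,2) t order_refl]] E(2)) auto
      finally show ?thesis .
    qed
    have "(\<lambda>n. 2 * (ennreal (lip t) * ennreal (E * (1/8) ^ n)) + 2 * ennreal (4 * D * (1/8) ^ Suc n)) \<longlonglongrightarrow> 2 * (ennreal (lip t) * 0) + 2 * 0"
      using D(1) E(1)
      by (intro tendsto_add ennreal_tendsto_cmult ennreal_geometric_tendsto_0 LIMSEQ_Suc[OF ennreal_geometric_tendsto_0]) auto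
    then have "(\<integral>\<^sup>+\<omega>. nsq (\<Phi> t \<omega> - \<Psi> t \<omega>) \<partial>M) \<le> 2 * (ennreal (lip t) * 0) + 2 * 0"
      by (rule LIMSEQ_le_const) (use bound in blast)
    then show ?thesis by simp
  qed
  have msq0: "msq (\<lambda>s \<omega>. \<Phi> s \<omega> - \<Psi> s \<omega>) t = 0" if t: "0 \<le> t" for t
    using msq_le_const[OF progressive_diff[OF p\<Phi> p\<Psi>] t, of 0] eq by simp
  \<comment> \<open>A further image \<open>\<Phi>'\<close> carries the integrals of the coefficients
    along \<open>\<Phi>\<close> itself. It is compared with \<open>\<Phi>\<close>, the image of
    \<open>\<Psi>\<close>: the arguments agree in mean square, so the images agree almost surely at
    each time, and \<open>\<Phi>\<close> may take the place of \<open>\<Phi>'\<close>.\<close>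
  obtain \<Phi>' where \<Phi>': "step \<Phi> \<Phi>'" using step_exists[OF adm\<Phi>] by blast
  have same: "AE \<omega> in M. \<Phi>' t \<omega> = \<Phi> t \<omega>" if t: "0 \<le> t" for t
  proof -
    have "(\<integral>\<^sup>+\<omega>. nsq (\<Phi>' t \<omega> - \<Phi> t \<omega>) \<partial>M) \<le> 0"
      using step_contraction[OF adm\<Phi> \<Phi>' adm\<Psi> \<Phi> t order_refl] unfolding msq0[OF t] by simp
    then have "(\<integral>\<^sup>+\<omega>. nsq (\<Phi>' t \<omega> - \<Phi> t \<omega>) \<partial>M) = 0" by simp
    then have "AE \<omega> in M. nsq (\<Phi>' t \<omega> - \<Phi> t \<omega>) = 0"
      using step_measurable[OF \<Phi>' t] step_measurable[OF \<Phi> t] by (subst (asm) nn_integral_0_iff_AE) auto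
    then show ?thesis by eventually_elim simp
  qed
  have "step \<Phi> \<Phi>"
  proof -
    obtain X where X: "ito_process (\<lambda>i s \<omega>. g i s (\<Phi> s \<omega>)) X"
      "\<And>t. 0 \<le> t \<Longrightarrow> AE \<omega> in M. set_integrable lborel {0..t} (\<lambda>s. A s (\<Phi> s \<omega>)) \<and> \<Phi>' t \<omega> = \<Phi>\<^sub>0 \<omega> + (LINT s:{0..t}|lborel. A s (\<Phi> s \<omega>)) + X t \<omega>"
      using \<Phi>' unfolding step_def by blast
    have "AE \<omega> in M. set_integrable lborel {0..t} (\<lambda>s. A s (\<Phi> s \<omega>)) \<and> \<Phi> t \<omega> = \<Phi>\<^sub>0 \<omega> + (LINT s:{0..t}|lborel. A s (\<Phi> s \<omega>)) + X t \<omega>"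
      if "0 \<le> t" for t using X(2)[OF that] same[OF that] by eventually_elim simp
    then show ?thesis using \<Phi> X(1) unfolding step_def by blast
  qed
  then show ?thesis using adm\<Phi> by blast
qed

end

section \<open>Hilbert--Schmidt coefficients\<close>

lemma space_hs_borel: "space (hs_borel e) = hilbert_schmidt e"
  unfolding hs_borel_def by (simp add: space_measure_of_conv)

lemma hilbert_schmidt_diff:
  fixes S R :: "'u::real_normed_vector \<Rightarrow>\<^sub>L 'h::real_normed_vector"
  assumes "S \<in> hilbert_schmidt e" "R \<in> hilbert_schmidt e"
  shows "S - R \<in> hilbert_schmidt e"
  unfolding hilbert_schmidt_def mem_Collect_eq
proof (rule summable_comparison_test'[where N = 0])
  show "summable (\<lambda>i. 2 * (norm (blinfun_apply S (e i)))\<^sup>2 + 2 * (norm (blinfun_apply R (e i)))\<^sup>2)"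
    using assms unfolding hilbert_schmidt_def by (intro summable_add summable_mult) auto
  fix i
  show "norm ((norm (blinfun_apply (S - R) (e i)))\<^sup>2) \<le> 2 * (norm (blinfun_apply S (e i)))\<^sup>2 + 2 * (norm (blinfun_apply R (e i)))\<^sup>2"
    using norm_add_sq_le[of "blinfun_apply S (e i)" "- blinfun_apply R (e i)"] by (simp add: blinfun.diff_left)
qed

lemma norm_apply_le_hs_norm:
  assumes "S \<in> hilbert_schmidt e"
  shows "norm (blinfun_apply S (e i)) \<le> hs_norm e S"
proof -
  have "(norm (blinfun_apply S (e i)))\<^sup>2 \<le> (\<Sum>i. (norm (blinfun_apply S (e i)))\<^sup>2)"
    using sum_le_suminf[of "\<lambda>i. (norm (blinfun_apply S (e i)))\<^sup>2" "{i}"] assms unfolding hilbert_schmidt_def by simp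
  then show ?thesis unfolding hs_norm_def by (rule real_le_rsqrt)
qed

lemma hs_norm_sq:
  assumes "S \<in> hilbert_schmidt e"
  shows "ennreal ((hs_norm e S)\<^sup>2) = (\<Sum>i. nsq (blinfun_apply S (e i)))"
proof -
  have s: "summable (\<lambda>i. (norm (blinfun_apply S (e i)))\<^sup>2)" using assms unfolding hilbert_schmidt_def by simp
  have eq: "(hs_norm e S)\<^sup>2 = (\<Sum>i. (norm (blinfun_apply S (e i)))\<^sup>2)"
    unfolding hs_norm_def by (intro real_sqrt_pow2 suminf_nonneg s) simp
  show ?thesis unfolding eq by (rule suminf_ennreal2[OF _ s, symmetric]) simp
qed

text \<open>Evaluation at \<open>e i\<close> is bounded by the Hilbert-Schmidt norm, so preimages of
  open sets are open for that norm and belong to the generator of \<open>hs_borel\<close>.\<close>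

lemma measurable_hs_apply:
  fixes e :: "nat \<Rightarrow> 'u::real_normed_vector"
  shows "(\<lambda>S. blinfun_apply S (e i) :: 'h::real_normed_vector) \<in> hs_borel e \<rightarrow>\<^sub>M borel"
proof (rule borel_measurableI)
  fix U :: "'h set" assume U: "open U"
  let ?V = "(\<lambda>S. blinfun_apply S (e i)) -` U \<inter> space (hs_borel e)"
  have "\<exists>\<epsilon>>0. \<forall>R\<in>hilbert_schmidt e. hs_norm e (R - S) < \<epsilon> \<longrightarrow> R \<in> ?V" if "S \<in> ?V" for S
  proof -
    have S: "S \<in> hilbert_schmidt e" "blinfun_apply S (e i) \<in> U" using that by (auto simp: space_hs_borel)
    obtain \<epsilon> where \<epsilon>: "\<epsilon> > 0" "\<And>y. dist y (blinfun_apply S (e i)) < \<epsilon> \<Longrightarrow> y \<in> U"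
      using U S(2) unfolding open_dist by blast
    have "R \<in> ?V" if R: "R \<in> hilbert_schmidt e" "hs_norm e (R - S) < \<epsilon>" for R
    proof -
      have "norm (blinfun_apply (R - S) (e i)) < \<epsilon>"
        using norm_apply_le_hs_norm[OF hilbert_schmidt_diff[OF R(1) S(1)], of i] R(2) by simp
      then have "blinfun_apply R (e i) \<in> U" by (intro \<epsilon>(2)) (simp add: dist_norm blinfun.diff_left)
      then show ?thesis using R(1) by (simp add: space_hs_borel)
    qed
    then show ?thesis using \<epsilon>(1) by blast
  qed
  moreover have "?V \<subseteq> hilbert_schmidt e" by (auto simp: space_hs_borel)
  ultimately show "?V \<in> sets (hs_borel e)"
    unfolding hs_borel_def by (subst sets_measure_of) (auto intro!: sigma_sets.Basic)
qed

theorem theorem3p1p1: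
  fixes M :: "'a measure"
    and F :: "real \<Rightarrow> 'a measure"
    and e :: "nat \<Rightarrow> 'u::{real_inner, banach, second_countable_topology}"
    and W :: "nat \<Rightarrow> real \<Rightarrow> 'a \<Rightarrow> real"
    and A :: "real \<Rightarrow> 'h \<Rightarrow> 'h::{real_inner, banach, second_countable_topology}"
    and G :: "real \<Rightarrow> 'h \<Rightarrow> 'u \<Rightarrow>\<^sub>L 'h"
    and C :: "real \<Rightarrow> real"
    and c :: "nat \<Rightarrow> real"
    and \<Phi>\<^sub>0 :: "'a \<Rightarrow> 'h"
  assumes "filtered_prob_space M F"
    and "orthonormal_basis e"
    and "cylindrical_brownian_motion M F W"
    and "\<exists>S :: 'h set. finite S \<and> span S = UNIV"
    and "\<And>T. T > 0 \<Longrightarrow>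
           (\<lambda>(t, \<phi>). A t \<phi>) \<in> restrict_space borel {0..T} \<Otimes>\<^sub>M borel \<rightarrow>\<^sub>M borel"
    and "\<And>T. T > 0 \<Longrightarrow>
           (\<lambda>(t, \<phi>). G t \<phi>) \<in> restrict_space borel {0..T} \<Otimes>\<^sub>M borel \<rightarrow>\<^sub>M hs_borel e"
    and "\<And>T. T > 0 \<Longrightarrow> bounded (C ` {0..T})"
    and "\<And>t \<phi>. t \<ge> 0 \<Longrightarrow> (norm (A t \<phi>))\<^sup>2 \<le> C t * (1 + (norm \<phi>)\<^sup>2)"
    and "\<And>t \<phi> i. t \<ge> 0 \<Longrightarrow>
           (norm (blinfun_apply (G t \<phi>) (e i)))\<^sup>2 \<le> C t * c i * (1 + (norm \<phi>)\<^sup>2)"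
    and "summable c"
    and "\<And>t \<phi> \<psi>. t \<ge> 0 \<Longrightarrow>
           (norm (A t \<phi> - A t \<psi>))\<^sup>2
             + (\<Sum>i. (norm (blinfun_apply (G t \<phi>) (e i) - blinfun_apply (G t \<psi>) (e i)))\<^sup>2)
           \<le> C t * (norm (\<phi> - \<psi>))\<^sup>2"
    and "\<Phi>\<^sub>0 \<in> borel_measurable (F 0)"
    and "integrable M (\<lambda>\<omega>. (norm (\<Phi>\<^sub>0 \<omega>))\<^sup>2)"
  shows "\<exists>\<Phi> :: real \<Rightarrow> 'a \<Rightarrow> 'h.
           (AE \<omega> in M. \<forall>T>0. continuous_on {0..T} (\<lambda>t. \<Phi> t \<omega>)) \<and>
           progressively_measurable F borel \<Phi> \<and>
           (\<forall>t\<ge>0. \<exists>I. has_cylindrical_integral M F e W (\<lambda>s \<omega>. G s (\<Phi> s \<omega>)) t I \<and>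
              (AE \<omega> in M. set_integrable lborel {0..t} (\<lambda>s. A s (\<Phi> s \<omega>)) \<and>
                 \<Phi> t \<omega> = \<Phi>\<^sub>0 \<omega> + (LINT s:{0..t}|lborel. A s (\<Phi> s \<omega>)) + I \<omega>))"
proof -
  interpret cylindrical_bm M F W
    by (rule cylindrical_bm.intro[OF assms(1)]) (unfold cylindrical_bm_axioms_def, rule assms(3))
  define g where "g i t \<phi> = blinfun_apply (G t \<phi>) (e i)" for i t \<phi>
  have "\<exists>k\<ge>0. \<forall>t\<in>{0..T}. C t \<le> k" for T
  proof -
    \<comment> \<open>Boundedness is given on positive horizons, and \<open>max T 1\<close> is one
      for every \<open>T\<close>.\<close>
    have "bounded (C ` {0..max T 1})" by (rule assms(7)) simp
    then obtain k where k: "\<forall>x\<in>C ` {0..max T 1}. norm x \<le> k" by (auto simp: bounded_iff)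
    have "C t \<le> max k 0" if "t \<in> {0..T}" for t
    proof -
      have "norm (C t) \<le> k" by (rule k[rule_format]) (use that in auto)
      then show ?thesis by auto
    qed
    then show ?thesis by (intro exI[of _ "max k 0"]) auto
  qed
  then obtain k where k: "\<And>T. 0 \<le> k T" "\<And>T t. t \<in> {0..T} \<Longrightarrow> C t \<le> k T" by metis
  \<comment> \<open>One constant for both growth bounds: it dominates \<open>C t\<close> and also
    \<open>C t\<close> times the sum of the \<open>c i\<close>. The absolute value is there because
    no sign is imposed on that sum.\<close>
  define K where "K T = k T * (1 + \<bar>suminf c\<bar>)" for T
  \<comment> \<open>At \<open>\<phi> = 0\<close> the growth bound reads
    \<open>(norm (A t 0))\<^sup>2 \<le> C t\<close>.\<close>
  have C0: "0 \<le> C t" if "0 \<le> t" for t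
    using order_trans[OF zero_le_power2 assms(8)[OF that, of 0]] by simp
  have kK: "k T \<le> K T" "k T * \<bar>suminf c\<bar> \<le> K T" "0 \<le> K T" for T
    using k(1)[of T] by (auto simp: K_def distrib_left)
  \<comment> \<open>Measurability into \<open>hs_borel e\<close> carries this information, since the
    space of that measure consists of the Hilbert-Schmidt operators only.\<close>
  have HS: "G t \<phi> \<in> hilbert_schmidt e" if "0 \<le> t" for t \<phi>
    using measurable_space[OF assms(6)[of "t + 1"], of "(t, \<phi>)"] that
    by (simp add: space_pair_measure space_restrict_space space_hs_borel)
  have sumG: "summable (\<lambda>i. (norm (g i t \<phi>))\<^sup>2)" if "0 \<le> t" for t \<phi>
    using HS[OF that] by (simp add: hilbert_schmidt_def g_def)
  have A_growth: "(norm (A t \<phi>))\<^sup>2 \<le> K T * (1 + (norm \<phi>)\<^sup>2)" if t: "0 \<le> t" "t \<le> T" for T t \<phi>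
  proof -
    have "C t \<le> K T" using k(2)[of t T] kK(1)[of T] t by auto
    then show ?thesis by (intro order_trans[OF assms(8)[OF t(1)]] mult_right_mono) auto
  qed
  have g_growth: "(\<Sum>i. ennreal ((norm (g i t \<phi>))\<^sup>2)) \<le> ennreal (K T * (1 + (norm \<phi>)\<^sup>2))" if t: "0 \<le> t" "t \<le> T" for T t \<phi>
  proof -
    have "(\<Sum>i. (norm (g i t \<phi>))\<^sup>2) \<le> (\<Sum>i. C t * c i * (1 + (norm \<phi>)\<^sup>2))"
      using assms(9)[OF t(1)] sumG[OF t(1)] assms(10) unfolding g_def
      by (intro suminf_le summable_mult summable_mult2) auto
    also have "\<dots> = C t * suminf c * (1 + (norm \<phi>)\<^sup>2)"
      using assms(10) by (simp add: suminf_mult2[symmetric] suminf_mult summable_mult)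
    also have "\<dots> \<le> K T * (1 + (norm \<phi>)\<^sup>2)"
    proof (rule mult_right_mono)
      have "C t * suminf c \<le> C t * \<bar>suminf c\<bar>" using C0[OF t(1)] by (intro mult_left_mono) auto
      also have "\<dots> \<le> k T * \<bar>suminf c\<bar>" using k(2)[of t T] t by (intro mult_right_mono) auto
      also have "\<dots> \<le> K T" by (rule kK)
      finally show "C t * suminf c \<le> K T" .
    qed simp
    finally show ?thesis by (subst suminf_ennreal2[OF _ sumG[OF t(1)]]) (simp_all only: ennreal_leI zero_le_power2)
  qed
  \<comment> \<open>The Lipschitz hypothesis bounds a real \<open>suminf\<close>, which controls the
    series only when it converges; the Hilbert-Schmidt property supplies the convergence.\<close>
  have sumD: "summable (\<lambda>i. (norm (g i t \<phi> - g i t \<psi>))\<^sup>2)" if "0 \<le> t" for t \<phi> \<psi>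
    using hilbert_schmidt_diff[OF HS[OF that] HS[OF that], of \<phi> \<psi>]
    by (simp add: hilbert_schmidt_def g_def blinfun.diff_left)
  have lip: "(norm (A t \<phi> - A t \<psi>))\<^sup>2 + (\<Sum>i. (norm (g i t \<phi> - g i t \<psi>))\<^sup>2) \<le> K T * (norm (\<phi> - \<psi>))\<^sup>2"
    if t: "0 \<le> t" "t \<le> T" for T t \<phi> \<psi>
  proof -
    have "C t \<le> K T" using k(2)[of t T] kK(1)[of T] t by auto
    then show ?thesis unfolding g_def by (intro order_trans[OF assms(11)[OF t(1)]] mult_right_mono) auto
  qed
  have sumD0: "0 \<le> (\<Sum>i. (norm (g i t \<phi> - g i t \<psi>))\<^sup>2)" if "0 \<le> t" for t \<phi> \<psi>
    by (intro suminf_nonneg sumD that) simp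
  interpret S: sde M F W A g K \<Phi>\<^sub>0
  proof (intro sde.intro sde_axioms.intro cylindrical_bm_axioms assms(5) A_growth g_growth kK(3) assms(12))
    fix i and T :: real assume "T > 0"
    from measurable_compose[OF assms(6)[OF this] measurable_hs_apply]
    show "(\<lambda>(t, \<phi>). g i t \<phi>) \<in> restrict_space borel {0..T} \<Otimes>\<^sub>M borel \<rightarrow>\<^sub>M borel"
      by (simp add: g_def case_prod_unfold)
  next
    fix T t :: real and \<phi> \<psi> assume t: "0 \<le> t" "t \<le> T"
    show "(norm (A t \<phi> - A t \<psi>))\<^sup>2 \<le> K T * (norm (\<phi> - \<psi>))\<^sup>2"
      using lip[OF t, of \<phi> \<psi>] sumD0[OF t(1), of \<phi> \<psi>] by linarith
    have "(\<Sum>i. (norm (g i t \<phi> - g i t \<psi>))\<^sup>2) \<le> K T * (norm (\<phi> - \<psi>))\<^sup>2"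
      using lip[OF t, of \<phi> \<psi>] zero_le_power2[of "norm (A t \<phi> - A t \<psi>)"] by linarith
    then show "(\<Sum>i. ennreal ((norm (g i t \<phi> - g i t \<psi>))\<^sup>2)) \<le> ennreal (K T * (norm (\<phi> - \<psi>))\<^sup>2)"
      by (subst suminf_ennreal2[OF _ sumD[OF t(1)]]) (simp_all only: ennreal_leI zero_le_power2)
  next
    show "(\<integral>\<^sup>+\<omega>. ennreal ((norm (\<Phi>\<^sub>0 \<omega>))\<^sup>2) \<partial>M) < \<infinity>"
      using assms(13) by (simp add: integrable_iff_bounded)
  qed
  obtain \<Phi> where \<Phi>: "admissible \<Phi>" "S.step \<Phi> \<Phi>" using S.solution_exists by blast
  have p: "progressively_measurable F borel \<Phi>" using \<Phi>(1) by (simp add: admissible_def)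
  obtain X where X: "ito_process (\<lambda>i s \<omega>. g i s (\<Phi> s \<omega>)) X"
    "\<And>t. 0 \<le> t \<Longrightarrow> AE \<omega> in M. set_integrable lborel {0..t} (\<lambda>s. A s (\<Phi> s \<omega>)) \<and>
       \<Phi> t \<omega> = \<Phi>\<^sub>0 \<omega> + (LINT s:{0..t}|lborel. A s (\<Phi> s \<omega>)) + X t \<omega>"
    using \<Phi>(2) unfolding S.step_def by blast
  let ?B = "\<lambda>s \<omega>. G s (\<Phi> s \<omega>)"
  have "square_integrable_process M F e ?B"
    unfolding square_integrable_process_def
  proof (intro conjI allI impI)
    show "progressively_measurable F (hs_borel e) ?B" by (rule progressive_compose[OF assms(6) p])
    fix T :: real assume T: "0 < T"
    have "(\<integral>\<^sup>+\<omega>. hs_energy e ?B T \<omega> \<partial>M) \<le> (\<integral>\<^sup>+\<omega>. (\<integral>\<^sup>+s\<in>{0..T}. ennreal (K T * (1 + (norm (\<Phi> s \<omega>))\<^sup>2)) \<partial>lborel) \<partial>M)"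
      unfolding hs_energy_def
    proof (intro nn_integral_mono)
      fix \<omega> s
      show "ennreal ((hs_norm e (?B s \<omega>))\<^sup>2) * indicator {0..T} s \<le> ennreal (K T * (1 + (norm (\<Phi> s \<omega>))\<^sup>2)) * indicator {0..T} s"
      proof (cases "s \<in> {0..T}")
        case True
        then have s: "0 \<le> s" "s \<le> T" by auto
        have "ennreal ((hs_norm e (?B s \<omega>))\<^sup>2) \<le> ennreal (K T * (1 + (norm (\<Phi> s \<omega>))\<^sup>2))"
          unfolding hs_norm_sq[OF HS[OF s(1)]] using g_growth[OF s] by (simp add: g_def)
        then show ?thesis by (rule mult_right_mono) simp
      qed simp
    qed
    then show "(\<integral>\<^sup>+\<omega>. hs_energy e ?B T \<omega> \<partial>M) < \<infinity>"
      using S.growth_finite[OF \<Phi>(1), of T] T by (auto intro: order.strict_trans1)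
  qed
  then have I: "has_cylindrical_integral M F e W ?B t (X t)" if "0 \<le> t" for t
    using has_cylindrical_integral_ito_process[of e ?B X t] X(1) S.g_ito_integrand[OF \<Phi>(1)] that
    unfolding g_def by blast
  have "AE \<omega> in M. \<forall>T>0. continuous_on {0..T} (\<lambda>t. \<Phi> t \<omega>)"
  proof (rule AE_I2, intro allI impI)
    fix \<omega> and T :: real assume "\<omega> \<in> space M"
    then have "continuous_on {0..} (\<lambda>t. \<Phi> t \<omega>)" using \<Phi>(2) by (simp add: S.step_def)
    then show "continuous_on {0..T} (\<lambda>t. \<Phi> t \<omega>)" by (rule continuous_on_subset) auto
  qed
  then show ?thesis using p I X(2) by blast
qed

end
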